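(* Let $A$ be a formula. Then $\langle A\rangle\in\mathrm{BL\text{-}TAUT}$ (i.e. $\mathbf{BL}\vdash A$) if and only if the algorithm CheckTautology outputs ``Yes'' on input $\langle A\rangle$.
   Context: Formulas are built from the constant $\bot$ and propositional variables $p_0,p_1,\dots$ by the binary connectives $\odot,\rightarrow$. $c(A)$ is the number of connective occurrences in $A$. The symbol $\top$ stands for $\bot\rightarrow\bot$ and is treated as an atomic constant. Atomic formulas are the variables, $\bot$ and $\top$. $A<_cB$ means $c(A)<c(B)$, or $c(A)=c(B)$ and $A$ precedes $B$ in a fixed lexicographic order. $\langle\cdot\rangle$ is the standard binary (ASCII) encoding. $\mathbf{BL}$ is the Hilbert system with modus ponens and the axiom schemata: - (A1) $(A\rightarrow B)\rightarrow((B\rightarrow C)\rightarrow(A\rightarrow C))$; - (A2) $(A\odot B)\rightarrow A$; - (A3) $(A\odot B)\rightarrow(B\odot A)$; - (A4) $(A\odot(A\rightarrow B))\rightarrow(B\odot(B\rightarrow A))$; - (A5) $(A\rightarrow(B\rightarrow C))\leftrightarrow((A\odot B)\rightarrow C)$, where $X\leftrightarrow Y$ abbreviates $(X\rightarrow Y)\odot(Y\rightarrow X)$; - (A6) $((A\rightarrow B)\rightarrow C)\rightarrow(((B\rightarrow A)\rightarrow C)\rightarrow C)$; - (A7) $\bot\rightarrow A$. $\mathrm{BL\text{-}TAUT}=\{\langle A\rangle:\mathbf{BL}\vdash A\}$. The algebra $(\omega)[0,1]$ has universe $[0,+\infty]$; $\lfloor x\rfloor$ is the integer part of $x$ and $\lfloor+\infty\rfloor=+\infty$.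 Its operations are: $x*y=\min(x,y)$ if $\lfloor x\rfloor\ne\lfloor y\rfloor$; $x*y=\max(\lfloor x\rfloor,x+y-\lfloor x\rfloor-1)$ if $\lfloor x\rfloor=\lfloor y\rfloor<+\infty$; $x*y=+\infty$ if $x=y=+\infty$. Further, $x\Rightarrow y=y$ if $\lfloor y\rfloor<\lfloor x\rfloor$; $x\Rightarrow y=\lfloor x\rfloor+1-x+y$ if $\lfloor x\rfloor=\lfloor y\rfloor$ and $y<x$; $x\Rightarrow y=+\infty$ if $x\le y$. A valuation $v$ has $v(\bot)=0$ and $v(p_i)\in[0,+\infty]$, with $v(A\odot B)=v(A)*v(B)$ and $v(A\rightarrow B)=v(A)\Rightarrow v(B)$; so $v(\top)=+\infty$. For finite $v(A)$, $\bar v(A)=v(A)-\lfloor v(A)\rfloor$. A relational sequent is $\Gamma\triangleleft\Delta$, with $\Gamma,\Delta$ finite multisets of formulas and $\triangleleft\in\{\ll\}\cup\{\preccurlyeq_z,\prec_z:z\in\mathbb Z\}$; if $\triangleleft$ is $\ll$ then $|\Gamma|,|\Delta|\le1$. We write $\preccurlyeq,\prec$ for index $0$. A relational hypersequent is a finite set of relational sequents, written $S_1|\dots|S_k$, where $|$ also denotes union. It is irreducible if all formulas are atomic. $v$ satisfies a hypersequent iff it satisfies one of its sequents. It satisfies: - $A\ll B$ iff $\lfloor v(A)\rfloor<\lfloor v(B)\rfloor$; - $A\preccurlyeq B$ (single formulas, index $0$) iff $\lfloor v(A)\rfloor=\lfloor v(B)\rfloor$ and $v(A)\le v(B)$; $A\prec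 B$ likewise with $<$; - $A_1,\dots,A_k\preccurlyeq_zB_1,\dots,B_m$ ($k+m\ge2$, $z\ne0$ if $k+m=2$) iff all integer parts $\lfloor v(A_i)\rfloor,\lfloor v(B_j)\rfloor$ are equal and finite and $\sum\bar v(A_i)-k\le\sum\bar v(B_j)-m+z$; for $\prec_z$ use $<$. No other sequent is satisfied. A hypersequent is valid if all valuations satisfy it. Abbreviations (each a hypersequent): - $\overline{A\ll B}=A\preccurlyeq B|B\preccurlyeq A|B\ll A$; - $\overline{A\le B}=B\prec A|B\ll A$; - $\overline{A\preccurlyeq B}=A\ll B|B\prec A|B\ll A$; - $\overline{A\prec B}=A\ll B|B\preccurlyeq A|B\ll A$; - $\overline{A\sim B}=A\ll B|B\ll A$; - $\overline{\preccurlyeq_1A,B}=\overline{A\sim B}|\overline{A\ll\top}|\overline{B\ll\top}|A,B\prec_{-1}$; - $\overline{A,B\prec_{-1}}=\overline{A\sim B}|\overline{A\ll\top}|\overline{B\ll\top}|\preccurlyeq_1A,B$. Antecedents: - $I_{\odot_1}=\overline{A\ll B}$, $I_{\odot_2}=\overline{B\ll A}$, $I_{\odot_3}=\overline{\preccurlyeq_1A,B}$, $I_{\odot_4}=\overline{A,B\prec_{-1}}$, $I_{\odot_5}=\overline{\top\preccurlyeq A}|\overline{\top\preccurlyeq B}$; - $I_{\rightarrow_1}=\overline{B\ll A}$, $I_{\rightarrow_2}=\overline{B\prec A}$, $I_{\rightarrow_3}=\overline{A\le B}$. Rewriting rules. Let $G$ be a relational hypersequent whose most complex formula w.r.t. $<_c$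 is the pivot $A\circ B$. Let: - $H$ be the set of sequents of $G$ not containing $A\circ B$; - $G'$ be the set of $\ll$-sequents containing it; - $G''$ be the set of $\preccurlyeq_z/\prec_z$-sequents containing it; - $G'''\subseteq G''$ be those with relation $\preccurlyeq$ (index $0$) and at most one formula per side. Let $C=A$ if $A<_cB$, else $C=B$. Substitutions act on each sequent: - $X(D\Leftarrow E)$ replaces every occurrence of $D$ by $E$; - $X(D\Leftarrow E,E')$ replaces every occurrence of $D$ by $E,E'$; - for $l$ left and $r$ right occurrences of $A\odot B$, $(A\odot B\Leftarrow A,B\triangleleft_{+l-r}A,B)$ deletes them, adds one copy of $A,B$ on each side, and changes index $z$ to $z+l-r$; - for $l$ left and $r$ right occurrences of $A\rightarrow B$, $(A\rightarrow B\Leftarrow A^r,B^l\triangleleft A^l,B^r)$ deletes them, adds $r$ copies of $A$ and $l$ of $B$ on the left, and $l$ of $A$ and $r$ of $B$ on the right. Premises of $(\odot)$, in order, are $I_{\odot_i}|G_{\odot_i}$ with: - $G_{\odot_1}=G(A\odot B\Leftarrow A)|H$; - $G_{\odot_2}=G(A\odot B\Leftarrow B)|H$; - $G_{\odot_3}=G'(A\odot B\Leftarrow C)|G''(A\odot B\Leftarrow A,B)|H$; - $G_{\odot_4}=G'(A\odot B\Leftarrow C)|G''(A\odot B\Leftarrow A,B\triangleleft_{+l-r}A,B)|H$; - $G_{\odot_5}=G'(A\odot B\Leftarrow\top)|G'''(A\odot B\Leftarrow\top)|H$. Premises of $(\rightarrow)$ are $I_{\rightarrow_i}|G_{\rightarrow_i}$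 with: - $G_{\rightarrow_1}=G(A\rightarrow B\Leftarrow B)|H$; - $G_{\rightarrow_2}=G'(A\rightarrow B\Leftarrow C)|G''(A\rightarrow B\Leftarrow A^r,B^l\triangleleft A^l,B^r)|H$; - $G_{\rightarrow_3}=G'(A\rightarrow B\Leftarrow\top)|G'''(A\rightarrow B\Leftarrow\top)|H$. The $\mathbf{RWBL}$ reduction $T_A$: the root is labeled $\top\preccurlyeq A$; a node with irreducible label is a leaf; a node with reducible label $G$ has as children, in order, nodes labeled by the premises of the rewriting rule whose conclusion is $G$ and whose pivot is the most complex formula of $G$. The algorithm CheckTautology, on input $\langle A\rangle$, builds $T_A$ by repeatedly expanding reducible leaves until all leaves are irreducible. It then checks whether every leaf label is valid, outputting ``Yes'' if all are and ``No'' otherwise. *)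

theory Defs
  imports
    Complex_Main
    "HOL-Library.Multiset"
    "HOL-Library.FSet"
    "HOL-Library.Extended_Real"
    "HOL-Library.While_Combinator"
begin
datatype fm =
    Bot
  | Var nat
  | Conj fm fm  (infixr "\<^bold>\<odot>" 75)
  | Imp fm fm  (infixr "\<^bold>\<rightarrow>" 70)

abbreviation Top :: fm where
  "Top \<equiv> Bot \<^bold>\<rightarrow> Bot"

abbreviation Iff :: "fm \<Rightarrow> fm \<Rightarrow> fm" where
  "Iff X Y \<equiv> (X \<^bold>\<rightarrow> Y) \<^bold>\<odot> (Y \<^bold>\<rightarrow> X)"

definition atomic :: "fm \<Rightarrow> bool" where
  "atomic A \<longleftrightarrow> A = Bot \<or> A = Top \<or> (\<exists>i. A = Var i)"

text \<open>Number of connective occurrences. Since \<open>Top\<close> counts as an atomic constant, the arrow it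
  abbreviates is not counted; hence the atomic formulas are exactly those of complexity 0.\<close>

fun complexity :: "fm \<Rightarrow> nat" where
  "complexity Bot = 0"
| "complexity (Var i) = 0"
| "complexity (A \<^bold>\<odot> B) = complexity A + complexity B + 1"
| "complexity (A \<^bold>\<rightarrow> B) =
     (if A = Bot \<and> B = Bot then 0 else complexity A + complexity B + 1)"

text \<open>Formulas are written as ASCII strings: \<open>F\<close> for falsum, \<open>p\<close> followed by the decimal index for
  variables, and \<open>(A&B)\<close>, \<open>(A->B)\<close> for compound formulas. The binary code of a formula is its string
  with every character replaced by its 8-bit code, most significant bit first.\<close>

fun decimal :: "nat \<Rightarrow> string" where
  "decimal n = (if n < 10 then [char_of (48 + n)]
                else decimal (n div 10) @ [char_of (48 + n mod 10)])"

declare decimal.simps [simp del]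

primrec fm_string :: "fm \<Rightarrow> string" where
  "fm_string Bot = ''F''"
| "fm_string (Var i) = ''p'' @ decimal i"
| "fm_string (A \<^bold>\<odot> B) = ''('' @ fm_string A @ ''&'' @ fm_string B @ '')''"
| "fm_string (A \<^bold>\<rightarrow> B) = ''('' @ fm_string A @ ''->'' @ fm_string B @ '')''"

definition char_bits :: "char \<Rightarrow> bool list" where
  "char_bits c = [digit7 c, digit6 c, digit5 c, digit4 c, digit3 c, digit2 c, digit1 c, digit0 c]"

definition encode :: "fm \<Rightarrow> bool list" where
  "encode A = concat (map char_bits (fm_string A))"

text \<open>The fixed lexicographic order is that of the ASCII strings.\<close>

definition less_c :: "fm \<Rightarrow> fm \<Rightarrow> bool"  (infix "<\<^sub>c" 50) where
  "A <\<^sub>c B \<longleftrightarrow> complexity A < complexity B \<or>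
     complexity A = complexity B \<and>
     (fm_string A, fm_string B) \<in> lexord {(x, y). (of_char x :: nat) < of_char y}"

inductive BL_provable :: "fm \<Rightarrow> bool"  ("BL \<turnstile> _" [50] 50) where
  A1: "BL \<turnstile> (A \<^bold>\<rightarrow> B) \<^bold>\<rightarrow> ((B \<^bold>\<rightarrow> C) \<^bold>\<rightarrow> (A \<^bold>\<rightarrow> C))"
| A2: "BL \<turnstile> (A \<^bold>\<odot> B) \<^bold>\<rightarrow> A"
| A3: "BL \<turnstile> (A \<^bold>\<odot> B) \<^bold>\<rightarrow> (B \<^bold>\<odot> A)"
| A4: "BL \<turnstile> (A \<^bold>\<odot> (A \<^bold>\<rightarrow> B)) \<^bold>\<rightarrow> (B \<^bold>\<odot> (B \<^bold>\<rightarrow> A))"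
| A5: "BL \<turnstile> Iff (A \<^bold>\<rightarrow> (B \<^bold>\<rightarrow> C)) ((A \<^bold>\<odot> B) \<^bold>\<rightarrow> C)"
| A6: "BL \<turnstile> ((A \<^bold>\<rightarrow> B) \<^bold>\<rightarrow> C) \<^bold>\<rightarrow> (((B \<^bold>\<rightarrow> A) \<^bold>\<rightarrow> C) \<^bold>\<rightarrow> C)"
| A7: "BL \<turnstile> Bot \<^bold>\<rightarrow> A"
| MP: "BL \<turnstile> A \<Longrightarrow> BL \<turnstile> A \<^bold>\<rightarrow> B \<Longrightarrow> BL \<turnstile> B"

definition BL_TAUT :: "bool list set" where
  "BL_TAUT = {encode A | A. BL \<turnstile> A}"

definition ipart :: "ereal \<Rightarrow> ereal" where
  "ipart x = (if x = \<infinity> then \<infinity> else ereal (of_int \<lfloor>real_of_ereal x\<rfloor>))"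

definition op_conj :: "ereal \<Rightarrow> ereal \<Rightarrow> ereal" where
  "op_conj x y =
     (if ipart x \<noteq> ipart y then min x y
      else if ipart x < \<infinity> then max (ipart x) (x + y - ipart x - 1)
      else \<infinity>)"

text \<open>The last case below is exactly \<open>x \<le> y\<close>.\<close>

definition op_imp :: "ereal \<Rightarrow> ereal \<Rightarrow> ereal" where
  "op_imp x y =
     (if ipart y < ipart x then y
      else if ipart x = ipart y \<and> y < x then ipart x + 1 - x + y
      else \<infinity>)"

definition valuation :: "(fm \<Rightarrow> ereal) \<Rightarrow> bool" where
  "valuation v \<longleftrightarrow>
     v Bot = 0 \<and>
     (\<forall>i. v (Var i) \<in> {0..\<infinity>}) \<and>
     (\<forall>A B. v (A \<^bold>\<odot> B) = op_conj (v A) (v B)) \<and>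
     (\<forall>A B. v (A \<^bold>\<rightarrow> B) = op_imp (v A) (v B))"

text \<open>Only meaningful when \<open>v A\<close> is finite.\<close>

definition fpart :: "(fm \<Rightarrow> ereal) \<Rightarrow> fm \<Rightarrow> real" where
  "fpart v A = frac (real_of_ereal (v A))"

datatype cmp = Preceq | Prec

text \<open>The sides of a \<open>\<lless>\<close>-sequent are multisets with at most one element, rendered as options;
  \<open>Cmp Preceq z \<Gamma> \<Delta>\<close> and \<open>Cmp Prec z \<Gamma> \<Delta>\<close> are the sequents whose relation carries the index \<open>z\<close>.\<close>

datatype 'a rseq =
    LL "'a option" "'a option"
  | Cmp cmp int "'a multiset" "'a multiset"

type_synonym hyperseq = "fm rseq fset"

definition formulas :: "hyperseq \<Rightarrow> fm set" where
  "formulas G = (\<Union>S \<in> fset G. set_rseq S)"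

definition irreducible_hs :: "hyperseq \<Rightarrow> bool" where
  "irreducible_hs G \<longleftrightarrow> (\<forall>A \<in> formulas G. atomic A)"

fun cmp_holds :: "cmp \<Rightarrow> 'b::linorder \<Rightarrow> 'b \<Rightarrow> bool" where
  "cmp_holds Preceq x y \<longleftrightarrow> x \<le> y"
| "cmp_holds Prec x y \<longleftrightarrow> x < y"

fun sat_seq :: "(fm \<Rightarrow> ereal) \<Rightarrow> fm rseq \<Rightarrow> bool" where
  "sat_seq v (LL \<Gamma> \<Delta>) \<longleftrightarrow>
     (\<exists>A B. \<Gamma> = Some A \<and> \<Delta> = Some B \<and> ipart (v A) < ipart (v B))"
| "sat_seq v (Cmp R z \<Gamma> \<Delta>) \<longleftrightarrow>
     (\<exists>A B. \<Gamma> = {#A#} \<and> \<Delta> = {#B#} \<and> z = 0 \<and>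
        ipart (v A) = ipart (v B) \<and> cmp_holds R (v A) (v B)) \<or>
     (size \<Gamma> + size \<Delta> \<ge> 2 \<and> (size \<Gamma> + size \<Delta> = 2 \<longrightarrow> z \<noteq> 0) \<and>
        (\<exists>n::int. \<forall>A \<in># \<Gamma> + \<Delta>. ipart (v A) = ereal (of_int n)) \<and>
        cmp_holds R
          ((\<Sum>A \<in># \<Gamma>. fpart v A) - real (size \<Gamma>))
          ((\<Sum>B \<in># \<Delta>. fpart v B) - real (size \<Delta>) + real_of_int z))"

definition sat :: "(fm \<Rightarrow> ereal) \<Rightarrow> hyperseq \<Rightarrow> bool" where
  "sat v G \<longleftrightarrow> (\<exists>S. S |\<in>| G \<and> sat_seq v S)"

definition valid :: "hyperseq \<Rightarrow> bool" where
  "valid G \<longleftrightarrow> (\<forall>v. valuation v \<longrightarrow> sat v G)"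

abbreviation seq_ll :: "fm \<Rightarrow> fm \<Rightarrow> fm rseq"  (infix "\<lless>" 50) where
  "A \<lless> B \<equiv> LL (Some A) (Some B)"

abbreviation seq_preceq :: "fm \<Rightarrow> fm \<Rightarrow> fm rseq"  (infix "\<preceq>\<^sub>0" 50) where
  "A \<preceq>\<^sub>0 B \<equiv> Cmp Preceq 0 {#A#} {#B#}"

abbreviation seq_prec :: "fm \<Rightarrow> fm \<Rightarrow> fm rseq"  (infix "\<prec>\<^sub>0" 50) where
  "A \<prec>\<^sub>0 B \<equiv> Cmp Prec 0 {#A#} {#B#}"

text \<open>The overlined hypersequents: \<open>not_X A B\<close> is satisfied exactly when the overlined relation \<open>X\<close>
  between \<open>A\<close> and \<open>B\<close> does not hold.\<close>

definition not_ll :: "fm \<Rightarrow> fm \<Rightarrow> hyperseq" where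
  "not_ll A B = {| A \<preceq>\<^sub>0 B, B \<preceq>\<^sub>0 A, B \<lless> A |}"

definition not_le :: "fm \<Rightarrow> fm \<Rightarrow> hyperseq" where
  "not_le A B = {| B \<prec>\<^sub>0 A, B \<lless> A |}"

definition not_preceq :: "fm \<Rightarrow> fm \<Rightarrow> hyperseq" where
  "not_preceq A B = {| A \<lless> B, B \<prec>\<^sub>0 A, B \<lless> A |}"

definition not_prec :: "fm \<Rightarrow> fm \<Rightarrow> hyperseq" where
  "not_prec A B = {| A \<lless> B, B \<preceq>\<^sub>0 A, B \<lless> A |}"

definition not_sim :: "fm \<Rightarrow> fm \<Rightarrow> hyperseq" where
  "not_sim A B = {| A \<lless> B, B \<lless> A |}"

text \<open>Negation of \<open>\<preceq>\<^sub>1 A, B\<close> (empty left-hand side).\<close>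

definition not_preceq1 :: "fm \<Rightarrow> fm \<Rightarrow> hyperseq" where
  "not_preceq1 A B = not_sim A B |\<union>| not_ll A Top |\<union>| not_ll B Top |\<union>|
     {| Cmp Prec (- 1) {#A, B#} {#} |}"

text \<open>Negation of \<open>A, B \<prec>\<^sub>-\<^sub>1\<close> (empty right-hand side).\<close>

definition not_precm1 :: "fm \<Rightarrow> fm \<Rightarrow> hyperseq" where
  "not_precm1 A B = not_sim A B |\<union>| not_ll A Top |\<union>| not_ll B Top |\<union>|
     {| Cmp Preceq 1 {#} {#A, B#} |}"

definition part_H :: "hyperseq \<Rightarrow> fm \<Rightarrow> hyperseq" where
  "part_H G D = ffilter (\<lambda>S. D \<notin> set_rseq S) G"

definition part_G1 :: "hyperseq \<Rightarrow> fm \<Rightarrow> hyperseq" where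
  "part_G1 G D = ffilter (\<lambda>S. D \<in> set_rseq S \<and> (\<exists>\<Gamma> \<Delta>. S = LL \<Gamma> \<Delta>)) G"

definition part_G2 :: "hyperseq \<Rightarrow> fm \<Rightarrow> hyperseq" where
  "part_G2 G D = ffilter (\<lambda>S. D \<in> set_rseq S \<and> (\<exists>R z \<Gamma> \<Delta>. S = Cmp R z \<Gamma> \<Delta>)) G"

definition part_G3 :: "hyperseq \<Rightarrow> fm \<Rightarrow> hyperseq" where
  "part_G3 G D =
     ffilter (\<lambda>S. \<exists>\<Gamma> \<Delta>. S = Cmp Preceq 0 \<Gamma> \<Delta> \<and> size \<Gamma> \<le> 1 \<and> size \<Delta> \<le> 1) (part_G2 G D)"

text \<open>The substitutions replace occurrences of the pivot \<open>D\<close> as a member of a side of a sequent; a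
  most complex formula is never a proper subformula of another member. The last three substitutions
  are only ever applied to \<open>Cmp\<close>-sequents, so their value on \<open>LL\<close>-sequents is irrelevant.\<close>

definition subst1 :: "fm \<Rightarrow> fm \<Rightarrow> fm rseq \<Rightarrow> fm rseq" where
  "subst1 D E = map_rseq (\<lambda>F. if F = D then E else F)"

abbreviation delete_all :: "fm \<Rightarrow> fm multiset \<Rightarrow> fm multiset" where
  "delete_all D \<Gamma> \<equiv> filter_mset (\<lambda>F. F \<noteq> D) \<Gamma>"

fun subst2 :: "fm \<Rightarrow> fm \<Rightarrow> fm \<Rightarrow> fm rseq \<Rightarrow> fm rseq" where
  "subst2 D E E' (LL \<Gamma> \<Delta>) = LL \<Gamma> \<Delta>"
| "subst2 D E E' (Cmp R z \<Gamma> \<Delta>) =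
     Cmp R z (delete_all D \<Gamma> + repeat_mset (count \<Gamma> D) {#E, E'#})
             (delete_all D \<Delta> + repeat_mset (count \<Delta> D) {#E, E'#})"

fun subst_conj_shift :: "fm \<Rightarrow> fm \<Rightarrow> fm rseq \<Rightarrow> fm rseq" where
  "subst_conj_shift A B (LL \<Gamma> \<Delta>) = LL \<Gamma> \<Delta>"
| "subst_conj_shift A B (Cmp R z \<Gamma> \<Delta>) =
     (let D = A \<^bold>\<odot> B; l = count \<Gamma> D; r = count \<Delta> D
      in Cmp R (z + int l - int r) (delete_all D \<Gamma> + {#A, B#}) (delete_all D \<Delta> + {#A, B#}))"

fun subst_imp :: "fm \<Rightarrow> fm \<Rightarrow> fm rseq \<Rightarrow> fm rseq" where
  "subst_imp A B (LL \<Gamma> \<Delta>) = LL \<Gamma> \<Delta>"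
| "subst_imp A B (Cmp R z \<Gamma> \<Delta>) =
     (let D = A \<^bold>\<rightarrow> B; l = count \<Gamma> D; r = count \<Delta> D
      in Cmp R z (delete_all D \<Gamma> + replicate_mset r A + replicate_mset l B)
                 (delete_all D \<Delta> + replicate_mset l A + replicate_mset r B))"

definition least_of :: "fm \<Rightarrow> fm \<Rightarrow> fm" where
  "least_of A B = (if A <\<^sub>c B then A else B)"

definition conj_premises :: "hyperseq \<Rightarrow> fm \<Rightarrow> fm \<Rightarrow> hyperseq list" where
  "conj_premises G A B =
     (let D = A \<^bold>\<odot> B; C = least_of A B;
          H = part_H G D; G1 = part_G1 G D; G2 = part_G2 G D; G3 = part_G3 G D
      in [not_ll A B |\<union>| (subst1 D A |`| G |\<union>| H),
          not_ll B A |\<union>| (subst1 D B |`| G |\<union>| H),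
          not_preceq1 A B |\<union>| (subst1 D C |`| G1 |\<union>| subst2 D A B |`| G2 |\<union>| H),
          not_precm1 A B |\<union>| (subst1 D C |`| G1 |\<union>| subst_conj_shift A B |`| G2 |\<union>| H),
          (not_preceq Top A |\<union>| not_preceq Top B) |\<union>|
            (subst1 D Top |`| G1 |\<union>| subst1 D Top |`| G3 |\<union>| H)])"

definition imp_premises :: "hyperseq \<Rightarrow> fm \<Rightarrow> fm \<Rightarrow> hyperseq list" where
  "imp_premises G A B =
     (let D = A \<^bold>\<rightarrow> B; C = least_of A B;
          H = part_H G D; G1 = part_G1 G D; G2 = part_G2 G D; G3 = part_G3 G D
      in [not_ll B A |\<union>| (subst1 D B |`| G |\<union>| H),
          not_prec B A |\<union>| (subst1 D C |`| G1 |\<union>| subst_imp A B |`| G2 |\<union>| H),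
          not_le A B |\<union>| (subst1 D Top |`| G1 |\<union>| subst1 D Top |`| G3 |\<union>| H)])"

definition pivot :: "hyperseq \<Rightarrow> fm" where
  "pivot G = (THE D. D \<in> formulas G \<and> (\<forall>E \<in> formulas G. E \<noteq> D \<longrightarrow> E <\<^sub>c D))"

text \<open>Only used for reducible \<open>G\<close>, whose pivot is not atomic.\<close>

definition rule_premises :: "hyperseq \<Rightarrow> hyperseq list" where
  "rule_premises G =
     (case pivot G of
        A \<^bold>\<odot> B \<Rightarrow> conj_premises G A B
      | A \<^bold>\<rightarrow> B \<Rightarrow> imp_premises G A B
      | _ \<Rightarrow> [])"

datatype tree = Node hyperseq "tree list"

fun leaves :: "tree \<Rightarrow> hyperseq set" where
  "leaves (Node G ts) = (if ts = [] then {G} else (\<Union>t \<in> set ts. leaves t))"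

text \<open>One round of expansion: every reducible leaf receives its children.\<close>

fun expand :: "tree \<Rightarrow> tree" where
  "expand (Node G ts) =
     (if ts = [] then
        (if irreducible_hs G then Node G []
         else Node G (map (\<lambda>P. Node P []) (rule_premises G)))
      else Node G (map expand ts))"

text \<open>The loop starts from the root \<open>Top \<preceq>\<^sub>0 A\<close>; the result is \<open>None\<close> if it does not terminate, and
  otherwise the final tree is the reduction of \<open>A\<close>.\<close>

definition build_reduction :: "fm \<Rightarrow> tree option" where
  "build_reduction A =
     while_option (\<lambda>t. \<exists>G \<in> leaves t. \<not> irreducible_hs G) expand
       (Node {| Top \<preceq>\<^sub>0 A |} [])"

datatype answer = Yes | No

text \<open>\<open>the_inv encode\<close> decodes the input; inputs that are not codes of formulas are not considered.
  \<open>None\<close> means that the algorithm does not halt.\<close>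

definition check_tautology :: "bool list \<Rightarrow> answer option" where
  "check_tautology w =
     map_option (\<lambda>t. if \<forall>G \<in> leaves t. valid G then Yes else No)
       (build_reduction (the_inv encode w))"

end

theory Submission
  imports Defs "HOL-Algebra.FiniteProduct"
begin

text \<open>Every valuation makes exactly one antecedent of a rewriting rule fail, and under that valuation
  the corresponding premise is equivalent to the conclusion; so the leaves of the reduction are valid
  iff $\top \preccurlyeq A$ is, that is, iff $A$ takes the value $+\infty$ under all valuations.

  For completeness of BL, an unprovable formula is refuted in the Lindenbaum algebra of a prime theory,
  a BL-chain. Its elements below $1$ fall into components (two elements $a < b$ are in different ones
  iff $b \rightarrow a = a$). A component, cut off at a base element, is an MV-chain, so it sits in the
  Chang group of pairs of an integer and an element, added with carry. Fourier-Motzkin elimination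
  transfers the finitely many linear relations between the elements in question from this ordered
  group to the reals, which gives the fractional parts; the number of components below gives the
  integer parts.\<close>

section \<open>The algebra $(\omega)[0,1]$ and soundness of BL\<close>

text \<open>The obstacle is that a BL-chain need not be archimedean and its components need not have
  least elements, so a whole component need not embed into the reals. Only the finitely many values
  of the subformulas of one formula have to be mapped, and only those products and residuals that
  lie among them have to be preserved. This permits cutting a component off at a base m read from
  these values, with \<open>u \<leadsto> m\<close> as negation. The crux is
  \<open>double_neg\<close>: this negation is involutive at every u above m with
  \<open>u \<leadsto> m \<noteq> m\<close>. It gives the transitivity of sharing a component
  (\<open>far_split\<close>) as well as the cancellation on which the carry in Chang's group rests.
  Pairs are based on the half-open interval from 0, excluded, to 1: (k, u) stands for k + u - 1, so
  that 1 is neutral and the base lies one unit below it. The elimination carries strict inequalities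
  along with weak ones, because the ranks have to reflect the order and not only preserve
  it.\<close>

abbreviation pt :: "int \<Rightarrow> real \<Rightarrow> ereal" where
  "pt n a \<equiv> ereal (of_int n + a)"

section \<open>Normal forms and case tables of the two operations\<close>

lemma pt_cases:
  assumes "0 \<le> x"
  obtains "x = \<infinity>" | n a where "x = pt n a" "0 \<le> n" "0 \<le> a" "a < 1"
proof (cases x)
  case (real r)
  then have "x = pt \<lfloor>r\<rfloor> (frac r)" by (simp add: frac_def)
  then show thesis using that(2)[of "\<lfloor>r\<rfloor>" "frac r"] real assms by (simp add: frac_lt_1)
qed (use assms that in auto)

lemma ipart_pt [simp]: "0 \<le> a \<Longrightarrow> a < 1 \<Longrightarrow> ipart (pt n a) = ereal (of_int n)"
  by (simp add: ipart_def) (simp add: floor_eq_iff)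

lemma ipart_infinity [simp]: "ipart \<infinity> = \<infinity>"
  by (simp add: ipart_def)

lemma pt_le_iff:
  assumes "0 \<le> a" "a < 1" "0 \<le> b" "b < 1"
  shows "pt n a \<le> pt m b \<longleftrightarrow> n < m \<or> n = m \<and> a \<le> b"
proof -
  have "of_int n + 1 \<le> (of_int m :: real)" if "n < m" for n m :: int
    using that by (metis of_int_1 of_int_add of_int_le_iff zless_imp_add1_zle)
  from this[of n m] this[of m n] show ?thesis
    using assms by (cases n m rule: linorder_cases) auto
qed

lemma pt_less_iff:
  assumes "0 \<le> a" "a < 1" "0 \<le> b" "b < 1"
  shows "pt n a < pt m b \<longleftrightarrow> n < m \<or> n = m \<and> a < b"
  using pt_le_iff[OF assms(3,4,1,2), of m n] by (auto simp: not_le[symmetric])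

lemma op_conj_infinity [simp]: "0 \<le> x \<Longrightarrow> op_conj \<infinity> x = x" "0 \<le> x \<Longrightarrow> op_conj x \<infinity> = x"
  by (auto simp: op_conj_def min_def elim!: pt_cases)

lemma op_conj_pt:
  assumes "0 \<le> a" "a < 1" "0 \<le> b" "b < 1"
  shows "op_conj (pt n a) (pt m b) =
    (if n < m then pt n a else if m < n then pt m b else pt n (max 0 (a + b - 1)))"
proof (cases n m rule: linorder_cases)
  case equal
  then show ?thesis using assms by (auto simp: op_conj_def max_def one_ereal_def)
qed (use assms in \<open>auto simp: op_conj_def min_def pt_le_iff simp del: ereal_less_eq\<close>)

lemma op_imp_infinity [simp]: "op_imp x \<infinity> = \<infinity>"
  by (cases x) (auto simp: op_imp_def ipart_def)

lemma op_imp_infinity_left [simp]: "0 \<le> x \<Longrightarrow> op_imp \<infinity> x = x"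
  by (auto simp: op_imp_def elim!: pt_cases)

lemma op_imp_pt:
  assumes "0 \<le> a" "a < 1" "0 \<le> b" "b < 1"
  shows "op_imp (pt n a) (pt m b) =
    (if m < n then pt m b else if n = m \<and> b < a then pt n (1 - a + b) else \<infinity>)"
  using assms by (auto simp: op_imp_def)

lemma op_conj_comm: "op_conj x y = op_conj y x"
  by (auto simp: op_conj_def min_def add.commute)

lemma op_conj_nonneg: "0 \<le> x \<Longrightarrow> 0 \<le> y \<Longrightarrow> 0 \<le> op_conj x y"
  by (auto simp: op_conj_pt elim!: pt_cases)

lemma op_imp_nonneg: "0 \<le> x \<Longrightarrow> 0 \<le> y \<Longrightarrow> 0 \<le> op_imp x y"
  by (auto simp: op_imp_pt elim!: pt_cases)

lemma op_conj_assoc: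
  assumes "0 \<le> x" "0 \<le> y" "0 \<le> z"
  shows "op_conj (op_conj x y) z = op_conj x (op_conj y z)"
proof (cases "x = \<infinity> \<or> y = \<infinity> \<or> z = \<infinity>")
  case True
  then show ?thesis using assms by (auto simp: op_conj_nonneg)
next
  case False
  then obtain i j k a b c where "x = pt i a" "y = pt j b" "z = pt k c"
    and "0 \<le> a" "a < 1" "0 \<le> b" "b < 1" "0 \<le> c" "c < 1"
    using assms by (metis pt_cases)
  then show ?thesis by (auto simp: op_conj_pt max_def)
qed

text \<open>Together with \<open>op_divisibility\<close> this is where the explicit tables do their
  work: monotonicity, currying and transitivity below follow formally from these two and the monoid
  laws.\<close>

lemma op_residuation:
  assumes "0 \<le> x" "0 \<le> y" "0 \<le> z"
  shows "op_conj x y \<le> z \<longleftrightarrow> x \<le> op_imp y z"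
proof (cases "x = \<infinity> \<or> y = \<infinity> \<or> z = \<infinity>")
  case True
  then show ?thesis using assms by (elim pt_cases) (auto simp: op_imp_pt pt_le_iff)
next
  case False
  then obtain i j k a b c where "x = pt i a" "y = pt j b" "z = pt k c"
    and "0 \<le> a" "a < 1" "0 \<le> b" "b < 1" "0 \<le> c" "c < 1"
    using assms by (metis pt_cases)
  then show ?thesis
    by (auto simp: op_conj_pt op_imp_pt pt_le_iff max_def simp del: ereal_less_eq(3))
qed

lemma op_divisibility:
  assumes "0 \<le> x" "0 \<le> y"
  shows "op_conj x (op_imp x y) = min x y"
  using assms
  by (elim pt_cases) (auto simp: op_conj_pt op_imp_pt pt_le_iff min_def simp del: ereal_less_eq(3))

lemma op_imp_eq_infinity_iff:
  assumes "0 \<le> x" "0 \<le> y"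
  shows "op_imp x y = \<infinity> \<longleftrightarrow> x \<le> y"
  using op_residuation[of \<infinity> x y] assms by simp


lemma op_conj_mono:
  assumes "0 \<le> x" "0 \<le> y" "0 \<le> z" "x \<le> y"
  shows "op_conj x z \<le> op_conj y z"
proof -
  have "y \<le> op_imp z (op_conj y z)"
    using assms by (simp add: op_residuation[symmetric] op_conj_nonneg)
  then show ?thesis using assms op_residuation[of x z "op_conj y z"] by (simp add: op_conj_nonneg)
qed

lemma op_conj_le: "0 \<le> x \<Longrightarrow> 0 \<le> y \<Longrightarrow> op_conj x y \<le> x"
  using op_conj_mono[of y \<infinity> x] by (simp add: op_conj_comm)

lemma op_imp_ge: "0 \<le> x \<Longrightarrow> 0 \<le> y \<Longrightarrow> y \<le> op_imp x y"
  by (simp add: op_residuation[symmetric] op_conj_le)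

lemma op_imp_curry:
  assumes "0 \<le> x" "0 \<le> y" "0 \<le> z"
  shows "op_imp x (op_imp y z) = op_imp (op_conj x y) z"
proof (rule order_antisym)
  have "op_conj (op_imp x (op_imp y z)) (op_conj x y) \<le> z"
    using assms
    by (simp add: op_conj_assoc[symmetric] op_residuation op_imp_nonneg op_conj_nonneg)
  then show "op_imp x (op_imp y z) \<le> op_imp (op_conj x y) z"
    using assms by (simp add: op_residuation op_imp_nonneg op_conj_nonneg)
  have "op_conj (op_imp (op_conj x y) z) (op_conj x y) \<le> z"
    using assms by (simp add: op_residuation op_imp_nonneg op_conj_nonneg)
  then show "op_imp (op_conj x y) z \<le> op_imp x (op_imp y z)"
    using assms
    by (simp add: op_conj_assoc[symmetric] op_residuation op_imp_nonneg op_conj_nonneg)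
qed

lemma op_imp_trans:
  assumes "0 \<le> x" "0 \<le> y" "0 \<le> z"
  shows "op_imp x y \<le> op_imp (op_imp y z) (op_imp x z)"
proof -
  have "op_conj (op_conj (op_imp x y) (op_imp y z)) x = op_conj (min x y) (op_imp y z)"
    using assms
    by (metis op_conj_assoc op_conj_comm op_divisibility op_imp_nonneg)
  also have "\<dots> \<le> op_conj y (op_imp y z)"
    using assms by (intro op_conj_mono) (auto simp: op_imp_nonneg)
  also have "\<dots> \<le> z" using assms by (simp add: op_divisibility)
  finally show ?thesis using assms by (simp add: op_residuation op_imp_nonneg op_conj_nonneg)
qed

lemma valuation_nonneg:
  assumes "valuation v"
  shows "0 \<le> v A"
  using assms by (induction A) (auto simp: valuation_def op_conj_nonneg op_imp_nonneg)

theorem BL_sound: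
  assumes "BL \<turnstile> A" and v: "valuation v"
  shows "v A = \<infinity>"
proof -
  have [simp]: "v (B \<^bold>\<odot> C) = op_conj (v B) (v C)" "v (B \<^bold>\<rightarrow> C) = op_imp (v B) (v C)" "v Bot = 0" for B C
    using v by (auto simp: valuation_def)
  have nn [simp]: "0 \<le> v B" for B using valuation_nonneg[OF v] .
  show ?thesis
    using assms(1)
  proof induction
    case (A1 A B C)
    show ?case by (simp add: op_imp_eq_infinity_iff op_imp_nonneg op_imp_trans)
  next
    case (A2 A B)
    show ?case by (simp add: op_imp_eq_infinity_iff op_conj_nonneg op_conj_le)
  next
    case (A3 A B)
    show ?case by (simp add: op_imp_eq_infinity_iff op_conj_nonneg op_conj_comm)
  next
    case (A4 A B)
    show ?case
      by (simp add: op_imp_eq_infinity_iff op_conj_nonneg op_imp_nonneg op_divisibility min.commute)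
  next
    case (A5 A B C)
    have "op_imp x x = \<infinity>" if "0 \<le> x" for x using that by (simp add: op_imp_eq_infinity_iff)
    then show ?case by (simp add: op_imp_curry op_imp_nonneg op_conj_nonneg)
  next
    case (A6 A B C)
    show ?case
    proof (cases "v A \<le> v B")
      case True
      then have "op_imp (v A) (v B) = \<infinity>" by (simp add: op_imp_eq_infinity_iff)
      \<comment> \<open>The premise A \<rightarrow> B is true, so (A \<rightarrow> B) \<rightarrow>
        C takes the value of C, and what remains is a weakening.\<close>
      then have "v (((A \<^bold>\<rightarrow> B) \<^bold>\<rightarrow> C) \<^bold>\<rightarrow> ((B \<^bold>\<rightarrow> A) \<^bold>\<rightarrow> C) \<^bold>\<rightarrow> C) =
          op_imp (v C) (op_imp (op_imp (op_imp (v B) (v A)) (v C)) (v C))" by simp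
      also have "\<dots> = \<infinity>" by (simp add: op_imp_eq_infinity_iff op_imp_nonneg op_imp_ge)
      finally show ?thesis .
    next
      case False
      then have "op_imp (v B) (v A) = \<infinity>" by (simp add: op_imp_eq_infinity_iff)
      moreover have "op_imp (v C) (v C) = \<infinity>" by (simp add: op_imp_eq_infinity_iff)
      ultimately show ?thesis by simp
    qed
  next
    case (A7 A)
    show ?case by (simp add: op_imp_eq_infinity_iff)
  next
    case (MP A B)
    then show ?case by simp
  qed
qed

section \<open>Fourier-Motzkin elimination\<close>

text \<open>This solves for one unknown t between finitely many lower bounds \<open>L\<close> and
  upper bounds \<open>U\<close>, with \<open>S\<close> marking the strict ones. The midpoint of the
  largest lower bound a and the least upper bound b works: a strict lower bound is at most a and
  below b, hence below the midpoint, and dually.\<close>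

lemma separating_real:
  fixes L U :: "'c \<Rightarrow> real"
  assumes fin: "finite P" "finite Q"
    and le: "\<And>p q. p \<in> P \<Longrightarrow> q \<in> Q \<Longrightarrow> L p \<le> U q"
    and less: "\<And>p q. p \<in> P \<Longrightarrow> q \<in> Q \<Longrightarrow> S p \<or> S q \<Longrightarrow> L p < U q"
  obtains t where "\<And>p. p \<in> P \<Longrightarrow> L p \<le> t" "\<And>p. p \<in> P \<Longrightarrow> S p \<Longrightarrow> L p < t"
    "\<And>q. q \<in> Q \<Longrightarrow> t \<le> U q" "\<And>q. q \<in> Q \<Longrightarrow> S q \<Longrightarrow> t < U q"
proof -
  consider "P = {}" | "Q = {}" | "P \<noteq> {}" "Q \<noteq> {}" by blast
  then show thesis
  proof cases
    case 1
    \<comment> \<open>The inserted 0 keeps the minimum defined when \<open>Q\<close> is empty as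
      well.\<close>
    have "Min (insert 0 (U ` Q)) \<le> U q" if "q \<in> Q" for q using fin that by auto
    then have "Min (insert 0 (U ` Q)) - 1 < U q" if "q \<in> Q" for q using that by fastforce
    then show thesis using 1 that[of "Min (insert 0 (U ` Q)) - 1"] by (force intro: less_imp_le)
  next
    case 2
    have "L p \<le> Max (insert 0 (L ` P))" if "p \<in> P" for p using fin that by auto
    then have "L p < Max (insert 0 (L ` P)) + 1" if "p \<in> P" for p using that by fastforce
    then show thesis using 2 that[of "Max (insert 0 (L ` P)) + 1"] by (force intro: less_imp_le)
  next
    case 3
    define a b where "a = Max (L ` P)" and "b = Min (U ` Q)"
    have "a \<in> L ` P" "b \<in> U ` Q" unfolding a_def b_def using 3 fin by (auto intro: Max_in Min_in)
    then obtain p0 q0 where p0: "p0 \<in> P" "a = L p0" and q0: "q0 \<in> Q" "b = U q0" by auto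
    have a: "L p \<le> a" if "p \<in> P" for p unfolding a_def using fin that by auto
    have b: "b \<le> U q" if "q \<in> Q" for q unfolding b_def using fin that by auto
    have "a \<le> b" using le p0 q0 by simp
    show thesis
    proof (rule that[of "(a + b) / 2"])
      fix p assume p: "p \<in> P"
      show "L p \<le> (a + b) / 2" using a[OF p] \<open>a \<le> b\<close> by simp
      show "L p < (a + b) / 2" if "S p" using less[OF p q0(1)] that a[OF p] q0(2) \<open>a \<le> b\<close> by simp
    next
      fix q assume q: "q \<in> Q"
      show "(a + b) / 2 \<le> U q" using b[OF q] \<open>a \<le> b\<close> by simp
      show "(a + b) / 2 < U q" if "S q" using less[OF p0(1) q] that b[OF q] p0(2) \<open>a \<le> b\<close> by simp
    qed
  qed
qed

text \<open>The only facts about an ordered abelian group that the elimination uses are the closure under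
  addition and the totality of its set of nonnegative integer combinations.\<close>

locale nonneg_combinations =
  fixes N :: "('i \<Rightarrow> int) \<Rightarrow> bool"
  assumes add: "N c \<Longrightarrow> N d \<Longrightarrow> N (\<lambda>i. c i + d i)"
    and total: "N c \<or> N (\<lambda>i. - c i)"
begin

text \<open>By totality \<open>strict c\<close> implies \<open>N c\<close>, so this is positivity;
  if \<open>N\<close> contains both c and its opposite, then c stands for a combination of value
  zero.\<close>

abbreviation strict :: "('i \<Rightarrow> int) \<Rightarrow> bool" where
  "strict c \<equiv> \<not> N (\<lambda>i. - c i)"

lemma zero: "N (\<lambda>i. 0)"
  using total[of "\<lambda>i. 0"] by simp

lemma scale: "N c \<Longrightarrow> N (\<lambda>i. int n * c i)"
proof (induction n)
  case (Suc n)
  then show ?case using add[of c "\<lambda>i. int n * c i"] by (simp add: algebra_simps)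
qed (simp add: zero)

lemma strict_add:
  assumes "strict c" "N d"
  shows "strict (\<lambda>i. c i + d i)"
  using assms add[of "\<lambda>i. - (c i + d i)" d] by auto

lemma strict_scale:
  assumes "strict c" "0 < n"
  shows "strict (\<lambda>i. int n * c i)"
proof -
  obtain k where n: "n = Suc k" using assms(2) gr0_implies_Suc by blast
  have "N c" using assms total by blast
  then show ?thesis
    using strict_add[OF assms(1) scale[of c k]] by (simp add: n algebra_simps)
qed

text \<open>If c and its opposite are both among the constraints, whichever of them is in
  \<open>N\<close> is realized with the right strictness, so the sign of the real sum also
  determines membership in \<open>N\<close>.\<close>

definition realizes :: "('i \<Rightarrow> real) \<Rightarrow> 'i set \<Rightarrow> ('i \<Rightarrow> int) \<Rightarrow> bool" where
  "realizes r I c \<longleftrightarrow> 0 \<le> (\<Sum>i\<in>I. c i * r i) \<and> (strict c \<longrightarrow> 0 < (\<Sum>i\<in>I. c i * r i))"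

text \<open>Solved for the unknown at j, constraints with a positive coefficient are lower bounds
  and those with a negative one are upper bounds. Each pair is combined so that j cancels; a
  solution of the combined system makes every lower bound compatible with every upper bound, and
  \<open>separating_real\<close> supplies the value at j.\<close>

lemma fourier_motzkin:
  assumes "finite I" "finite C" "\<And>c. c \<in> C \<Longrightarrow> N c" "\<And>c i. c \<in> C \<Longrightarrow> i \<notin> I \<Longrightarrow> c i = 0"
  shows "\<exists>r. \<forall>c\<in>C. realizes r I c"
  using assms
proof (induction I arbitrary: C rule: finite_induct)
  case empty
  then have "c = (\<lambda>i. 0)" if "c \<in> C" for c using that by auto
  then have "\<not> strict c" if "c \<in> C" for c using that zero by fastforce
  then show ?case by (auto simp: realizes_def)
next
  case (insert j I)
  define P Q Z where "P = {c \<in> C. 0 < c j}" and "Q = {c \<in> C. c j < 0}" and "Z = {c \<in> C. c j = 0}"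
  \<comment> \<open>The pair is multiplied crosswise instead of divided, which keeps the
    coefficients integral. The multipliers are positive for c in \<open>P\<close> and d in
    \<open>Q\<close>, and pass through \<open>nat\<close> because \<open>scale\<close> takes natural
    multiples.\<close>
  define comb where "comb c d = (\<lambda>i. int (nat (- d j)) * c i + int (nat (c j)) * d i)"
    for c d :: "'i \<Rightarrow> int"
  define D where "D = Z \<union> (\<lambda>(c, d). comb c d) ` (P \<times> Q)"
  have fin: "finite P" "finite Q" "finite Z" using insert.prems(1) by (auto simp: P_def Q_def Z_def)
  have N: "N c" if "c \<in> P \<union> Q \<union> Z" for c
    using that insert.prems(2) by (auto simp: P_def Q_def Z_def)
  have comb: "N (comb c d)" "strict c \<or> strict d \<Longrightarrow> strict (comb c d)" "comb c d j = 0"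
    if "c \<in> P" "d \<in> Q" for c d
  proof -
    have cd: "0 < c j" "d j < 0" "N c" "N d" using that N by (auto simp: P_def Q_def)
    show "N (comb c d)" unfolding comb_def by (intro add scale cd)
    show "comb c d j = 0" using cd by (simp add: comb_def)
    assume "strict c \<or> strict d"
    then show "strict (comb c d)"
    proof
      assume "strict c"
      then show ?thesis unfolding comb_def using cd by (intro strict_add strict_scale scale) auto
    next
      assume "strict d"
      then have "strict (\<lambda>i. int (nat (c j)) * d i + int (nat (- d j)) * c i)"
        using cd by (intro strict_add strict_scale scale) auto
      then show ?thesis by (simp add: comb_def add.commute)
    qed
  qed
  have "\<exists>r. \<forall>c\<in>D. realizes r I c"
  proof (rule insert.IH)
    show "finite D" using fin by (simp add: D_def)
    show "N c" if "c \<in> D" for c using that N comb by (auto simp: D_def)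
    show "c i = 0" if "c \<in> D" "i \<notin> I" for c i
    proof (cases "i = j")
      case True
      then show ?thesis using that comb by (auto simp: D_def Z_def)
    next
      case False
      then have zero_i: "c' i = 0" if "c' \<in> C" for c' using that insert.prems(3) \<open>i \<notin> I\<close> by simp
      consider "c \<in> C" | a b where "a \<in> C" "b \<in> C" "c = comb a b"
        using \<open>c \<in> D\<close> by (auto simp: D_def Z_def P_def Q_def)
      then show ?thesis by cases (simp_all add: comb_def zero_i)
    qed
  qed
  then obtain r where r: "\<And>c. c \<in> D \<Longrightarrow> realizes r I c" by blast
  define val where "val c = (\<Sum>i\<in>I. c i * r i)" for c :: "'i \<Rightarrow> int"
  have val_comb: "val (comb c d) = real_of_int (- d j) * val c + real_of_int (c j) * val d"
    if "c \<in> P" "d \<in> Q" for c d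
    using that by (simp add: val_def comb_def P_def Q_def sum.distrib sum_subtractf sum_negf sum_distrib_left algebra_simps)
  have bound: "- val c / c j \<le> val d / - d j"
      "strict c \<or> strict d \<Longrightarrow> - val c / c j < val d / - d j" if "c \<in> P" "d \<in> Q" for c d
  proof -
    have pos: "0 < real_of_int (c j)" "0 < real_of_int (- d j)" using that by (auto simp: P_def Q_def)
    have "realizes r I (comb c d)" using r that by (auto simp: D_def)
    then have "0 \<le> real_of_int (- d j) * val c + real_of_int (c j) * val d"
      and *: "strict c \<or> strict d \<Longrightarrow> 0 < real_of_int (- d j) * val c + real_of_int (c j) * val d"
      using comb[OF that] val_comb[OF that] by (auto simp: realizes_def val_def)
    then show "- val c / c j \<le> val d / - d j"
      using pos by (simp add: field_simps)
    show "- val c / c j < val d / - d j" if "strict c \<or> strict d"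
      using *[OF that] pos by (simp add: field_simps)
  qed
  obtain t where t: "\<And>c. c \<in> P \<Longrightarrow> - val c / c j \<le> t" "\<And>c. c \<in> P \<Longrightarrow> strict c \<Longrightarrow> - val c / c j < t"
      "\<And>d. d \<in> Q \<Longrightarrow> t \<le> val d / - d j" "\<And>d. d \<in> Q \<Longrightarrow> strict d \<Longrightarrow> t < val d / - d j"
    using separating_real[of P Q "\<lambda>c. - val c / c j" "\<lambda>d. val d / - d j" strict] fin bound
    by blast
  have "realizes (r(j := t)) (insert j I) c" if c: "c \<in> C" for c
  proof -
    have sum: "(\<Sum>i\<in>insert j I. c i * (r(j := t)) i) = c j * t + val c"
      using insert.hyps by (simp add: val_def) (intro sum.cong, auto)
    consider "c \<in> P" | "c \<in> Q" | "c \<in> Z"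
      using c by (cases "c j" "0::int" rule: linorder_cases) (auto simp: P_def Q_def Z_def)
    then show ?thesis
    proof cases
      case 1
      then have "0 < real_of_int (c j)" by (simp add: P_def)
      then show ?thesis using t(1,2)[OF 1] unfolding realizes_def sum by (auto simp: field_simps)
    next
      case 2
      then have "real_of_int (c j) < 0" by (simp add: Q_def)
      then show ?thesis using t(3,4)[OF 2] unfolding realizes_def sum by (auto simp: field_simps)
    next
      case 3
      then have "realizes r I c" "c j = 0" using r by (auto simp: D_def Z_def)
      then show ?thesis unfolding realizes_def sum by (simp add: val_def)
    qed
  qed
  then show ?case by blast
qed

end

section \<open>BL-chains\<close>

text \<open>The truth values of a prime theory: linearity takes over the part of axiom A6, and
  \<open>divisibility\<close> that of A4.\<close>

class bl_chain = comm_monoid_mult + linorder + order_bot +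
  fixes resid :: "'a \<Rightarrow> 'a \<Rightarrow> 'a"  (infixr "\<leadsto>" 65)
  assumes le_one: "x \<le> 1"
    and residuation: "x * y \<le> z \<longleftrightarrow> x \<le> y \<leadsto> z"
    and divisibility: "x * (x \<leadsto> y) = min x y"
begin

section \<open>Calculus of residuated chains\<close>

lemma times_mono: "x \<le> x' \<Longrightarrow> y \<le> y' \<Longrightarrow> x * y \<le> x' * y'"
proof -
  have "x * z \<le> x' * z" if "x \<le> x'" for x x' z
    using that residuation[of x z "x' * z"] residuation[of x' z "x' * z"] by auto
  then show "x \<le> x' \<Longrightarrow> y \<le> y' \<Longrightarrow> x * y \<le> x' * y'"
    by (metis mult.commute order_trans)
qed

lemma mult_le1: "x * y \<le> x"
  using times_mono[of x x y 1] le_one by simp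

lemma mult_le2: "x * y \<le> y"
  using mult_le1[of y x] by (simp add: mult.commute)

lemma resid_eq_one_iff: "x \<leadsto> y = 1 \<longleftrightarrow> x \<le> y"
  by (metis le_one residuation mult_1_left order_antisym order_refl)

lemma one_resid [simp]: "1 \<leadsto> x = x"
  using divisibility[of 1 x] le_one by (simp add: min_absorb2)

lemma resid_self [simp]: "x \<leadsto> x = 1"
  by (simp add: resid_eq_one_iff)

lemma resid_mono: "x' \<le> x \<Longrightarrow> y \<le> y' \<Longrightarrow> x \<leadsto> y \<le> x' \<leadsto> y'"
  by (metis residuation times_mono order_refl order_trans)

lemma le_resid: "y \<le> x \<leadsto> y"
  by (simp add: residuation[symmetric] mult_le1)

lemma resid_resid: "x \<leadsto> (y \<leadsto> z) = (x * y) \<leadsto> z"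
proof (rule order_antisym)
  show "x \<leadsto> y \<leadsto> z \<le> x * y \<leadsto> z"
    by (metis residuation mult.assoc order_refl)
  show "x * y \<leadsto> z \<le> x \<leadsto> y \<leadsto> z"
    by (metis residuation mult.assoc order_refl)
qed

lemma resid_exchange: "x \<leadsto> (y \<leadsto> z) = y \<leadsto> (x \<leadsto> z)"
  by (simp add: resid_resid mult.commute)

lemma mult_resid: "y \<le> x \<Longrightarrow> x * (x \<leadsto> y) = y"
  by (simp add: divisibility min_absorb2)

lemma le_resid_resid: "x \<le> (x \<leadsto> y) \<leadsto> y"
  by (metis residuation divisibility min.cobounded2)

lemma resid_triple: "((x \<leadsto> y) \<leadsto> y) \<leadsto> y = x \<leadsto> y"
  by (meson le_resid_resid resid_mono order_antisym order_refl)

section \<open>Absorption, double negation and the division into components\<close>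

lemma absorb_mono: "b * a = a \<Longrightarrow> a' \<le> a \<Longrightarrow> b * a' = a'"
  by (metis mult_resid mult.assoc)

text \<open>Since \<open>b \<leadsto> a'\<close> is at most a, it is absorbed by b just as a is; but
  its product with b is the minimum of b and a', so it cannot exceed a'.\<close>

lemma resid_absorb_mono:
  assumes "b \<leadsto> a = a" "a < 1" "a' \<le> a"
  shows "b \<leadsto> a' = a'"
proof -
  have "\<not> b \<le> a" using assms resid_eq_one_iff[of b a] by auto
  then have "b * a = a" using divisibility[of b a] assms by (simp add: min_def)
  moreover have "b \<leadsto> a' \<le> a" using assms resid_mono by (metis order_refl)
  ultimately have "b * (b \<leadsto> a') = b \<leadsto> a'" using absorb_mono by blast
  then show ?thesis by (metis divisibility le_resid min.cobounded2 order_antisym)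
qed


text \<open>Let z be the double negation of u relative to m, and f = \<open>z \<leadsto> u\<close>
  the factor by which u falls short of z. Negation does not distinguish z from u, so residuation by
  f fixes \<open>u \<leadsto> m\<close>; hence it fixes m, and then z as well. So f is absorbed by
  z, and z = z * f = u.\<close>

lemma double_neg:
  assumes "m \<le> u" and nd: "u \<leadsto> m \<noteq> m"
  shows "(u \<leadsto> m) \<leadsto> m = u"
proof (cases "u \<leadsto> m = 1")
  case True
  then have "u \<le> m" by (simp only: resid_eq_one_iff)
  then have "u = m" using assms(1) by (rule order_antisym)
  then show ?thesis by simp
next
  case False
  define z f where "z = (u \<leadsto> m) \<leadsto> m" and "f = z \<leadsto> u"
  have u: "z * f = u"
    unfolding f_def by (rule mult_resid) (simp add: z_def le_resid_resid)
  have z: "z \<leadsto> m = u \<leadsto> m" by (simp add: z_def resid_triple)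
  have "f \<leadsto> (z \<leadsto> m) = (z * f) \<leadsto> m" by (simp add: resid_resid mult.commute)
  then have "f \<leadsto> (u \<leadsto> m) = u \<leadsto> m" by (simp only: z u)
  then have fm: "f \<leadsto> m = m"
  proof (rule resid_absorb_mono)
    show "u \<leadsto> m < 1" using False le_one[of "u \<leadsto> m"] by simp
  qed (rule le_resid)
  have fz: "f \<leadsto> z = z"
    unfolding z_def by (simp only: resid_exchange[of f] fm)
  have "z \<noteq> 1" using z nd by auto
  then have "z \<le> f" using fz resid_eq_one_iff[of f z] by auto
  then have "f * z = z" using divisibility[of f z] fz by (simp add: min_absorb2)
  then show ?thesis using u by (simp add: z_def mult.commute)
qed

text \<open>The guard keeps 1 from being far from itself, since \<open>1 \<leadsto> 1 = 1\<close>.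
  Every a below 1 is far below 1, so 1 shares a component with none of them.\<close>

definition far :: "'a \<Rightarrow> 'a \<Rightarrow> bool" where
  "far a b \<longleftrightarrow> a < 1 \<and> b \<leadsto> a = a"

lemma far_less: "far a b \<Longrightarrow> a < b"
  using resid_eq_one_iff[of b a] by (auto simp: far_def)

lemma far_mono:
  assumes "far a b" "a' \<le> a" "b \<le> b'"
  shows "far a' b'"
proof -
  have "b' \<leadsto> a = a"
    using assms by (metis far_def le_resid resid_mono order_antisym order_refl)
  then show ?thesis
    using assms resid_absorb_mono[of b' a a'] by (auto simp: far_def)
qed

text \<open>This makes not being far apart transitive. If b is above a and not far from it, then b
  and \<open>c \<leadsto> b\<close> have the same negation relative to a, because residuation by c
  fixes a; \<open>double_neg\<close> recovers both from that negation, so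
  \<open>c \<leadsto> b = b\<close>.\<close>

lemma far_split:
  assumes "far a c"
  shows "far a b \<or> far b c"
proof (cases "b \<le> a")
  case True
  with assms show ?thesis using far_mono by blast
next
  case False
  have "far b c" if nab: "\<not> far a b"
  proof -
    have ba: "b \<leadsto> a \<noteq> a" and b1: "b < 1" and ca: "c \<leadsto> a = a"
      using nab assms le_one[of b] by (auto simp: far_def less_le)
    have "b \<le> c"
      using ba ca False by (metis le_resid resid_mono order_antisym order_refl linear)
    then have "c * (c \<leadsto> b) = b" by (rule mult_resid)
    then have eq: "(c \<leadsto> b) \<leadsto> a = b \<leadsto> a"
      using ca by (metis resid_resid mult.commute)
    have "a \<le> c \<leadsto> b" using False le_resid[of b c] by auto
    then have "c \<leadsto> b = b"
      using double_neg[of a "c \<leadsto> b"] double_neg[of a b] ba False eq by auto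
    then show ?thesis using b1 by (simp add: far_def)
  qed
  then show ?thesis by blast
qed

lemma not_far_bot: "\<not> far a bot"
  using far_less[of a bot] by auto

subsection \<open>The ordered group of a component\<close>

text \<open>The nonzero elements of the MV-chain with zero m. The element 1 is added by hand because
  \<open>1 \<leadsto> m = m\<close>.\<close>

definition near :: "'a \<Rightarrow> 'a set" where
  "near m = {u. m < u \<and> (u = 1 \<or> u \<leadsto> m \<noteq> m)}"

lemma one_near [simp]: "m < 1 \<Longrightarrow> 1 \<in> near m"
  by (simp add: near_def)

lemma near_regular:
  assumes "u \<in> near m"
  shows "(u \<leadsto> m) \<leadsto> m = u"
proof (cases "u = 1")
  case False
  then show ?thesis using assms by (intro double_neg) (auto simp: near_def)
qed simp

lemma near_less: "u \<in> near m \<Longrightarrow> m < u"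
  by (simp add: near_def)

lemma neg_near:
  assumes "u \<in> near m" "u \<noteq> 1"
  shows "u \<leadsto> m \<in> near m"
proof -
  have "u \<leadsto> m \<noteq> m" "m < u" using assms by (simp_all add: near_def)
  then have "m < u \<leadsto> m" using le_resid[of m u] by simp
  moreover have "(u \<leadsto> m) \<leadsto> m \<noteq> m" using near_regular[OF assms(1)] \<open>m < u\<close> by simp
  ultimately show ?thesis by (simp add: near_def)
qed

lemma mult_near:
  assumes u: "u \<in> near m" and v: "v \<in> near m" and uv: "m < u * v"
  shows "u * v \<in> near m"
proof (cases "u = 1")
  case True
  then show ?thesis using v by simp
next
  case False
  then have "m < u \<leadsto> m" using near_less[OF neg_near[OF u]] by simp
  also have "u \<leadsto> m \<le> u * v \<leadsto> m" by (simp add: resid_mono mult_le1)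
  finally have "u * v \<leadsto> m \<noteq> m" by simp
  then show ?thesis using uv by (simp add: near_def)
qed

lemma contrapose:
  assumes "v \<in> near m"
  shows "(v \<leadsto> m) \<leadsto> (u \<leadsto> m) = u \<leadsto> v"
  using near_regular[OF assms] resid_exchange by metis

text \<open>The MV law for the maximum. By contraposition the left side is the negation of the
  product of \<open>x \<leadsto> m\<close> with its residual to \<open>v \<leadsto> m\<close>, and
  by divisibility that product is \<open>v \<leadsto> m\<close>.\<close>

lemma wajsberg:
  assumes v: "(v \<leadsto> m) \<leadsto> m = v" and x: "(x \<leadsto> m) \<leadsto> m = x" and "x \<le> v"
  shows "(v \<leadsto> x) \<leadsto> x = v"
proof -
  have "v \<leadsto> x = (x \<leadsto> m) \<leadsto> (v \<leadsto> m)" using x resid_exchange by metis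
  then have "(v \<leadsto> x) \<leadsto> x = ((x \<leadsto> m) * ((x \<leadsto> m) \<leadsto> (v \<leadsto> m))) \<leadsto> m"
    using x by (metis resid_resid mult.commute)
  also have "(x \<leadsto> m) * ((x \<leadsto> m) \<leadsto> (v \<leadsto> m)) = v \<leadsto> m"
    by (rule mult_resid) (simp add: resid_mono assms)
  finally show ?thesis using v by simp
qed

text \<open>A product that stays above m is not truncated and can be cancelled: by contraposition
  the left side becomes the Wajsberg maximum of v and \<open>u \<leadsto> m\<close>, and v is the
  larger one because \<open>m < u * v\<close>.\<close>

lemma near_cancel:
  assumes u: "u \<in> near m" and v: "v \<in> near m" and uv: "m < u * v"
  shows "u \<leadsto> u * v = v"
proof -
  have "((u * v) \<leadsto> m) = v \<leadsto> (u \<leadsto> m)" by (metis resid_resid mult.commute)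
  then have "u \<leadsto> u * v = (v \<leadsto> (u \<leadsto> m)) \<leadsto> (u \<leadsto> m)"
    using contrapose[OF mult_near[OF u v uv], of u] by simp
  also have "\<dots> = v"
  proof (rule wajsberg[OF near_regular[OF v]])
    show "u \<leadsto> m \<le> v"
      using uv residuation[of v u m] by (auto simp: mult.commute)
  qed (simp add: resid_triple)
  finally show ?thesis .
qed

lemma carry_comm:
  "u \<in> near m \<Longrightarrow> v \<in> near m \<Longrightarrow> (u \<leadsto> m) \<leadsto> v = (v \<leadsto> m) \<leadsto> u"
  using resid_exchange[of "u \<leadsto> m" "v \<leadsto> m" m] by (simp add: near_regular)

text \<open>Here r = \<open>(u \<leadsto> m) \<leadsto> v\<close> is the truncated sum of u and v.
  If it were far above m, \<open>far_split\<close> would put it far above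
  \<open>u \<leadsto> m\<close>, and multiplication by r would leave \<open>u \<leadsto> m\<close>
  unchanged. But that product is v, so \<open>u \<leadsto> m = v\<close> and r = 1, which is in
  \<open>near m\<close>.\<close>

lemma carry_near:
  assumes u: "u \<in> near m" and v: "v \<in> near m" and uv: "u * v \<le> m"
  shows "(u \<leadsto> m) \<leadsto> v \<in> near m"
proof (rule ccontr)
  define r where "r = (u \<leadsto> m) \<leadsto> v"
  assume "(u \<leadsto> m) \<leadsto> v \<notin> near m"
  then have r: "r \<notin> near m" by (simp add: r_def)
  have vm: "m < v" and um: "m < u" using u v by (auto simp: near_def)
  have v1: "v \<noteq> 1" and u1: "u \<noteq> 1" using um vm uv by auto
  have "v \<le> r" by (simp add: r_def le_resid)
  then have "m < r" using vm by simp
  then have r1: "r < 1" and rm: "r \<leadsto> m = m"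
    using r le_one[of r] by (auto simp: near_def)
  have vu: "v \<le> u \<leadsto> m" using uv residuation[of v u m] by (simp add: mult.commute)
  have "far m r" using rm \<open>m < r\<close> r1 by (simp add: far_def)
  moreover have "\<not> far m (u \<leadsto> m)"
    using near_regular[OF u] um by (auto simp: far_def)
  ultimately have f: "far (u \<leadsto> m) r" using far_split by blast
  then have "r * (u \<leadsto> m) = u \<leadsto> m"
    using mult_resid[of "u \<leadsto> m" r] far_less[OF f] f by (simp add: far_def)
  moreover have "(u \<leadsto> m) * r = v" unfolding r_def using vu by (rule mult_resid)
  ultimately have "u \<leadsto> m = v" by (simp add: mult.commute)
  then show False using r1 by (simp add: r_def)
qed

text \<open>With m as number 0, read (k, u) as k + u - 1. A product above m is u + v - 1; otherwise
  u + v is at most 1, it is given by \<open>(u \<leadsto> m) \<leadsto> v\<close>, and one unit is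
  borrowed.\<close>

fun carry_add :: "'a \<Rightarrow> int \<times> 'a \<Rightarrow> int \<times> 'a \<Rightarrow> int \<times> 'a" where
  "carry_add m (k, u) (l, v) =
     (if m < u * v then (k + l, u * v) else (k + l - 1, (u \<leadsto> m) \<leadsto> v))"

lemma carry_add_comm:
  "u \<in> near m \<Longrightarrow> v \<in> near m \<Longrightarrow> carry_add m (k, u) (l, v) = carry_add m (l, v) (k, u)"
  by (simp add: mult.commute carry_comm)

text \<open>The mixed case of associativity. The factor t with
  \<open>(w \<leadsto> m) * t = v\<close> also satisfies
  \<open>(w \<leadsto> m) * (u * t) = u * v\<close>, a product above m, so
  \<open>near_cancel\<close> returns u * t as the residual.\<close>

lemma carry_one_side:
  assumes u: "u \<in> near m" and v: "v \<in> near m" and w: "w \<in> near m"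
    and uv: "m < u * v" and vw: "v * w \<le> m"
  shows "m < u * ((v \<leadsto> m) \<leadsto> w) \<and> u * ((v \<leadsto> m) \<leadsto> w) = (u * v \<leadsto> m) \<leadsto> w"
proof -
  define t where "t = (w \<leadsto> m) \<leadsto> v"
  have t: "(v \<leadsto> m) \<leadsto> w = t" using carry_comm[OF v w] by (simp add: t_def)
  have tn: "t \<in> near m" using carry_near[OF w v] vw by (simp add: t_def mult.commute)
  have "w \<noteq> 1" using near_less[OF v] vw by auto
  then have wn: "w \<leadsto> m \<in> near m" using w neg_near by blast
  have "v \<le> w \<leadsto> m" using vw by (simp add: residuation)
  then have v_eq: "(w \<leadsto> m) * t = v" unfolding t_def by (rule mult_resid)
  have "u * v \<le> u * t" by (rule times_mono) (simp_all add: t_def le_resid)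
  then have ut: "m < u * t" using uv by simp
  have "(w \<leadsto> m) * (u * t) = u * v" by (simp add: v_eq[symmetric] mult.left_commute)
  then have "(w \<leadsto> m) \<leadsto> u * v = u * t"
    using near_cancel[OF wn mult_near[OF u tn ut]] uv by simp
  then show ?thesis
    using ut t carry_comm[OF w mult_near[OF u v uv]] by simp
qed

text \<open>The case in which both inner sums borrow and an outer one does not. With q the right
  side and s its first factor, writing \<open>w \<leadsto> m\<close> as
  \<open>(q \<leadsto> m) * s\<close> and contraposing yields
  \<open>(v \<leadsto> m) \<leadsto> w = u \<leadsto> q\<close>; multiplication by u returns q
  because \<open>q \<le> u\<close>.\<close>

lemma carry_two_sides:
  assumes u: "u \<in> near m" and v: "v \<in> near m" and w: "w \<in> near m"
    and uv: "u * v \<le> m" and vw: "v * w \<le> m"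
    and c: "m < ((u \<leadsto> m) \<leadsto> v) * w"
  shows "u * ((v \<leadsto> m) \<leadsto> w) = ((u \<leadsto> m) \<leadsto> v) * w"
proof -
  define s where "s = (u \<leadsto> m) \<leadsto> v"
  define q where "q = s * w"
  have sn: "s \<in> near m" unfolding s_def using carry_near[OF u v uv] .
  have qn: "q \<in> near m" unfolding q_def using mult_near[OF sn w] c by (simp add: s_def)
  have u1: "u \<noteq> 1" using near_less[OF v] uv by auto
  have un: "u \<leadsto> m \<in> near m" using neg_near[OF u u1] .
  have vu: "v \<le> u \<leadsto> m" using uv residuation[of v u m] by (simp add: mult.commute)
  have vw': "v \<le> w \<leadsto> m" using vw by (simp add: residuation)
  have v_eq: "(u \<leadsto> m) * s = v" unfolding s_def using vu by (rule mult_resid)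
  have q': "q \<leadsto> m = s \<leadsto> (w \<leadsto> m)" by (simp add: q_def resid_resid)
  have "s * (s \<leadsto> (w \<leadsto> m)) = w \<leadsto> m"
  proof (rule mult_resid)
    show "w \<leadsto> m \<le> s"
      using c residuation[of s w m] by (auto simp: s_def)
  qed
  then have w': "w \<leadsto> m = (q \<leadsto> m) * s" using q' by (simp add: mult.commute)
  have vm: "m < v" using near_less[OF v] .
  have "s \<leadsto> (s * (u \<leadsto> m)) = u \<leadsto> m"
    by (rule near_cancel[OF sn un]) (use v_eq vm in \<open>simp add: mult.commute\<close>)
  then have "s \<leadsto> v = u \<leadsto> m" using v_eq by (simp add: mult.commute)
  then have "(w \<leadsto> m) \<leadsto> v = (q \<leadsto> m) \<leadsto> (u \<leadsto> m)"
    by (simp add: w' resid_resid[symmetric])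
  also have "\<dots> = u \<leadsto> q" using contrapose[OF qn] .
  finally have "(v \<leadsto> m) \<leadsto> w = u \<leadsto> q" using carry_comm[OF v w] by simp
  moreover have "q \<le> u"
  proof -
    have "u \<leadsto> m \<le> q \<leadsto> m"
      using v_eq vw' unfolding q' by (metis residuation)
    then show ?thesis 
      using near_regular[OF u] near_regular[OF qn] resid_mono[of "u \<leadsto> m" "q \<leadsto> m" m m] by simp
  qed
  ultimately show ?thesis using mult_resid[of q u] by (simp add: q_def s_def)
qed

lemma carry_add_assoc:
  assumes u: "u \<in> near m" and v: "v \<in> near m" and w: "w \<in> near m"
  shows "carry_add m (carry_add m (j, u) (k, v)) (l, w) = carry_add m (j, u) (carry_add m (k, v) (l, w))"
proof (cases "m < u * v"; cases "m < v * w")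
  assume uv: "m < u * v" and vw: "m < v * w"
  show ?thesis
  proof (cases "m < u * v * w")
    case False
    have v': "u \<leadsto> m \<le> v" using uv residuation[of v u m] by (auto simp: mult.commute)
    \<comment> \<open>Both groupings borrow in the outer sum. As
      \<open>u \<leadsto> m \<le> v\<close>, the negation factors through v, which then cancels
      against \<open>v * w\<close>.\<close>
    have "(u \<leadsto> m) \<leadsto> v * w = (v * (v \<leadsto> (u \<leadsto> m))) \<leadsto> v * w"
      by (simp add: mult_resid v')
    also have "\<dots> = (v \<leadsto> (u \<leadsto> m)) \<leadsto> (v \<leadsto> v * w)"
      by (metis resid_resid mult.commute)
    also have "\<dots> = (u * v \<leadsto> m) \<leadsto> w"
      by (simp add: near_cancel[OF v w vw] resid_resid mult.commute)
    finally show ?thesis using False uv vw by (simp add: mult.assoc)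
  qed (use uv vw in \<open>simp add: mult.assoc\<close>)
next
  assume uv: "m < u * v" and vw: "\<not> m < v * w"
  have "u * v * w \<le> v * w" by (simp add: mult.assoc mult_le2)
  then have "\<not> m < u * v * w" using vw by simp
  moreover have "m < u * ((v \<leadsto> m) \<leadsto> w)" "u * ((v \<leadsto> m) \<leadsto> w) = (u * v \<leadsto> m) \<leadsto> w"
    using carry_one_side[OF u v w uv] leI[OF vw] by blast+
  ultimately show ?thesis using uv vw by simp
next
  assume uv: "\<not> m < u * v" and vw: "m < v * w"
  have "u * (v * w) \<le> u * v" by (simp add: mult.assoc[symmetric] mult_le1)
  moreover have "m < w * ((v \<leadsto> m) \<leadsto> u)" "w * ((v \<leadsto> m) \<leadsto> u) = (w * v \<leadsto> m) \<leadsto> u"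
    using carry_one_side[OF w v u] vw leI[OF uv]
    unfolding mult.commute[of w v] mult.commute[of v u] by blast+
  moreover have "(v * w \<leadsto> m) \<leadsto> u = (u \<leadsto> m) \<leadsto> v * w"
    using carry_comm[OF mult_near[OF v w vw] u] .
  ultimately show ?thesis using uv vw carry_comm[OF u v] by (auto simp: mult.commute)
next
  assume "\<not> m < u * v" "\<not> m < v * w"
  then have uv: "u * v \<le> m" and vw: "v * w \<le> m" by auto
  then have vu: "v * u \<le> m" and wv: "w * v \<le> m" by (simp_all add: mult.commute)
  show ?thesis
  proof (cases "m < ((u \<leadsto> m) \<leadsto> v) * w")
    case True
    then show ?thesis using carry_two_sides[OF u v w uv vw] uv vw by auto
  next
    case False
    \<comment> \<open>The contrapositive of \<open>carry_two_sides\<close> with u and w exchanged: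
      if this outer sum did not borrow, neither would the other one.\<close>
    have "\<not> m < u * ((v \<leadsto> m) \<leadsto> w)"
      using carry_two_sides[OF w v u wv vu] False carry_comm[OF u v] carry_comm[OF v w]
      by (auto simp: mult.commute)
    moreover have "(((u \<leadsto> m) \<leadsto> v) \<leadsto> m) \<leadsto> w = (u \<leadsto> m) \<leadsto> ((v \<leadsto> m) \<leadsto> w)"
      using carry_comm[OF carry_near[OF u v uv] w] carry_comm[OF v w] resid_exchange by metis
    ultimately show ?thesis using False uv vw by auto
  qed
qed


definition component_group :: "'a \<Rightarrow> (int \<times> 'a) monoid" where
  "component_group m = \<lparr>carrier = UNIV \<times> near m, mult = carry_add m, one = (0, 1)\<rparr>"

lemma carry_add_inverse:
  assumes "m < 1" and u: "u \<in> near m"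
  shows "\<exists>q \<in> UNIV \<times> near m. carry_add m q (k, u) = (0, 1)"
proof (cases "u = 1")
  case True
  then show ?thesis using assms(1) by (intro bexI[of _ "(- k, 1)"]) auto
next
  case False
  \<comment> \<open>The opposite of the number k + u - 1 is (1 - k) + (1 - u) - 1, and
    \<open>u \<leadsto> m\<close> is 1 - u.\<close>
  have "carry_add m (1 - k, u \<leadsto> m) (k, u) = (0, 1)"
    using near_regular[OF u] mult_resid[of m u] near_less[OF u] by (simp add: mult.commute)
  then show ?thesis using neg_near[OF u False] by (intro bexI[of _ "(1 - k, u \<leadsto> m)"]) auto
qed

lemma comm_group_component_group:
  assumes "m < 1"
  shows "comm_group (component_group m)"
proof (rule comm_groupI)
  fix p q assume "p \<in> carrier (component_group m)" "q \<in> carrier (component_group m)"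
  then obtain k u l v where pq: "p = (k, u)" "q = (l, v)" and u: "u \<in> near m" and v: "v \<in> near m"
    by (auto simp: component_group_def)
  show "p \<otimes>\<^bsub>component_group m\<^esub> q \<in> carrier (component_group m)"
    using mult_near[OF u v] carry_near[OF u v] by (simp add: component_group_def pq)
  show "p \<otimes>\<^bsub>component_group m\<^esub> q = q \<otimes>\<^bsub>component_group m\<^esub> p"
    using carry_add_comm[OF u v] by (simp add: component_group_def pq)
next
  fix p q r assume "p \<in> carrier (component_group m)" "q \<in> carrier (component_group m)"
    "r \<in> carrier (component_group m)"
  then show "p \<otimes>\<^bsub>component_group m\<^esub> q \<otimes>\<^bsub>component_group m\<^esub> r =
      p \<otimes>\<^bsub>component_group m\<^esub> (q \<otimes>\<^bsub>component_group m\<^esub> r)"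
    unfolding component_group_def using carry_add_assoc by (auto simp del: carry_add.simps)
next
  fix p assume "p \<in> carrier (component_group m)"
  then obtain k u where p: "p = (k, u)" and u: "u \<in> near m"
    by (auto simp: component_group_def)
  show "\<one>\<^bsub>component_group m\<^esub> \<otimes>\<^bsub>component_group m\<^esub> p = p"
    using near_less[OF u] by (simp add: component_group_def p)
  show "\<exists>q\<in>carrier (component_group m). q \<otimes>\<^bsub>component_group m\<^esub> p = \<one>\<^bsub>component_group m\<^esub>"
    using carry_add_inverse[OF assms u] by (simp add: component_group_def p)
qed (simp add: component_group_def assms)

section \<open>Order of the group and real ranks\<close>

fun lex_le :: "int \<times> 'a \<Rightarrow> int \<times> 'a \<Rightarrow> bool" where
  "lex_le (k, u) (l, v) \<longleftrightarrow> k < l \<or> k = l \<and> u \<le> v"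

lemma lex_le_total: "lex_le p q \<or> lex_le q p"
  by (cases p; cases q) auto

text \<open>Comparison is reduced to the sign of a difference, the form in which
  \<open>nonneg_combinations\<close> sees the order. For u below 1, residuation and regularity of u
  show that the difference borrows exactly when \<open>v \<le> u\<close>.\<close>

lemma lex_le_iff_inv:
  assumes "m < 1" and p: "p \<in> carrier (component_group m)" and q: "q \<in> carrier (component_group m)"
  shows "lex_le p q \<longleftrightarrow>
    lex_le (0, 1) (q \<otimes>\<^bsub>component_group m\<^esub> inv\<^bsub>component_group m\<^esub> p)"
proof -
  interpret comm_group "component_group m" using comm_group_component_group[OF assms(1)] .
  obtain k u l v where pq: "p = (k, u)" "q = (l, v)" and u: "u \<in> near m" and v: "v \<in> near m"
    using p q by (auto simp: component_group_def)
  have v1: "v \<le> 1" by (rule le_one)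
  show ?thesis
  proof (cases "u = 1")
    case True
    have "inv\<^bsub>component_group m\<^esub> p = (- k, 1)"
      by (rule inv_equality) (use p True assms in \<open>auto simp: component_group_def pq\<close>)
    then show ?thesis using near_less[OF v] v1 True by (auto simp: pq component_group_def)
  next
    case False
    have n: "u \<leadsto> m \<in> near m" using neg_near[OF u False] .
    have i: "inv\<^bsub>component_group m\<^esub> p = (1 - k, u \<leadsto> m)"
      by (rule inv_equality)
        (use p n near_regular[OF u] mult_resid[of m u] near_less[OF u] in
          \<open>auto simp: component_group_def pq mult.commute\<close>)
    have "v * (u \<leadsto> m) \<le> m \<longleftrightarrow> v \<le> u"
      using residuation[of v "u \<leadsto> m" m] near_regular[OF u] by simp
    moreover have "(v \<leadsto> m) \<leadsto> (u \<leadsto> m) = v' \<Longrightarrow> 1 \<le> v' \<longleftrightarrow> u \<le> v" for v'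
      using contrapose[OF v, of u] resid_eq_one_iff[of u v] le_one[of v'] by auto
    moreover have "u \<leadsto> m < 1"
      using near_less[OF u] resid_eq_one_iff[of u m] le_one[of "u \<leadsto> m"] by (auto simp: less_le)
    then have "\<not> 1 \<le> v * (u \<leadsto> m)"
      using mult_le2[of v "u \<leadsto> m"] by auto
    ultimately show ?thesis
      unfolding pq[symmetric] i unfolding pq by (auto simp: component_group_def not_less)
  qed
qed

text \<open>A nonnegative pair is (0, 1) or has a positive first component, and two positive first
  components still leave at least 1 after a borrow.\<close>

lemma lex_nonneg_add:
  assumes "m < 1" "p \<in> carrier (component_group m)" "q \<in> carrier (component_group m)"
    and "lex_le (0, 1) p" "lex_le (0, 1) q"
  shows "lex_le (0, 1) (p \<otimes>\<^bsub>component_group m\<^esub> q)"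
proof -
  obtain k u l v where pq: "p = (k, u)" "q = (l, v)" and uv: "u \<in> near m" "v \<in> near m"
    using assms by (auto simp: component_group_def)
  have "0 < k \<or> k = 0 \<and> u = 1" "0 < l \<or> l = 0 \<and> v = 1"
    using assms(4,5) le_one[of u] le_one[of v] by (auto simp: pq order_antisym)
  then consider "k = 0" "u = 1" | "l = 0" "v = 1" | "0 < k" "0 < l" by blast
  then show ?thesis
    using assms(4,5) near_less[OF uv(1)] near_less[OF uv(2)]
    by cases (auto simp: pq component_group_def)
qed

text \<open>As the zero of the MV-chain, m is not in \<open>near m\<close> and has no pair (0, m) in
  the group; its place is one unit below the neutral (0, 1).\<close>

definition position :: "'a \<Rightarrow> 'a \<Rightarrow> int \<times> 'a" where
  "position m x = (if x = m then (- 1, 1) else (0, x))"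

text \<open>A finite part of the ordered group of a component can be ranked by reals. The neutral element
  \<open>1\<close> is at position \<open>(0, 1)\<close>, so that comparisons of two elements are included.\<close>

lemma real_ranking:
  assumes m: "m < 1" and fin: "finite I" and I: "I \<subseteq> insert m (near m)"
  obtains r :: "'a \<Rightarrow> real" where
    "\<And>a b c. a \<in> I \<Longrightarrow> b \<in> I \<Longrightarrow> c \<in> I \<Longrightarrow>
      lex_le (position m a) (carry_add m (position m b) (position m c)) \<longleftrightarrow> r a \<le> r b + r c"
    "\<And>a b c. a \<in> I \<Longrightarrow> b \<in> I \<Longrightarrow> c \<in> I \<Longrightarrow>
      lex_le (carry_add m (position m b) (position m c)) (position m a) \<longleftrightarrow> r b + r c \<le> r a"
proof -
  let ?G = "component_group m"
  interpret G: comm_group ?G using comm_group_component_group[OF m] .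
  define g where "g = position m"
  have g: "g x \<in> carrier ?G" if "x \<in> I" for x
    using that I m by (auto simp: g_def position_def component_group_def)
  \<comment> \<open>Integer vectors indexed by \<open>I\<close> are evaluated in the group. Since
    \<open>ev\<close> turns addition of vectors into the group operation, nonnegativity becomes a
    property of vectors.\<close>
  define ev where "ev c = (\<Otimes>\<^bsub>?G\<^esub>x\<in>I. g x [^]\<^bsub>?G\<^esub> (c x :: int))" for c
  have ev_closed: "ev c \<in> carrier ?G" for c
    unfolding ev_def using g by (intro G.finprod_closed) auto
  have ev_add: "ev (\<lambda>x. c x + d x) = ev c \<otimes>\<^bsub>?G\<^esub> ev d" for c d
  proof -
    have "ev (\<lambda>x. c x + d x) = (\<Otimes>\<^bsub>?G\<^esub>x\<in>I. g x [^]\<^bsub>?G\<^esub> c x \<otimes>\<^bsub>?G\<^esub> g x [^]\<^bsub>?G\<^esub> d x)"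
      unfolding ev_def using g by (intro G.finprod_cong') (auto simp: G.int_pow_mult)
    also have "\<dots> = ev c \<otimes>\<^bsub>?G\<^esub> ev d"
      unfolding ev_def using g by (intro G.finprod_multf) auto
    finally show ?thesis .
  qed
  have ev_zero: "ev (\<lambda>x. 0) = \<one>\<^bsub>?G\<^esub>"
    unfolding ev_def by (intro G.finprod_one_eqI) simp
  have ev_minus: "ev (\<lambda>x. - c x) = inv\<^bsub>?G\<^esub> (ev c)" for c
    using ev_add[of "\<lambda>x. - c x" c] ev_zero ev_closed by (intro G.inv_equality[symmetric]) auto
  define \<delta> :: "'a \<Rightarrow> 'a \<Rightarrow> int" where "\<delta> a x = (if x = a then 1 else 0)" for a x
  have ev_unit: "ev (\<delta> a) = g a" if "a \<in> I" for a
  proof -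
    have "ev (\<delta> a) = (\<Otimes>\<^bsub>?G\<^esub>x\<in>I. if a = x then g x else \<one>\<^bsub>?G\<^esub>)"
      unfolding ev_def \<delta>_def using g by (intro G.finprod_cong') auto
    also have "\<dots> = g a" using that fin g by (intro G.finprod_singleton) auto
    finally show ?thesis .
  qed
  define N where "N c = lex_le (0, 1) (ev c)" for c
  have N_diff: "N (\<lambda>x. d x + - c x) \<longleftrightarrow> lex_le (ev c) (ev d)" for c d
    unfolding N_def ev_add ev_minus using lex_le_iff_inv[OF m ev_closed ev_closed] by simp
  interpret nonneg_combinations N
  proof
    show "N (\<lambda>x. c x + d x)" if "N c" "N d" for c d
      using that lex_nonneg_add[OF m ev_closed ev_closed] by (simp add: N_def ev_add)
    show "N c \<or> N (\<lambda>x. - c x)" for c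
      using N_diff[of c "\<lambda>x. 0"] N_diff[of "\<lambda>x. 0" c] lex_le_total[of "ev c" "ev (\<lambda>x. 0)"] by auto
  qed
  \<comment> \<open>The vector of b + c - a, whose sign decides the comparisons in the claim;
    \<open>V\<close> holds both signs so that the ranks reflect the order.\<close>
  define vec where "vec t = (case t of (a, b, c) \<Rightarrow> \<lambda>x. \<delta> b x + \<delta> c x - \<delta> a x)" for t
  define V where "V = vec ` (I \<times> I \<times> I) \<union> (\<lambda>t x. - vec t x) ` (I \<times> I \<times> I)"
  have "\<exists>r. \<forall>c\<in>{c \<in> V. N c}. realizes r I c"
  proof (rule fourier_motzkin[OF fin])
    show "finite {c \<in> V. N c}" using fin by (simp add: V_def)
    show "c i = 0" if "c \<in> {c \<in> V. N c}" "i \<notin> I" for c i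
      using that by (auto simp: V_def vec_def \<delta>_def)
  qed simp
  then obtain r where r: "\<And>c. c \<in> V \<Longrightarrow> N c \<Longrightarrow> realizes r I c" by blast
  have sum: "(\<Sum>x\<in>I. vec (a, b, c) x * r x) = r b + r c - r a" if "a \<in> I" "b \<in> I" "c \<in> I" for a b c
  proof -
    have "(\<Sum>x\<in>I. \<delta> y x * r x) = r y" if "y \<in> I" for y
    proof -
      have "(\<Sum>x\<in>I. \<delta> y x * r x) = (\<Sum>x\<in>I. if x = y then r x else 0)"
        by (intro sum.cong) (auto simp: \<delta>_def)
      then show ?thesis using that fin by simp
    qed
    then show ?thesis
      using that by (simp add: vec_def left_diff_distrib distrib_right sum.distrib sum_subtractf)
  qed
  \<comment> \<open>Totality puts the vector or its opposite into \<open>N\<close>; if only the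
    opposite is there, \<open>realizes\<close> makes the real sum strictly negative.\<close>
  have key: "N (vec t) \<longleftrightarrow> 0 \<le> (\<Sum>x\<in>I. vec t x * r x)"
      "N (\<lambda>x. - vec t x) \<longleftrightarrow> (\<Sum>x\<in>I. vec t x * r x) \<le> 0" if "t \<in> I \<times> I \<times> I" for t
    using r[of "vec t"] r[of "\<lambda>x. - vec t x"] that total[of "vec t"]
    by (auto simp: V_def realizes_def sum_negf)
  show thesis
  proof (rule that)
    fix a b c assume abc: "a \<in> I" "b \<in> I" "c \<in> I"
    have bc: "ev (\<lambda>x. \<delta> b x + \<delta> c x) = carry_add m (position m b) (position m c)"
      using ev_unit abc by (simp add: ev_add component_group_def g_def)
    have "lex_le (ev (\<delta> a)) (ev (\<lambda>x. \<delta> b x + \<delta> c x)) \<longleftrightarrow> N (vec (a, b, c))"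
      using N_diff[of "\<lambda>x. \<delta> b x + \<delta> c x" "\<delta> a"] by (simp add: vec_def)
    then show "lex_le (position m a) (carry_add m (position m b) (position m c)) \<longleftrightarrow> r a \<le> r b + r c"
      using key(1)[of "(a, b, c)"] abc sum[OF abc] ev_unit[OF abc(1)] bc by (simp add: g_def)
    have "lex_le (ev (\<lambda>x. \<delta> b x + \<delta> c x)) (ev (\<delta> a)) \<longleftrightarrow> N (\<lambda>x. - vec (a, b, c) x)"
      using N_diff[of "\<delta> a" "\<lambda>x. \<delta> b x + \<delta> c x"] by (simp add: vec_def algebra_simps)
    then show "lex_le (carry_add m (position m b) (position m c)) (position m a) \<longleftrightarrow> r b + r c \<le> r a"
      using key(2)[of "(a, b, c)"] abc sum[OF abc] ev_unit[OF abc(1)] bc by (simp add: g_def)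
  qed
qed

text \<open>The rank is the intended fractional part minus 1: products become addition truncated at
  -1, residuals become subtraction. The laws are conditional on membership of the result because
  \<open>Y\<close> is only a finite part of a component.\<close>

definition component_rank :: "'a \<Rightarrow> 'a set \<Rightarrow> ('a \<Rightarrow> real) \<Rightarrow> bool" where
  "component_rank m Y w \<longleftrightarrow> w m = - 1 \<and> (\<forall>x\<in>Y. - 1 \<le> w x \<and> w x < 0) \<and>
    (\<forall>x\<in>Y. \<forall>y\<in>Y. x < y \<longrightarrow> w x < w y) \<and>
    (\<forall>x\<in>Y. \<forall>y\<in>Y. x * y \<in> Y \<longrightarrow> w (x * y) = max (- 1) (w x + w y)) \<and>
    (\<forall>x\<in>Y. \<forall>y\<in>Y. y < x \<longrightarrow> x \<leadsto> y \<in> Y \<longrightarrow> w (x \<leadsto> y) = w y - w x)"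

lemma component_rank_exists:
  assumes m: "m < 1" and fin: "finite Y" and Y: "Y \<subseteq> insert m (near m) - {1}"
  shows "\<exists>w. component_rank m Y w"
proof -
  \<comment> \<open>The element 1 turns the three-place comparisons of \<open>real_ranking\<close>
    into comparisons of two elements, and m fixes the scale.\<close>
  define I where "I = insert 1 (insert m Y)"
  have I: "finite I" "I \<subseteq> insert m (near m)" using fin Y m by (auto simp: I_def)
  obtain r where
    r1: "\<And>a b c. a \<in> I \<Longrightarrow> b \<in> I \<Longrightarrow> c \<in> I \<Longrightarrow>
      lex_le (position m a) (carry_add m (position m b) (position m c)) \<longleftrightarrow> r a \<le> r b + (r c :: real)"
    and r2: "\<And>a b c. a \<in> I \<Longrightarrow> b \<in> I \<Longrightarrow> c \<in> I \<Longrightarrow>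
      lex_le (carry_add m (position m b) (position m c)) (position m a) \<longleftrightarrow> r b + r c \<le> r a"
    using real_ranking[OF m I] by metis
  have mem: "1 \<in> I" "m \<in> I" "x \<in> Y \<Longrightarrow> x \<in> I" for x by (auto simp: I_def)
  have pos1: "position m 1 = (0, 1)" and posm: "position m m = (- 1, 1)"
    using m by (auto simp: position_def)
  have posn: "position m x = (0, x)" if "x \<in> near m" for x
    using near_less[OF that] by (auto simp: position_def)
  have r_one: "r 1 = 0"
    using r1[of 1 1 1] r2[of 1 1 1] mem m by (simp add: pos1)
  have mono: "r x < r y" if "x \<in> I" "y \<in> I" "x < y" for x y
  proof -
    have x: "x = m \<or> x \<in> near m" using that I by auto
    then have "m < y" using that near_less[of x m] by auto
    then have "y \<in> near m" using that I by auto
    with x have "\<not> lex_le (carry_add m (position m y) (position m 1)) (position m x)"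
      using that near_less[of y m] posn by (auto simp: pos1 posm)
    then show ?thesis using r2[of x y 1] that mem r_one by simp
  qed
  have rm: "r m < 0" using mono[of m 1] mem m r_one by simp
  \<comment> \<open>Ranks below 1 are negative; division by \<open>- r m\<close> sets the base to
    -1.\<close>
  define w where "w x = r x / - r m" for x
  have w_plus: "w x + w y = (r x + r y) / - r m" for x y by (simp add: w_def add_divide_distrib)
  have w_mono: "w x < w y" if "x \<in> I" "y \<in> I" "x < y" for x y
    using mono[OF that] rm by (simp add: w_def divide_strict_right_mono_neg)
  have w_m: "w m = - 1" and w_one: "w 1 = 0" using rm r_one by (simp_all add: w_def)
  have Y': "y = m \<or> y \<in> near m" "y < 1" "m \<le> y" if "y \<in> Y" for y
    using that Y near_less[of y m] le_one[of y] by (auto simp: less_le)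
  have plus_near: "w (x * y) = w x + w y"
    if "x \<in> near m" "y \<in> near m" "x \<in> I" "y \<in> I" "x * y \<in> I" "m < x * y" for x y
  proof -
    have "r (x * y) = r x + r y"
      using that r1[of "x * y" x y] r2[of "x * y" x y] posn[OF mult_near[of x m y]]
      by (simp add: posn)
    then show ?thesis by (simp add: w_def add_divide_distrib)
  qed
  have "component_rank m Y w"
    unfolding component_rank_def
  proof (intro conjI ballI impI)
    show "w m = - 1" by (rule w_m)
    show "- 1 \<le> w x" "w x < 0" if "x \<in> Y" for x
      using w_mono[of x 1] w_mono[of m x] Y'[OF that] near_less[of x m] mem that w_m w_one
      by (cases "x = m"; auto)+
    show "w x < w y" if "x \<in> Y" "y \<in> Y" "x < y" for x y
      using w_mono that mem by blast
  next
    fix x y assume xy: "x \<in> Y" "y \<in> Y" "x * y \<in> Y"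
    have le: "m \<le> x * y" using Y'(3)[OF xy(3)] .
    have neg: "w x < 0" "w y < 0"
      using w_mono[of x 1] w_mono[of y 1] xy Y' mem w_one by auto
    show "w (x * y) = max (- 1) (w x + w y)"
    proof (cases "x \<in> near m \<and> y \<in> near m")
      case True
      show ?thesis
      proof (cases "m < x * y")
        case lt: True
        have "w m < w (x * y)" using w_mono[of m "x * y"] lt xy mem by blast
        then show ?thesis using plus_near[of x y] True lt xy mem w_m by auto
      next
        \<comment> \<open>The product hits the base, so the group sum borrows and is at most the
          position of m. Hence the ranks add up to at most -1, and the maximum truncates
          them.\<close>
        case False
        then have "x * y = m" using le by simp
        moreover have "r x + r y \<le> r m"
        proof -
          have "(x \<leadsto> m) \<leadsto> y \<le> 1" by (rule le_one)
          then show ?thesis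
            using r2[of m x y] True mem xy \<open>x * y = m\<close> by (simp add: posm posn)
        qed
        then have "w x + w y \<le> - 1" using rm by (simp add: w_plus field_simps)
        ultimately show ?thesis using w_m by simp
      qed
    next
      case False
      then have "x = m \<or> y = m" using Y' xy by blast
      moreover from this have "x * y = m" using le mult_le1[of x y] mult_le2[of x y] by auto
      ultimately show ?thesis using neg w_m by auto
    qed
  next
    fix x y assume xy: "x \<in> Y" "y \<in> Y" "y < x" "x \<leadsto> y \<in> Y"
    have x: "x \<in> near m" using Y'[OF xy(1)] Y'(3)[OF xy(2)] xy(3) by auto
    have prod: "(x \<leadsto> y) * x = y" using mult_resid[of y x] xy(3) by (simp add: mult.commute)
    show "w (x \<leadsto> y) = w y - w x"
    proof (cases "y = m")
      case True
      have xm: "x \<leadsto> m \<in> near m" using neg_near[OF x] Y'(2)[OF xy(1)] by simp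
      have "carry_add m (position m (x \<leadsto> m)) (position m x) = position m m"
        using prod near_regular[OF x] True by (simp add: posn[OF x] posn[OF xm] posm)
      then have "lex_le (carry_add m (position m (x \<leadsto> m)) (position m x)) (position m m)"
        "lex_le (position m m) (carry_add m (position m (x \<leadsto> m)) (position m x))"
        by (simp_all add: posm)
      then have "r (x \<leadsto> m) + r x = r m"
        using r1[of m "x \<leadsto> m" x] r2[of m "x \<leadsto> m" x] mem xy True by simp
      then have "w (x \<leadsto> m) + w x = w m" by (simp add: w_plus) (simp add: w_def)
      then show ?thesis using True by simp
    next
      case False
      then have lt: "m < (x \<leadsto> y) * x" using Y'(3)[OF xy(2)] prod by simp
      then have "m < x \<leadsto> y" using mult_le1[of "x \<leadsto> y" x] by simp
      then have "x \<leadsto> y \<in> near m" using Y'(1)[OF xy(4)] by auto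
      then show ?thesis using plus_near[of "x \<leadsto> y" x] x lt xy mem prod by simp
    qed
  qed
  then show ?thesis by (rule exI[of _ w])
qed

end

section \<open>Embedding finite parts of a BL-chain into $(\omega)[0,1]$\<close>

context bl_chain
begin

definition component :: "'a set \<Rightarrow> 'a \<Rightarrow> 'a set" where
  "component X x = {y \<in> X. y < 1 \<and> \<not> far x y \<and> \<not> far y x}"

text \<open>The count is of elements rather than components. It is constant on components, increases
  strictly along \<open>far\<close>, and is 0 at \<open>bot\<close>, as integer parts have to
  be.\<close>

definition below :: "'a set \<Rightarrow> 'a \<Rightarrow> nat" where
  "below X x = card {y \<in> X. far y x}"

lemma below_less:
  assumes "finite X" "x \<in> X" "far x y"
  shows "below X x < below X y"
  unfolding below_def
proof (rule psubset_card_mono)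
  have "far z y" if "far z x" for z
    using that assms(3) far_less[of z x] far_mono[of x y z y] by simp
  moreover have "\<not> far x x" using far_less[of x x] by auto
  ultimately show "{z \<in> X. far z x} \<subset> {z \<in> X. far z y}" using assms by blast
qed (use assms in simp)

text \<open>By \<open>far_split\<close>, two elements that are not far apart are far from exactly
  the same elements.\<close>

lemma component_eq:
  assumes "\<not> far x y" "\<not> far y x"
  shows "component X x = component X y" "below X x = below X y"
proof -
  have 1: "far x z \<longleftrightarrow> far y z" "far z x \<longleftrightarrow> far z y" for z
    using assms far_split[of x z y] far_split[of y z x] far_split[of z x y] far_split[of z y x] by auto
  show "component X x = component X y" "below X x = below X y"
    by (simp_all add: component_def below_def 1)
qed

lemma below_bot: "below X bot = 0"
  by (simp add: below_def not_far_bot)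

text \<open>A component need not have a least element, so a zero for its MV-chain is read off the
  finite set \<open>S\<close>; including pairwise products keeps the product of any two members at
  or above it.\<close>

definition base :: "'a set \<Rightarrow> 'a" where
  "base S = Min (S \<union> (\<lambda>(y, z). y * z) ` (S \<times> S))"

lemma base_le:
  assumes "finite S"
  shows "y \<in> S \<Longrightarrow> base S \<le> y" "y \<in> S \<Longrightarrow> z \<in> S \<Longrightarrow> base S \<le> y * z"
  unfolding base_def using assms by (auto intro!: Min_le)

text \<open>If y were far above y * z, then z \<le> \<open>y \<leadsto> y * z\<close> = y * z \<le>
  z, and z itself would be far below y.\<close>

lemma not_far_mult:
  assumes "y < 1" "z < 1" "\<not> far z y"
  shows "\<not> far (y * z) y"
proof
  assume "far (y * z) y"
  then have eq: "y \<leadsto> y * z = y * z" by (simp add: far_def)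
  have "z \<le> y \<leadsto> y * z" using residuation[of z y "y * z"] by (simp add: mult.commute)
  then have "y * z = z" using eq mult_le2[of y z] by simp
  then show False using eq assms by (simp add: far_def)
qed

lemma component_near_base:
  assumes fin: "finite X" and x: "x \<in> X" "x < 1"
  defines "S \<equiv> component X x"
  shows "base S < 1" "S \<subseteq> insert (base S) (near (base S)) - {1}"
proof -
  have S: "finite S" "x \<in> S" "\<And>y. y \<in> S \<Longrightarrow> y < 1"
    using fin x far_less[of x x] by (auto simp: S_def component_def)
  have nf: "\<not> far y z" if "y \<in> S" "z \<in> S" for y z
    using that far_split[of y z x] by (auto simp: S_def component_def)
  have "base S \<in> S \<union> (\<lambda>(y, z). y * z) ` (S \<times> S)"
    unfolding base_def using S by (intro Min_in) auto
  \<comment> \<open>The base may be a product outside \<open>S\<close>. By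
    \<open>not_far_mult\<close> it is not far below its first factor, and \<open>far_split\<close>
    passes this on to z.\<close>
  then have m: "\<not> far (base S) z" if "z \<in> S" for z
  proof (safe)
    fix y y' assume yy: "y \<in> S" "y' \<in> S" "base S = y * y'" and "far (base S) z"
    then have "far (base S) y \<or> far y z" using far_split by blast
    then show False using nf[of y z] nf[of y' y] yy that not_far_mult[of y y'] S by auto
  qed (use nf that in blast)
  show m1: "base S < 1" using base_le(1)[OF S(1,2)] x by simp
  show "S \<subseteq> insert (base S) (near (base S)) - {1}"
  proof
    fix y assume y: "y \<in> S"
    have "y \<leadsto> base S \<noteq> base S" using m[OF y] m1 by (simp add: far_def)
    then show "y \<in> insert (base S) (near (base S)) - {1}"
      using base_le(1)[OF S(1) y] S(3)[OF y] by (auto simp: near_def)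
  qed
qed

text \<open>Across components an operation returns one of its arguments or 1, and the integer parts
  produce the same in the algebra; inside a component \<open>component_rank\<close> is the
  Lukasiewicz arithmetic of fractional parts.\<close>

lemma finite_embedding:
  assumes ne: "bot < (1 :: 'a)" and "finite X"
  obtains h :: "'a \<Rightarrow> ereal" where
    "h bot = 0" "h 1 = \<infinity>" "\<And>x. x \<in> X \<Longrightarrow> 0 \<le> h x" "\<And>x. x \<in> X \<Longrightarrow> h x = \<infinity> \<Longrightarrow> x = 1"
    "\<And>x y. x \<in> X \<Longrightarrow> y \<in> X \<Longrightarrow> x * y \<in> X \<Longrightarrow> h (x * y) = op_conj (h x) (h y)"
    "\<And>x y. x \<in> X \<Longrightarrow> y \<in> X \<Longrightarrow> x \<leadsto> y \<in> X \<Longrightarrow> h (x \<leadsto> y) = op_imp (h x) (h y)"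
proof -
  \<comment> \<open>With \<open>bot\<close> included, its component is cut off at \<open>bot\<close>
    itself, which gives it fractional part 0.\<close>
  define Z where "Z = insert bot X"
  have fin: "finite Z" using assms by (simp add: Z_def)
  have ZI: "x \<in> X \<Longrightarrow> x \<in> Z" for x by (simp add: Z_def)
  \<comment> \<open>The rank is chosen per component and not per element, so that all elements of a
    component are measured on one scale.\<close>
  define W where "W S = (SOME w. component_rank (base S) S w)" for S
  have good: "component_rank (base (component Z x)) (component Z x) (W (component Z x))"
    if "x \<in> Z" "x < 1" for x
  proof -
    have "finite (component Z x)" using fin by (simp add: component_def)
    then show ?thesis
      unfolding W_def using component_near_base[OF fin that]
      by (intro someI_ex[of "component_rank _ _"] component_rank_exists)
  qed
  define a where "a x = 1 + W (component Z x) x" for x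
  define n where "n x = int (below Z x)" for x
  define h where "h x = (if x = 1 then \<infinity> else pt (n x) (a x))" for x
  have self: "x \<in> component Z x" if "x \<in> Z" "x < 1" for x
    using that far_less[of x x] by (auto simp: component_def)
  have a: "0 \<le> a x" "a x < 1" if "x \<in> Z" "x < 1" for x
    using good[OF that] self[OF that] by (auto simp: component_rank_def a_def)
  have n_less: "n x < n y" if "x \<in> Z" "far x y" for x y
    using below_less[OF fin that] by (simp add: n_def)
  have same: "n x = n y" "y \<in> component Z x" "component Z y = component Z x"
    if "y \<in> Z" "y < 1" "\<not> far x y" "\<not> far y x" for x y
    using that component_eq[of x y Z] by (auto simp: n_def component_def)
  have lt1: "x < 1" if "x \<noteq> 1" for x using that le_one[of x] by simp
  have nonneg: "0 \<le> h x" if "x \<in> Z" for x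
    using a[OF that lt1] by (auto simp: h_def n_def)
  have one: "h 1 = \<infinity>" by (simp add: h_def)
  have bot: "h bot = 0"
  proof -
    have Z: "bot \<in> Z" by (simp add: Z_def)
    have "base (component Z bot) = bot"
      using base_le(1)[OF _ self[OF Z ne]] fin by (simp add: component_def bot_unique)
    then have "a bot = 0" using good[OF Z ne] by (simp add: component_rank_def a_def)
    then show ?thesis using ne below_bot[of Z] by (auto simp: h_def n_def)
  qed
  show thesis
  proof (rule that)
    show "h bot = 0" by (rule bot)
    show "h 1 = \<infinity>" by (rule one)
    show "0 \<le> h x" if "x \<in> X" for x using nonneg ZI that by blast
    show "x = 1" if "h x = \<infinity>" for x using that by (auto simp: h_def split: if_splits)
  next
    fix x y assume "x \<in> X" "y \<in> X" "x * y \<in> X"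
    then have Z: "x \<in> Z" "y \<in> Z" "x * y \<in> Z" by (simp_all add: Z_def)
    show "h (x * y) = op_conj (h x) (h y)"
    proof (cases "x = 1 \<or> y = 1")
      case True
      then show ?thesis using nonneg[OF Z(1)] nonneg[OF Z(2)] one by auto
    next
      case False
      then have lt: "x < 1" "y < 1" using lt1 by auto
      then have lt': "x * y < 1" using mult_le1[of x y] by simp
      have hxy: "h x = pt (n x) (a x)" "h y = pt (n y) (a y)" "h (x * y) = pt (n (x * y)) (a (x * y))"
        using lt lt' by (auto simp: h_def)
      note conj = op_conj_pt[OF a[OF Z(1) lt(1)] a[OF Z(2) lt(2)]]
      consider "far x y" | "far y x" | "\<not> far x y" "\<not> far y x" by blast
      then show ?thesis
      proof cases
        case 1
        then have "x * y = x" using mult_resid[of x y] far_less[OF 1] by (simp add: far_def mult.commute)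
        then show ?thesis using n_less[OF Z(1) 1] hxy conj by simp
      next
        case 2
        then have "x * y = y" using mult_resid[of y x] far_less[OF 2] by (simp add: far_def)
        then show ?thesis using n_less[OF Z(2) 2] hxy conj by simp
      next
        case 3
        have "\<not> far (x * y) x" using not_far_mult[OF lt 3(2)] .
        moreover have "\<not> far x (x * y)" using far_less[of x "x * y"] mult_le1[of x y] by auto
        ultimately have p: "n x = n (x * y)" "x * y \<in> component Z x" "component Z (x * y) = component Z x"
          using same[OF Z(3) lt', of x] by auto
        have q: "n x = n y" "y \<in> component Z x" "component Z y = component Z x"
          using same[OF Z(2) lt(2) 3] by auto
        have "a (x * y) = max 0 (a x + a y - 1)"
          using good[OF Z(1) lt(1)] p(2) q(2) self[OF Z(1) lt(1)]
          unfolding component_rank_def a_def p(3) q(3) by (auto simp: max_def)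
        then show ?thesis using hxy conj p q by simp
      qed
    qed
  next
    fix x y assume "x \<in> X" "y \<in> X" "x \<leadsto> y \<in> X"
    then have Z: "x \<in> Z" "y \<in> Z" "x \<leadsto> y \<in> Z" by (simp_all add: Z_def)
    show "h (x \<leadsto> y) = op_imp (h x) (h y)"
    proof (cases "x = 1 \<or> y = 1")
      case True
      then show ?thesis
        using nonneg[OF Z(1)] nonneg[OF Z(2)] one le_one[of x] resid_eq_one_iff[of x 1] by auto
    next
      case False
      then have lt: "x < 1" "y < 1" using lt1 by auto
      have hxy: "h x = pt (n x) (a x)" "h y = pt (n y) (a y)" using lt by (auto simp: h_def)
      note imp = op_imp_pt[OF a[OF Z(1) lt(1)] a[OF Z(2) lt(2)]]
      consider "far x y" | "far y x" | "\<not> far x y" "\<not> far y x" by blast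
      then show ?thesis
      proof cases
        case 1
        then have "x \<leadsto> y = 1" using far_less[OF 1] by (simp add: resid_eq_one_iff)
        then show ?thesis using n_less[OF Z(1) 1] hxy imp by (simp add: h_def)
      next
        case 2
        then have "x \<leadsto> y = y" by (simp add: far_def)
        then show ?thesis using n_less[OF Z(2) 2] hxy imp by simp
      next
        case 3
        have q: "n x = n y" "y \<in> component Z x" "component Z y = component Z x"
          using same[OF Z(2) lt(2) 3] by auto
        note g = good[OF Z(1) lt(1), unfolded component_rank_def] and x = self[OF Z(1) lt(1)]
        show ?thesis
        proof (cases "x \<le> y")
          case True
          then have "x = y \<or> x < y" by auto
          then have "a x \<le> a y" using g x q(2) unfolding a_def q(3) by force
          then have "\<not> a y < a x" by simp
          moreover have "x \<leadsto> y = 1" using True by (simp add: resid_eq_one_iff)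
          ultimately show ?thesis using hxy imp q by (simp add: h_def)
        next
          case False
          then have yx: "y < x" by simp
          have lt': "x \<leadsto> y < 1" using False resid_eq_one_iff[of x y] lt1 by blast
          \<comment> \<open>Equality would put y far below x. So the residual is strictly above y,
            and since \<open>(x \<leadsto> y) \<leadsto> y\<close> is at least x, it stays in the
            component of y.\<close>
          have "y \<noteq> x \<leadsto> y" using 3(2) lt by (auto simp: far_def)
          then have "y < x \<leadsto> y" using le_resid[of y x] by simp
          then have "\<not> far (x \<leadsto> y) y" using far_less[of "x \<leadsto> y" y] by auto
          moreover have "\<not> far y (x \<leadsto> y)"
            using le_resid_resid[of x y] yx by (auto simp: far_def)
          ultimately have p: "n (x \<leadsto> y) = n y" "component Z (x \<leadsto> y) = component Z x"
            "x \<leadsto> y \<in> component Z x"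
            using same[OF Z(3) lt', of y] q by auto
          have "W (component Z x) (x \<leadsto> y) = W (component Z x) y - W (component Z x) x"
            and "W (component Z x) y < W (component Z x) x"
            using g x p q yx by auto
          then have "a (x \<leadsto> y) = 1 - a x + a y" "a y < a x" unfolding a_def p(2) q(3) by auto
          then show ?thesis using hxy imp p q lt' by (auto simp: h_def)
        qed
      qed
    qed
  qed
qed

end

section \<open>Completeness of BL\<close>

locale bl_theory =
  fixes T :: "fm set"
  assumes provable: "BL \<turnstile> A \<Longrightarrow> A \<in> T"
    and mp: "A \<in> T \<Longrightarrow> A \<^bold>\<rightarrow> B \<in> T \<Longrightarrow> B \<in> T"
begin

section \<open>Derived rules of BL inside a theory\<close>

lemma trans: "A \<^bold>\<rightarrow> B \<in> T \<Longrightarrow> B \<^bold>\<rightarrow> C \<in> T \<Longrightarrow> A \<^bold>\<rightarrow> C \<in> T"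
  using mp[OF _ mp[OF _ provable[OF BL_provable.A1]]] .

lemma conj_left: "A \<^bold>\<odot> B \<in> T \<Longrightarrow> A \<in> T"
  by (rule mp[OF _ provable[OF BL_provable.A2]])

lemma conj_right: "A \<^bold>\<odot> B \<in> T \<Longrightarrow> B \<in> T"
  by (rule conj_left[OF mp[OF _ provable[OF BL_provable.A3]]])

lemma curry_imp: "((A \<^bold>\<odot> B) \<^bold>\<rightarrow> C) \<^bold>\<rightarrow> (A \<^bold>\<rightarrow> (B \<^bold>\<rightarrow> C)) \<in> T"
  by (rule conj_right[OF provable[OF BL_provable.A5]])

lemma uncurry_imp: "(A \<^bold>\<rightarrow> (B \<^bold>\<rightarrow> C)) \<^bold>\<rightarrow> ((A \<^bold>\<odot> B) \<^bold>\<rightarrow> C) \<in> T"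
  by (rule conj_left[OF provable[OF BL_provable.A5]])

lemma residuation_iff: "A \<^bold>\<rightarrow> (B \<^bold>\<rightarrow> C) \<in> T \<longleftrightarrow> (A \<^bold>\<odot> B) \<^bold>\<rightarrow> C \<in> T"
  using mp[OF _ curry_imp] mp[OF _ uncurry_imp] by metis

lemma weaken: "A \<^bold>\<rightarrow> (B \<^bold>\<rightarrow> A) \<in> T"
  unfolding residuation_iff by (rule provable[OF BL_provable.A2])

lemma imp_mono_left: "A \<^bold>\<rightarrow> B \<in> T \<Longrightarrow> (B \<^bold>\<rightarrow> C) \<^bold>\<rightarrow> (A \<^bold>\<rightarrow> C) \<in> T"
  by (rule mp[OF _ provable[OF BL_provable.A1]])

lemma exchange: "(A \<^bold>\<rightarrow> (B \<^bold>\<rightarrow> C)) \<^bold>\<rightarrow> (B \<^bold>\<rightarrow> (A \<^bold>\<rightarrow> C)) \<in> T"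
  by (rule trans[OF trans[OF uncurry_imp imp_mono_left[OF provable[OF BL_provable.A3]]] curry_imp])

text \<open>The weakening A \<rightarrow> (B \<rightarrow> A), with an instance of A7 for B, is
  exchanged into B \<rightarrow> (A \<rightarrow> A).\<close>

lemma refl: "A \<^bold>\<rightarrow> A \<in> T"
  by (rule mp[OF provable[OF BL_provable.A7] mp[OF weaken exchange]])

lemma Top_mem: "Top \<in> T"
  by (rule refl)

lemma one_le_iff: "Top \<^bold>\<rightarrow> A \<in> T \<longleftrightarrow> A \<in> T"
  using mp[OF Top_mem] mp[OF _ weaken] by metis

lemma imp_mono_right: "A \<^bold>\<rightarrow> B \<in> T \<Longrightarrow> (C \<^bold>\<rightarrow> A) \<^bold>\<rightarrow> (C \<^bold>\<rightarrow> B) \<in> T"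
  by (rule mp[OF _ mp[OF provable[OF BL_provable.A1] exchange]])

lemma imp_mono:
  "A' \<^bold>\<rightarrow> A \<in> T \<Longrightarrow> B \<^bold>\<rightarrow> B' \<in> T \<Longrightarrow> (A \<^bold>\<rightarrow> B) \<^bold>\<rightarrow> (A' \<^bold>\<rightarrow> B') \<in> T"
  by (rule trans[OF imp_mono_left imp_mono_right])

lemma pairing: "A \<^bold>\<rightarrow> (B \<^bold>\<rightarrow> A \<^bold>\<odot> B) \<in> T"
  unfolding residuation_iff by (rule refl)

lemma conj_mono:
  assumes "A \<^bold>\<rightarrow> A' \<in> T" "B \<^bold>\<rightarrow> B' \<in> T"
  shows "A \<^bold>\<odot> B \<^bold>\<rightarrow> A' \<^bold>\<odot> B' \<in> T"
  unfolding residuation_iff[symmetric]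
  by (rule trans[OF trans[OF assms(1) pairing] imp_mono_left[OF assms(2)]])

lemma conj_commute: "A \<^bold>\<odot> B \<^bold>\<rightarrow> B \<^bold>\<odot> A \<in> T"
  by (rule provable[OF BL_provable.A3])

lemma conj_assoc1: "(A \<^bold>\<odot> B) \<^bold>\<odot> C \<^bold>\<rightarrow> A \<^bold>\<odot> (B \<^bold>\<odot> C) \<in> T"
  unfolding residuation_iff[symmetric] by (rule trans[OF pairing curry_imp])

lemma conj_assoc2: "A \<^bold>\<odot> (B \<^bold>\<odot> C) \<^bold>\<rightarrow> (A \<^bold>\<odot> B) \<^bold>\<odot> C \<in> T"
  unfolding residuation_iff[of A "B \<^bold>\<odot> C", symmetric]
  by (rule trans[OF residuation_iff[THEN iffD2, OF pairing] uncurry_imp])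

lemma conj_Top: "A \<^bold>\<rightarrow> Top \<^bold>\<odot> A \<in> T" "Top \<^bold>\<odot> A \<^bold>\<rightarrow> A \<in> T"
  by (rule mp[OF Top_mem pairing]) (simp add: residuation_iff[symmetric] one_le_iff refl)

lemma detach: "A \<^bold>\<odot> (A \<^bold>\<rightarrow> B) \<^bold>\<rightarrow> B \<in> T"
  by (rule trans[OF conj_commute residuation_iff[THEN iffD1, OF refl]])

lemma conj_absorb: "A \<^bold>\<rightarrow> B \<in> T \<Longrightarrow> A \<^bold>\<rightarrow> A \<^bold>\<odot> (A \<^bold>\<rightarrow> B) \<in> T"
  by (rule mp[OF _ mp[OF pairing exchange]])

section \<open>Local deduction theorem and proof by cases\<close>

abbreviation iterated_imp :: "fm \<Rightarrow> nat \<Rightarrow> fm \<Rightarrow> fm" where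
  "iterated_imp B n \<equiv> (\<lambda>C. B \<^bold>\<rightarrow> C) ^^ n"

lemma iterated_mono: "A \<^bold>\<rightarrow> C \<in> T \<Longrightarrow> iterated_imp B n A \<^bold>\<rightarrow> iterated_imp B n C \<in> T"
  by (induction n) (auto intro: imp_mono_right)

lemma iterated_weaken: "A \<^bold>\<rightarrow> iterated_imp B n A \<in> T"
  by (induction n) (auto intro: refl trans weaken)

lemma iterated_exchange: "iterated_imp B n (C \<^bold>\<rightarrow> D) \<^bold>\<rightarrow> (C \<^bold>\<rightarrow> iterated_imp B n D) \<in> T"
proof (induction n)
  case (Suc n)
  then show ?case using trans[OF imp_mono_right exchange] by simp
qed (simp add: refl)

text \<open>This is the theory generated by adding B. Contraction fails in BL, so a derivation may
  use B several times, and the number n of uses has to be recorded.\<close>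

lemma bl_theory_extend: "bl_theory {C. \<exists>n. iterated_imp B n C \<in> T}"
proof
  show "A \<in> {C. \<exists>n. iterated_imp B n C \<in> T}" if "BL \<turnstile> A" for A
    using provable[OF that] by (auto intro: exI[of _ 0])
  fix C D assume "C \<in> {C. \<exists>n. iterated_imp B n C \<in> T}" "C \<^bold>\<rightarrow> D \<in> {C. \<exists>n. iterated_imp B n C \<in> T}"
  then obtain n k where nk: "iterated_imp B n C \<in> T" "iterated_imp B k (C \<^bold>\<rightarrow> D) \<in> T" by auto
  have "iterated_imp B n (iterated_imp B k D) \<in> T"
    by (rule mp[OF nk(1) iterated_mono[OF mp[OF nk(2) iterated_exchange]]])
  then have "iterated_imp B (n + k) D \<in> T" by (simp add: funpow_add)
  then show "D \<in> {C. \<exists>n. iterated_imp B n C \<in> T}" by blast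
qed

lemma prelinear_single:
  assumes "(B \<^bold>\<rightarrow> C) \<^bold>\<rightarrow> A \<in> T" "iterated_imp (C \<^bold>\<rightarrow> B) n A \<in> T"
  shows "A \<in> T"
  using assms(2)
proof (induction n)
  case (Suc n)
  have "(B \<^bold>\<rightarrow> C) \<^bold>\<rightarrow> iterated_imp (C \<^bold>\<rightarrow> B) n A \<in> T"
    by (rule trans[OF assms(1) iterated_weaken])
  moreover have "(C \<^bold>\<rightarrow> B) \<^bold>\<rightarrow> iterated_imp (C \<^bold>\<rightarrow> B) n A \<in> T" using Suc.prems by simp
  ultimately have "iterated_imp (C \<^bold>\<rightarrow> B) n A \<in> T"
    by (rule mp[OF _ mp[OF _ provable[OF BL_provable.A6]]])
  then show ?case by (rule Suc.IH)
qed simp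

text \<open>Proof by cases on the two directions of an implication, with any numbers of uses: A6
  removes one copy of B \<rightarrow> C per step, and \<open>prelinear_single\<close> discharges all
  k copies of the other direction each time.\<close>

lemma prelinear:
  assumes "iterated_imp (B \<^bold>\<rightarrow> C) n A \<in> T" "iterated_imp (C \<^bold>\<rightarrow> B) k A \<in> T"
  shows "A \<in> T"
  using assms(1)
proof (induction n)
  case (Suc n)
  have "iterated_imp (C \<^bold>\<rightarrow> B) k (iterated_imp (B \<^bold>\<rightarrow> C) n A) \<in> T"
    by (rule mp[OF assms(2) iterated_mono[OF iterated_weaken]])
  moreover have "(B \<^bold>\<rightarrow> C) \<^bold>\<rightarrow> iterated_imp (B \<^bold>\<rightarrow> C) n A \<in> T" using Suc.prems by simp
  ultimately have "iterated_imp (B \<^bold>\<rightarrow> C) n A \<in> T" by (rule prelinear_single[rotated])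
  then show ?case by (rule Suc.IH)
qed simp

end

section \<open>Prime theories\<close>

definition prime_theory :: "fm set \<Rightarrow> bool" where
  "prime_theory T \<longleftrightarrow> bl_theory T \<and> (\<forall>A B. A \<^bold>\<rightarrow> B \<in> T \<or> B \<^bold>\<rightarrow> A \<in> T)"

text \<open>In a theory maximal among those omitting A, every formula outside it yields A by
  repeated use. If both directions of an implication were outside, \<open>prelinear\<close> would
  put A inside.\<close>

lemma prime_theory_exists:
  assumes "\<not> BL \<turnstile> A"
  shows "\<exists>T. prime_theory T \<and> A \<notin> T"
proof -
  define \<T> where "\<T> = {T. bl_theory T \<and> A \<notin> T}"
  have "{B. BL \<turnstile> B} \<in> \<T>"
    using assms by (auto simp: \<T>_def bl_theory_def intro: BL_provable.MP)
  moreover have "\<Union>\<C> \<in> \<T>" if "\<C> \<noteq> {}" "subset.chain \<T> \<C>" for \<C>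
  proof -
    have C: "\<And>T. T \<in> \<C> \<Longrightarrow> bl_theory T \<and> A \<notin> T"
      and ch: "\<And>S T. S \<in> \<C> \<Longrightarrow> T \<in> \<C> \<Longrightarrow> S \<subseteq> T \<or> T \<subseteq> S"
      using that(2) by (auto simp: subset_chain_def \<T>_def)
    have "bl_theory (\<Union>\<C>)"
    proof
      show "B \<in> \<Union>\<C>" if "BL \<turnstile> B" for B
        using that \<open>\<C> \<noteq> {}\<close> C bl_theory.provable by blast
      fix B D assume "B \<in> \<Union>\<C>" "B \<^bold>\<rightarrow> D \<in> \<Union>\<C>"
      then obtain S where "S \<in> \<C>" "B \<in> S" "B \<^bold>\<rightarrow> D \<in> S" using ch by blast
      then show "D \<in> \<Union>\<C>" using C bl_theory.mp by blast
    qed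
    then show ?thesis using C by (auto simp: \<T>_def)
  qed
  ultimately obtain T where T: "T \<in> \<T>" and max: "\<And>S. S \<in> \<T> \<Longrightarrow> T \<subseteq> S \<Longrightarrow> S = T"
    using subset_Zorn_nonempty[of \<T>] by blast
  interpret bl_theory T using T by (simp add: \<T>_def)
  have extend: "\<exists>n. iterated_imp B n A \<in> T" if "B \<notin> T" for B
  proof (rule ccontr)
    assume no: "\<nexists>n. iterated_imp B n A \<in> T"
    define S where "S = {C. \<exists>n. iterated_imp B n C \<in> T}"
    have "S \<in> \<T>" using bl_theory_extend[of B] no by (simp add: \<T>_def S_def)
    moreover have "T \<subseteq> S" by (auto simp: S_def intro: exI[of _ 0])
    moreover have "B \<in> S" using refl[of B] by (auto simp: S_def intro: exI[of _ 1])
    ultimately show False using max that by blast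
  qed
  have "B \<^bold>\<rightarrow> C \<in> T \<or> C \<^bold>\<rightarrow> B \<in> T" for B C
    using extend[of "B \<^bold>\<rightarrow> C"] extend[of "C \<^bold>\<rightarrow> B"] prelinear[where B = B and C = C] T
    by (auto simp: \<T>_def)
  then show ?thesis using T by (auto simp: prime_theory_def \<T>_def)
qed

text \<open>A quotient type cannot depend on a variable. Completeness is therefore proved for a single
  formula fixed by choice: an unprovable one, and a tautology if there is an unprovable tautology.\<close>

definition tautology :: "fm \<Rightarrow> bool" where
  "tautology A \<longleftrightarrow> (\<forall>v. valuation v \<longrightarrow> v A = \<infinity>)"

definition critical :: fm where
  "critical = (SOME A. \<not> BL \<turnstile> A \<and> ((\<exists>B. \<not> BL \<turnstile> B \<and> tautology B) \<longrightarrow> tautology A))"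

primrec fm_val :: "(nat \<Rightarrow> ereal) \<Rightarrow> fm \<Rightarrow> ereal" where
  "fm_val e Bot = 0"
| "fm_val e (Var i) = e i"
| "fm_val e (A \<^bold>\<odot> B) = op_conj (fm_val e A) (fm_val e B)"
| "fm_val e (A \<^bold>\<rightarrow> B) = op_imp (fm_val e A) (fm_val e B)"

lemma valuation_fm_val: "(\<And>i. 0 \<le> e i) \<Longrightarrow> valuation (fm_val e)"
  by (simp add: valuation_def)

text \<open>It supplies a candidate for \<open>critical\<close> in case every tautology is
  provable.\<close>

lemma Bot_unprovable: "\<not> BL \<turnstile> Bot"
  using BL_sound[OF _ valuation_fm_val[of "\<lambda>i. 0"], of Bot] by auto

lemma critical_unprovable: "\<not> BL \<turnstile> critical"
  and critical_tautology: "\<not> BL \<turnstile> B \<Longrightarrow> tautology B \<Longrightarrow> tautology critical"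
proof -
  have "\<exists>A. \<not> BL \<turnstile> A \<and> ((\<exists>B. \<not> BL \<turnstile> B \<and> tautology B) \<longrightarrow> tautology A)"
    using Bot_unprovable by blast
  from someI_ex[OF this, folded critical_def]
  show "\<not> BL \<turnstile> critical" "\<not> BL \<turnstile> B \<Longrightarrow> tautology B \<Longrightarrow> tautology critical" by blast+
qed

definition critical_theory :: "fm set" where
  "critical_theory = (SOME T. prime_theory T \<and> critical \<notin> T)"

lemma prime_critical_theory: "prime_theory critical_theory"
  and critical_notin: "critical \<notin> critical_theory"
  using someI_ex[OF prime_theory_exists[OF critical_unprovable]]
  by (simp_all add: critical_theory_def)

interpretation critical: bl_theory critical_theory
  using prime_critical_theory by (simp add: prime_theory_def)

\<comment> \<open>The Lindenbaum algebra of the chosen theory\<close>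
quotient_type truth_value =
  fm / "\<lambda>A B. A \<^bold>\<rightarrow> B \<in> critical_theory \<and> B \<^bold>\<rightarrow> A \<in> critical_theory"
proof (rule equivpI)
  show "reflp (\<lambda>A B. A \<^bold>\<rightarrow> B \<in> critical_theory \<and> B \<^bold>\<rightarrow> A \<in> critical_theory)"
    by (simp add: reflp_def critical.refl)
  show "symp (\<lambda>A B. A \<^bold>\<rightarrow> B \<in> critical_theory \<and> B \<^bold>\<rightarrow> A \<in> critical_theory)"
    by (simp add: symp_def)
  show "transp (\<lambda>A B. A \<^bold>\<rightarrow> B \<in> critical_theory \<and> B \<^bold>\<rightarrow> A \<in> critical_theory)"
    by (auto simp: transp_def intro: critical.trans)
qed

instantiation truth_value :: linorder
begin

lift_definition less_eq_truth_value :: "truth_value \<Rightarrow> truth_value \<Rightarrow> bool"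
  is "\<lambda>A B. A \<^bold>\<rightarrow> B \<in> critical_theory"
  using critical.trans by blast

definition less_truth_value :: "truth_value \<Rightarrow> truth_value \<Rightarrow> bool" where
  "less_truth_value x y \<longleftrightarrow> x \<le> y \<and> \<not> y \<le> x"

instance
proof
  fix x y z :: truth_value
  show "x < y \<longleftrightarrow> x \<le> y \<and> \<not> y \<le> x" by (rule less_truth_value_def)
  show "x \<le> x" by transfer (rule critical.refl)
  show "x \<le> y \<Longrightarrow> y \<le> z \<Longrightarrow> x \<le> z" by transfer (rule critical.trans)
  show "x \<le> y \<Longrightarrow> y \<le> x \<Longrightarrow> x = y" by transfer blast
  show "x \<le> y \<or> y \<le> x"
    by transfer (use prime_critical_theory in \<open>simp add: prime_theory_def\<close>)
qed

end

instantiation truth_value :: bl_chain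
begin

lift_definition times_truth_value :: "truth_value \<Rightarrow> truth_value \<Rightarrow> truth_value" is "(\<^bold>\<odot>)"
  using critical.conj_mono by blast

lift_definition one_truth_value :: truth_value is Top .

lift_definition bot_truth_value :: truth_value is Bot .

lift_definition resid_truth_value :: "truth_value \<Rightarrow> truth_value \<Rightarrow> truth_value" is "(\<^bold>\<rightarrow>)"
  using critical.imp_mono by blast

instance
proof
  fix x y z :: truth_value
  show "bot \<le> x" by transfer (rule critical.provable[OF BL_provable.A7])
  show "x * y * z = x * (y * z)" by transfer (simp add: critical.conj_assoc1 critical.conj_assoc2)
  show "x * y = y * x" by transfer (simp add: critical.conj_commute)
  show "1 * x = x" by transfer (simp add: critical.conj_Top)
  show "x \<le> 1" by transfer (rule critical.mp[OF critical.Top_mem critical.weaken])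
  show "x * y \<le> z \<longleftrightarrow> x \<le> y \<leadsto> z" by transfer (simp add: critical.residuation_iff)
  have le: "x * (x \<leadsto> y) \<le> y" "x * (x \<leadsto> y) \<le> x" "x \<le> y \<Longrightarrow> x \<le> x * (x \<leadsto> y)"
    "x * (x \<leadsto> y) \<le> y * (y \<leadsto> x)" for x y :: truth_value
    by (transfer, simp add: critical.detach critical.conj_absorb critical.provable BL_provable.A2
      BL_provable.A4)+
  show "x * (x \<leadsto> y) = min x y"
  proof (rule order_antisym)
    show "x * (x \<leadsto> y) \<le> min x y" by (simp add: le)
    show "min x y \<le> x * (x \<leadsto> y)"
    proof (cases "x \<le> y")
      case True
      then show ?thesis by (simp add: le(3) min_def)
    next
      case False
      then have "y \<le> y * (y \<leadsto> x)" by (simp add: le(3))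
      \<comment> \<open>Here y is the minimum. It lies below \<open>y * (y \<leadsto> x)\<close>,
        and A4 passes from this product to \<open>x * (x \<leadsto> y)\<close>.\<close>
      then show ?thesis using le(4)[of y x] False by (simp add: min_def)
    qed
  qed
qed

end

section \<open>The refuting valuation\<close>

primrec subformulas :: "fm \<Rightarrow> fm set" where
  "subformulas Bot = {Bot}"
| "subformulas (Var i) = {Var i}"
| "subformulas (A \<^bold>\<odot> B) = insert (A \<^bold>\<odot> B) (subformulas A \<union> subformulas B)"
| "subformulas (A \<^bold>\<rightarrow> B) = insert (A \<^bold>\<rightarrow> B) (subformulas A \<union> subformulas B)"

lemma finite_subformulas: "finite (subformulas A)"
  by (induction A) auto

lemma subformulas_self: "A \<in> subformulas A"
  by (cases A) auto

lemma subformulas_trans: "A \<in> subformulas B \<Longrightarrow> subformulas A \<subseteq> subformulas B"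
  by (induction B) auto

lemma critical_not_tautology: "\<not> tautology critical"
proof
  assume taut: "tautology critical"
  have eq1: "abs_truth_value A = 1 \<longleftrightarrow> A \<in> critical_theory" for A
    using critical.mp[OF critical.Top_mem critical.weaken]
    by (simp add: one_truth_value_def truth_value.abs_eq_iff critical.one_le_iff)
  have "bot \<noteq> (1 :: truth_value)"
  proof
    assume "bot = (1 :: truth_value)"
    then have "Bot \<in> critical_theory" using eq1 by (simp add: bot_truth_value_def)
    then show False using critical_notin critical.mp[OF _ critical.provable[OF BL_provable.A7]] by blast
  qed
  then have "bot < (1 :: truth_value)" using le_one[of "bot :: truth_value"] by (simp add: less_le)
  moreover define X where "X = abs_truth_value ` subformulas critical"
  have "finite X" using finite_subformulas by (simp add: X_def)
  ultimately obtain h :: "truth_value \<Rightarrow> ereal" where h: "h bot = 0" "h 1 = \<infinity>"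
    "\<And>x. x \<in> X \<Longrightarrow> 0 \<le> h x" "\<And>x. x \<in> X \<Longrightarrow> h x = \<infinity> \<Longrightarrow> x = 1"
    "\<And>x y. x \<in> X \<Longrightarrow> y \<in> X \<Longrightarrow> x * y \<in> X \<Longrightarrow> h (x * y) = op_conj (h x) (h y)"
    "\<And>x y. x \<in> X \<Longrightarrow> y \<in> X \<Longrightarrow> x \<leadsto> y \<in> X \<Longrightarrow> h (x \<leadsto> y) = op_imp (h x) (h y)"
    using finite_embedding by blast
  \<comment> \<open>The map \<open>h\<close> is controlled on \<open>X\<close> only; variables that
    do not occur get 0 to keep the valuation nonnegative.\<close>
  define e where "e i = (if Var i \<in> subformulas critical then h (abs_truth_value (Var i)) else 0)" for i
  have val: "valuation (fm_val e)"
    using h(3) by (intro valuation_fm_val) (auto simp: e_def X_def)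
  have "fm_val e A = h (abs_truth_value A)" if "A \<in> subformulas critical" for A
    using that
  proof (induction A)
    case Bot
    then show ?case using h(1) by (simp add: bot_truth_value_def)
  next
    case (Var i)
    then show ?case by (simp add: e_def)
  next
    case (Conj A B)
    then have sub: "A \<in> subformulas critical" "B \<in> subformulas critical"
      using subformulas_trans[OF Conj.prems] subformulas_self by auto
    then show ?case
      using Conj h(5)[of "abs_truth_value A" "abs_truth_value B"]
      by (simp add: X_def times_truth_value.abs_eq)
  next
    case (Imp A B)
    then have sub: "A \<in> subformulas critical" "B \<in> subformulas critical"
      using subformulas_trans[OF Imp.prems] subformulas_self by auto
    then show ?case
      using Imp h(6)[of "abs_truth_value A" "abs_truth_value B"]
      by (simp add: X_def resid_truth_value.abs_eq)
  qed
  then have "h (abs_truth_value critical) = \<infinity>"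
    using taut val subformulas_self by (auto simp: tautology_def)
  then have "abs_truth_value critical = 1"
    using h(4) subformulas_self by (simp add: X_def)
  then show False using eq1 critical_notin by simp
qed

theorem BL_complete: "BL \<turnstile> A \<longleftrightarrow> tautology A"
  using BL_sound critical_tautology critical_not_tautology by (auto simp: tautology_def)

section \<open>Codes and the order of formulas\<close>

definition is_digit :: "char \<Rightarrow> bool" where
  "is_digit c \<longleftrightarrow> of_char c \<in> {48..57 :: nat}"

lemma decimal_digits: "c \<in> set (decimal n) \<Longrightarrow> is_digit c"
proof (induction n rule: less_induct)
  case (less n)
  have digit: "is_digit (char_of (48 + k))" if "k < 10" for k :: nat
    using that by (simp add: is_digit_def)
  show ?case
  proof (cases "n < 10")
    case True
    then show ?thesis using less.prems digit by (subst (asm) decimal.simps) simp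
  next
    case False
    then have "c \<in> set (decimal (n div 10)) \<or> c = char_of (48 + n mod 10)"
      using less.prems by (subst (asm) decimal.simps) auto
    then show ?thesis
    proof
      assume "c = char_of (48 + n mod 10)"
      then show ?thesis using digit[of "n mod 10"] by simp
    qed (use less.IH[of "n div 10"] False in simp)
  qed
qed

lemma decimal_nonempty: "decimal n \<noteq> []"
  by (subst decimal.simps) simp

lemma decimal_inj: "decimal m = decimal n \<Longrightarrow> m = n"
proof (induction m arbitrary: n rule: less_induct)
  case (less m)
  have last: "of_char (last (decimal k)) = 48 + k mod 10" for k
    by (subst decimal.simps) simp
  have butlast: "butlast (decimal k) = (if k < 10 then [] else decimal (k div 10))" for k
    by (subst decimal.simps) simp
  have mod: "m mod 10 = n mod 10" using last[of m] last[of n] less.prems by simp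
  have "(if m < 10 then [] else decimal (m div 10)) = (if n < 10 then [] else decimal (n div 10))"
    using butlast[of m] butlast[of n] less.prems by simp
  then have "m div 10 = n div 10"
    using less.IH[of "m div 10" "n div 10"] decimal_nonempty[of "m div 10"]
      decimal_nonempty[of "n div 10", symmetric]
    by (cases "m < 10"; cases "n < 10") simp_all
  then show ?case using mod by (metis div_mult_mod_eq)
qed

text \<open>The trailing strings let the induction enter compound formulas. They must not begin with
  a digit, which would extend the index of a final variable.\<close>

lemma fm_string_parse:
  assumes "fm_string A @ s = fm_string B @ t"
    and "s = [] \<or> \<not> is_digit (hd s)" "t = [] \<or> \<not> is_digit (hd t)"
  shows "A = B \<and> s = t"
  using assms
proof (induction A arbitrary: B s t)
  case Bot
  then show ?case by (cases B) auto
next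
  case (Var i)
  then obtain j where B: "B = Var j" and eq: "decimal i @ s = decimal j @ t" by (cases B) auto
  have "takeWhile is_digit (decimal k @ u) = decimal k"
    if "u = [] \<or> \<not> is_digit (hd u)" for k u
  proof -
    have "takeWhile is_digit u = []" using that by (cases u) auto
    then show ?thesis using decimal_digits[of _ k] by (subst takeWhile_append2) auto
  qed
  from this[OF Var.prems(2), of i] this[OF Var.prems(3), of j] eq
  have "decimal i = decimal j" by simp
  then show ?case using eq B decimal_inj by auto
next
  case (Conj A1 A2)
  consider B1 B2 where "B = B1 \<^bold>\<odot> B2" | B1 B2 where "B = B1 \<^bold>\<rightarrow> B2"
    using Conj.prems(1) by (cases B) auto
  then show ?case
  proof cases
    case 1
    then have "fm_string A1 @ ''&'' @ fm_string A2 @ '')'' @ s = fm_string B1 @ ''&'' @ fm_string B2 @ '')'' @ t"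
      using Conj.prems(1) by simp
    from Conj.IH(1)[OF this]
    have "A1 = B1" "fm_string A2 @ '')'' @ s = fm_string B2 @ '')'' @ t" by (simp_all add: is_digit_def)
    with Conj.IH(2)[OF this(2)] 1 show ?thesis by (simp add: is_digit_def)
  next
    case 2
    then have "fm_string A1 @ ''&'' @ fm_string A2 @ '')'' @ s = fm_string B1 @ ''->'' @ fm_string B2 @ '')'' @ t"
      using Conj.prems(1) by simp
    from Conj.IH(1)[OF this] show ?thesis by (simp add: is_digit_def)
  qed
next
  case (Imp A1 A2)
  consider B1 B2 where "B = B1 \<^bold>\<odot> B2" | B1 B2 where "B = B1 \<^bold>\<rightarrow> B2"
    using Imp.prems(1) by (cases B) auto
  then show ?case
  proof cases
    case 1
    then have "fm_string A1 @ ''->'' @ fm_string A2 @ '')'' @ s = fm_string B1 @ ''&'' @ fm_string B2 @ '')'' @ t"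
      using Imp.prems(1) by simp
    from Imp.IH(1)[OF this] show ?thesis by (simp add: is_digit_def)
  next
    case 2
    then have "fm_string A1 @ ''->'' @ fm_string A2 @ '')'' @ s = fm_string B1 @ ''->'' @ fm_string B2 @ '')'' @ t"
      using Imp.prems(1) by simp
    from Imp.IH(1)[OF this]
    have "A1 = B1" "fm_string A2 @ '')'' @ s = fm_string B2 @ '')'' @ t" by (simp_all add: is_digit_def)
    with Imp.IH(2)[OF this(2)] 2 show ?thesis by (simp add: is_digit_def)
  qed
qed

lemma fm_string_inj: "fm_string A = fm_string B \<Longrightarrow> A = B"
  using fm_string_parse[of A "[]" B "[]"] by simp

lemma inj_encode: "inj encode"
proof (rule injI)
  fix A B assume "encode A = encode B"
  moreover have "xs = ys" if "concat (map char_bits xs) = concat (map char_bits ys)" for xs ys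
    using that
  proof (induction xs arbitrary: ys)
    case Nil
    then show ?case by (cases ys) (auto simp: char_bits_def)
  next
    case (Cons x xs)
    obtain y zs where ys: "ys = y # zs"
      using Cons.prems by (cases ys) (simp_all add: char_bits_def)
    \<comment> \<open>Blocks of constant length make both bit strings split at the same
      place.\<close>
    have len: "length (char_bits c) = 8" for c by (simp add: char_bits_def)
    have "char_bits x = char_bits y" and "concat (map char_bits xs) = concat (map char_bits zs)"
      using Cons.prems by (simp_all add: ys len)
    moreover from this(1) have "x = y" by (cases x; cases y) (simp add: char_bits_def)
    ultimately show ?case using Cons.IH[of zs] by (simp add: ys)
  qed
  ultimately show "A = B" by (auto simp: encode_def intro: fm_string_inj)
qed

section \<open>The order of formulas and the pivot\<close>

lemma less_c_irrefl: "\<not> A <\<^sub>c A"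
  using lexord_irreflexive[of "{(x, y). (of_char x :: nat) < of_char y}" "fm_string A"]
  by (simp add: less_c_def)

lemma less_c_trans:
  assumes "A <\<^sub>c B" "B <\<^sub>c C"
  shows "A <\<^sub>c C"
proof -
  have "trans {(x, y). (of_char x :: nat) < of_char y}" by (auto intro: transI)
  from lexord_trans[OF _ _ this, of "fm_string A" "fm_string B" "fm_string C"] show ?thesis
    using assms unfolding less_c_def by linarith
qed

lemma less_c_total:
  assumes "A \<noteq> B"
  shows "A <\<^sub>c B \<or> B <\<^sub>c A"
proof -
  let ?r = "{(x, y). (of_char x :: nat) < of_char y}"
  have "(fm_string A, fm_string B) \<in> lexord ?r \<or> fm_string A = fm_string B \<or>
      (fm_string B, fm_string A) \<in> lexord ?r"
  proof (rule lexord_linear, intro allI)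
    fix a b :: char
    have "(of_char a :: nat) < of_char b \<or> (of_char a :: nat) = of_char b \<or> (of_char b :: nat) < of_char a"
      by (rule linorder_less_linear)
    then show "(a, b) \<in> ?r \<or> a = b \<or> (b, a) \<in> ?r" by simp
  qed
  then show ?thesis using assms fm_string_inj by (auto simp: less_c_def)
qed

lemma finite_formulas: "finite (formulas G)"
proof -
  have "finite (set_rseq S)" for S :: "fm rseq" by (cases S) auto
  then show ?thesis by (simp add: formulas_def)
qed

lemma pivot:
  assumes "formulas G \<noteq> {}"
  shows "pivot G \<in> formulas G" "\<And>E. E \<in> formulas G \<Longrightarrow> E \<noteq> pivot G \<Longrightarrow> E <\<^sub>c pivot G"
proof -
  have "\<exists>D\<in>F. \<forall>E\<in>F. E \<noteq> D \<longrightarrow> E <\<^sub>c D" if "finite F" "F \<noteq> {}" for F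
    using that
  proof (induction F rule: finite_ne_induct)
    case (insert A F)
    then obtain D where D: "D \<in> F" "\<forall>E\<in>F. E \<noteq> D \<longrightarrow> E <\<^sub>c D" by (elim bexE)
    show ?case
    proof (cases "A <\<^sub>c D")
      case True
      show ?thesis by (rule bexI[of _ D]) (use D True in auto)
    next
      case False
      then have "D <\<^sub>c A" using less_c_total[of A D] insert.hyps D(1) by auto
      then have "E <\<^sub>c A" if "E \<in> F" for E
        using D(2) that less_c_trans[of E D A] by (cases "E = D") auto
      then show ?thesis by simp
    qed
  qed simp
  then obtain D where D: "D \<in> formulas G" "\<And>E. E \<in> formulas G \<Longrightarrow> E \<noteq> D \<Longrightarrow> E <\<^sub>c D"
    using finite_formulas assms by metis
  have "pivot G = D"
    unfolding pivot_def
  proof (rule the_equality)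
    show "D' = D" if "D' \<in> formulas G \<and> (\<forall>E\<in>formulas G. E \<noteq> D' \<longrightarrow> E <\<^sub>c D')" for D'
      using that D(1) D(2)[of D'] less_c_trans[of D D' D] less_c_irrefl[of D] by metis
  qed (use D in blast)
  then show "pivot G \<in> formulas G" "\<And>E. E \<in> formulas G \<Longrightarrow> E \<noteq> pivot G \<Longrightarrow> E <\<^sub>c pivot G"
    using D by simp_all
qed

lemma atomic_iff_complexity: "atomic A \<longleftrightarrow> complexity A = 0"
  by (cases A) (auto simp: atomic_def)

lemma pivot_nonatomic:
  assumes "\<not> irreducible_hs G"
  shows "formulas G \<noteq> {}" "\<not> atomic (pivot G)"
proof -
  obtain E where E: "E \<in> formulas G" "\<not> atomic E" using assms by (auto simp: irreducible_hs_def)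
  then show "formulas G \<noteq> {}" by blast
  then have "E = pivot G \<or> complexity E \<le> complexity (pivot G)"
    using pivot(2)[of G E] E by (auto simp: less_c_def)
  then show "\<not> atomic (pivot G)" using E by (auto simp: atomic_iff_complexity)
qed

section \<open>Invertibility of the rewriting rules\<close>

lemma sat_union: "sat v (G |\<union>| G') \<longleftrightarrow> sat v G \<or> sat v G'"
  by (auto simp: sat_def)

lemma sat_insert: "sat v (finsert S G) \<longleftrightarrow> sat_seq v S \<or> sat v G"
  by (auto simp: sat_def)

lemma sat_empty [simp]: "\<not> sat v {||}"
  by (simp add: sat_def)

lemma sat_parts: "sat v G \<longleftrightarrow> sat v (part_G1 G D) \<or> sat v (part_G2 G D) \<or> sat v (part_H G D)"
proof -
  have "S \<in> fset (part_G1 G D) \<or> S \<in> fset (part_G2 G D) \<or> S \<in> fset (part_H G D)" if "S |\<in>| G" for S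
    using that by (cases S) (auto simp: part_G1_def part_G2_def part_H_def)
  moreover have "S |\<in>| G"
    if "S \<in> fset (part_G1 G D) \<or> S \<in> fset (part_G2 G D) \<or> S \<in> fset (part_H G D)" for S
    using that by (auto simp: part_G1_def part_G2_def part_H_def)
  ultimately show ?thesis unfolding sat_def by blast
qed

lemma part_G2_cases:
  assumes "S |\<in>| part_G2 G D"
  obtains R z \<Gamma> \<Delta> where "S = Cmp R z \<Gamma> \<Delta>" "D \<in># \<Gamma> + \<Delta>" "S |\<in>| G"
  using assms that by (auto simp: part_G2_def)

lemma sat_image_cong:
  "(\<And>S. S |\<in>| G \<Longrightarrow> sat_seq v (f S) = sat_seq v S) \<Longrightarrow> sat v (f |`| G) = sat v G"
  by (auto simp: sat_def)

lemma fpart_pt: "v A = pt n a \<Longrightarrow> 0 \<le> a \<Longrightarrow> a < 1 \<Longrightarrow> fpart v A = a"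
  by (simp add: fpart_def frac_unique_iff)

lemma ipart_eq_infinity_iff: "0 \<le> x \<Longrightarrow> ipart x = \<infinity> \<longleftrightarrow> x = \<infinity>"
  by (auto simp: ipart_def)

lemma less_if_ipart_less:
  assumes "0 \<le> x" "0 \<le> y" "ipart x < ipart y"
  shows "x < y"
proof (cases "x = \<infinity> \<or> y = \<infinity>")
  case False
  then obtain n a m b where xy: "x = pt n a" "0 \<le> a" "a < 1" "y = pt m b" "0 \<le> b" "b < 1"
    using assms by (metis pt_cases)
  then have "n < m" using assms(3) by simp
  then show ?thesis using pt_less_iff[of a b n m] xy by simp
qed (use assms in auto)

lemma op_conj_ipart_less:
  assumes "0 \<le> x" "0 \<le> y" "ipart x < ipart y"
  shows "op_conj x y = x"
proof -
  have "ipart x \<noteq> ipart y" "x \<le> y" using less_if_ipart_less[OF assms] assms(3) by auto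
  then show ?thesis by (simp add: op_conj_def min_def)
qed

text \<open>The value of the side \<open>\<Gamma>\<close> of a sequent in the second satisfaction clause.\<close>

definition excess :: "(fm \<Rightarrow> ereal) \<Rightarrow> fm multiset \<Rightarrow> real" where
  "excess v \<Gamma> = (\<Sum>A\<in>#\<Gamma>. fpart v A - 1)"

lemma excess_eq: "excess v \<Gamma> = (\<Sum>A\<in>#\<Gamma>. fpart v A) - real (size \<Gamma>)"
  by (induction \<Gamma>) (auto simp: excess_def)

lemma excess_plus [simp]: "excess v (\<Gamma> + \<Delta>) = excess v \<Gamma> + excess v \<Delta>"
  by (simp add: excess_def)

lemma excess_add_mset [simp]: "excess v (add_mset A \<Gamma>) = fpart v A - 1 + excess v \<Gamma>"
  by (simp add: excess_def)

lemma excess_empty [simp]: "excess v {#} = 0"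
  by (simp add: excess_def)

lemma excess_replicate [simp]: "excess v (replicate_mset n A) = real n * (fpart v A - 1)"
  by (induction n) (auto simp: algebra_simps)

lemma excess_repeat [simp]: "excess v (repeat_mset n \<Gamma>) = real n * excess v \<Gamma>"
  by (induction n) (auto simp: algebra_simps)

lemma delete_all_eq: "\<Gamma> = delete_all D \<Gamma> + replicate_mset (count \<Gamma> D) D"
  using multiset_partition[of \<Gamma> "\<lambda>F. F = D"] by (simp add: filter_eq_replicate_mset add.commute)

lemma excess_delete_all: "excess v \<Gamma> = excess v (delete_all D \<Gamma>) + real (count \<Gamma> D) * (fpart v D - 1)"
  by (metis delete_all_eq excess_plus excess_replicate)

lemma size_delete_all: "size \<Gamma> = size (delete_all D \<Gamma>) + count \<Gamma> D"
  by (metis delete_all_eq size_union size_replicate_mset)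

definition linear_sat :: "(fm \<Rightarrow> ereal) \<Rightarrow> cmp \<Rightarrow> int \<Rightarrow> fm multiset \<Rightarrow> fm multiset \<Rightarrow> bool" where
  "linear_sat v R z \<Gamma> \<Delta> \<longleftrightarrow> (\<exists>n::int. \<forall>A\<in>#\<Gamma> + \<Delta>. ipart (v A) = ereal (of_int n)) \<and>
    cmp_holds R (excess v \<Gamma>) (excess v \<Delta> + real_of_int z)"

text \<open>The reduction only produces such sequents. Sequents violating this condition are never
  satisfied, and replacing a pivot by two formulas could make them satisfiable.\<close>

fun proper_seq :: "fm rseq \<Rightarrow> bool" where
  "proper_seq (LL \<Gamma> \<Delta>) \<longleftrightarrow> True"
| "proper_seq (Cmp R z \<Gamma> \<Delta>) \<longleftrightarrow>
     2 \<le> size \<Gamma> + size \<Delta> \<and> (size \<Gamma> + size \<Delta> = 2 \<longrightarrow> z \<noteq> 0 \<or> size \<Gamma> = 1)"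

lemma cmp_holds_cong:
  fixes x y x' y' :: real
  shows "y - x = y' - x' \<Longrightarrow> cmp_holds R x y = cmp_holds R x' y'"
  by (cases R) auto

lemma cmp_holds_minus: "cmp_holds R (x - c) (y - c) \<longleftrightarrow> cmp_holds R x (y :: real)"
  by (rule cmp_holds_cong) simp

lemma cmp_holds_pt:
  assumes "0 \<le> a" "a < 1" "0 \<le> b" "b < 1"
  shows "cmp_holds R (pt n a) (pt n b) \<longleftrightarrow> cmp_holds R a b"
  by (cases R) auto

text \<open>For two single formulas at index 0, a finite member excludes a pair of infinite values;
  with a common finite integer part, comparing values is comparing fractional parts. All other
  proper sequents fall under the linear clause by definition.\<close>

lemma sat_seq_linear:
  assumes proper: "proper_seq (Cmp R z \<Gamma> \<Delta>)" and D: "D \<in># \<Gamma> + \<Delta>" "v D \<noteq> \<infinity>"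
    and nonneg: "\<And>A. 0 \<le> v A"
  shows "sat_seq v (Cmp R z \<Gamma> \<Delta>) \<longleftrightarrow> linear_sat v R z \<Gamma> \<Delta>"
proof (cases "z = 0 \<and> size \<Gamma> = 1 \<and> size \<Delta> = 1")
  case True
  then have "size \<Gamma> = 1" "size \<Delta> = 1" by simp_all
  then obtain A B where AB: "\<Gamma> = {#A#}" "\<Delta> = {#B#}"
    using size_1_singleton_mset[of \<Gamma>] size_1_singleton_mset[of \<Delta>] by blast
  have sat: "sat_seq v (Cmp R z \<Gamma> \<Delta>) \<longleftrightarrow> ipart (v A) = ipart (v B) \<and> cmp_holds R (v A) (v B)"
    using True by (simp add: AB)
  have lin: "linear_sat v R z \<Gamma> \<Delta> \<longleftrightarrow>
      (\<exists>n::int. ipart (v A) = ereal (of_int n) \<and> ipart (v B) = ereal (of_int n)) \<and>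
      cmp_holds R (fpart v A) (fpart v B)"
    using True by (simp add: AB linear_sat_def cmp_holds_minus) blast
  show ?thesis
  proof (cases "v A = \<infinity> \<or> v B = \<infinity>")
    case inf: True
    then have "ipart (v A) \<noteq> ipart (v B)"
      using D nonneg[of A] nonneg[of B] ipart_eq_infinity_iff[of "v A"] ipart_eq_infinity_iff[of "v B"]
      by (auto simp: AB)
    then show ?thesis unfolding sat lin by metis
  next
    case False
    obtain n a where A: "v A = pt n a" "0 \<le> a" "a < 1" using False by - (rule pt_cases[OF nonneg[of A]], auto)
    obtain m b where B: "v B = pt m b" "0 \<le> b" "b < 1" using False by - (rule pt_cases[OF nonneg[of B]], auto)
    have i: "ipart (v A) = ereal (of_int n)" "ipart (v B) = ereal (of_int m)"
      using A B by simp_all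
    have f: "fpart v A = a" "fpart v B = b"
      by (rule fpart_pt[where v = v, OF A], rule fpart_pt[where v = v, OF B])
    have "cmp_holds R (v A) (v B) \<longleftrightarrow> cmp_holds R a b" if "n = m"
      unfolding A(1) B(1) that by (rule cmp_holds_pt) (use A B in simp_all)
    then show ?thesis unfolding sat lin i f by (cases "n = m") simp_all
  qed
next
  case False
  have size: "2 \<le> size \<Gamma> + size \<Delta>" using proper by simp
  have index: "z \<noteq> 0" if "size \<Gamma> + size \<Delta> = 2"
  proof
    assume "z = 0"
    then have "size \<Gamma> = 1" using proper that by simp
    then show False using False that \<open>z = 0\<close> by simp
  qed
  have not_single: "\<not> (\<Gamma> = {#A#} \<and> \<Delta> = {#B#} \<and> z = 0)" for A B
  proof
    assume "\<Gamma> = {#A#} \<and> \<Delta> = {#B#} \<and> z = 0"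
    then show False using False by simp
  qed
  show ?thesis
    unfolding sat_seq.simps(2) linear_sat_def excess_eq using size index not_single by blast
qed

lemma linear_sat_subst:
  assumes "D \<in># \<Gamma> + \<Delta>" "set_mset (\<Gamma>' + \<Delta>') = set_mset (\<Gamma> + \<Delta>) - {D} \<union> {A, B}"
    and "ipart (v A) = ipart (v D)" "ipart (v B) = ipart (v D)"
    and "excess v \<Delta> + z - excess v \<Gamma> = excess v \<Delta>' + z' - excess v \<Gamma>'"
  shows "linear_sat v R z \<Gamma> \<Delta> \<longleftrightarrow> linear_sat v R z' \<Gamma>' \<Delta>'"
proof -
  have "(\<forall>F\<in>#\<Gamma> + \<Delta>. ipart (v F) = x) \<longleftrightarrow> (\<forall>F\<in>#\<Gamma>' + \<Delta>'. ipart (v F) = x)" for x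
    unfolding assms(2) using assms(1,3,4) by auto
  moreover have "cmp_holds R (excess v \<Gamma>) (excess v \<Delta> + z) = cmp_holds R (excess v \<Gamma>') (excess v \<Delta>' + z')"
    by (rule cmp_holds_cong) (rule assms(5))
  ultimately show ?thesis unfolding linear_sat_def by simp
qed

lemma set_mset_delete_all: "set_mset (delete_all D \<Gamma>) = set_mset \<Gamma> - {D}"
  by auto

lemma count_pos: "D \<in># \<Gamma> + \<Delta> \<Longrightarrow> 0 < count \<Gamma> D + count \<Delta> D"
  by (auto simp: count_greater_zero_iff[symmetric] simp del: count_greater_zero_iff)

text \<open>With at least three formulas the result is proper whatever its index, and only the
  linear clause of satisfaction can apply.\<close>

lemma size_subst2:
  assumes "proper_seq (Cmp R z \<Gamma> \<Delta>)" "D \<in># \<Gamma> + \<Delta>"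
  shows "3 \<le> size (delete_all D \<Gamma> + repeat_mset (count \<Gamma> D) {#A, B#}) +
    size (delete_all D \<Delta> + repeat_mset (count \<Delta> D) {#A, B#})"
proof -
  have "2 \<le> size \<Gamma> + size \<Delta>" using assms(1) by simp
  then show ?thesis
    using size_delete_all[of \<Gamma> D] size_delete_all[of \<Delta> D] count_pos[OF assms(2)]
    unfolding size_union size_repeat_mset size_add_mset size_empty by linarith
qed

lemma size_subst_imp:
  assumes "proper_seq (Cmp R z \<Gamma> \<Delta>)" "D \<in># \<Gamma> + \<Delta>"
  shows "3 \<le> size (delete_all D \<Gamma> + replicate_mset (count \<Delta> D) A + replicate_mset (count \<Gamma> D) B) +
    size (delete_all D \<Delta> + replicate_mset (count \<Gamma> D) A + replicate_mset (count \<Delta> D) B)"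
proof -
  have "2 \<le> size \<Gamma> + size \<Delta>" using assms(1) by simp
  then show ?thesis
    using size_delete_all[of \<Gamma> D] size_delete_all[of \<Delta> D] count_pos[OF assms(2)]
    unfolding size_union size_replicate_mset by linarith
qed

text \<open>The situation in which the arithmetic substitutions are made: the pivot and both of its
  parts have one finite integer part, so exchanging them preserves the condition on integer
  parts.\<close>

locale component_value =
  fixes v :: "fm \<Rightarrow> ereal" and A B D :: fm
  assumes nonneg: "\<And>F. 0 \<le> v F"
    and finite_D: "v D \<noteq> \<infinity>"
    and ipart_A: "ipart (v A) = ipart (v D)" and ipart_B: "ipart (v B) = ipart (v D)"
begin

lemma sat_seq_subst:
  assumes "proper_seq (Cmp R z \<Gamma> \<Delta>)" "D \<in># \<Gamma> + \<Delta>"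
    and "set_mset (\<Gamma>' + \<Delta>') = set_mset (\<Gamma> + \<Delta>) - {D} \<union> {A, B}"
    and "3 \<le> size \<Gamma>' + size \<Delta>'"
    and "excess v \<Delta> + z - excess v \<Gamma> = excess v \<Delta>' + z' - excess v \<Gamma>'"
  shows "sat_seq v (Cmp R z' \<Gamma>' \<Delta>') \<longleftrightarrow> sat_seq v (Cmp R z \<Gamma> \<Delta>)"
proof -
  have "v A \<noteq> \<infinity>"
    using ipart_A finite_D nonneg ipart_eq_infinity_iff by metis
  moreover have "A \<in># \<Gamma>' + \<Delta>'" using assms(3) by blast
  moreover have "proper_seq (Cmp R z' \<Gamma>' \<Delta>')" using assms(1,4) by auto
  ultimately have "sat_seq v (Cmp R z' \<Gamma>' \<Delta>') \<longleftrightarrow> linear_sat v R z' \<Gamma>' \<Delta>'"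
    using sat_seq_linear nonneg by blast
  then show ?thesis
    using sat_seq_linear[where v = v, OF assms(1,2) finite_D nonneg]
      linear_sat_subst[OF assms(2,3) ipart_A ipart_B assms(5)] by simp
qed

text \<open>With a and b the fractional parts of A and B, the pivot has excess a + b - 2, the sum of
  the excesses of its parts, so each side keeps its value.\<close>

lemma sat_subst2:
  assumes "fpart v D = fpart v A + fpart v B - 1"
    and "proper_seq (Cmp R z \<Gamma> \<Delta>)" "D \<in># \<Gamma> + \<Delta>"
  shows "sat_seq v (subst2 D A B (Cmp R z \<Gamma> \<Delta>)) \<longleftrightarrow> sat_seq v (Cmp R z \<Gamma> \<Delta>)"
proof -
  have count: "0 < count \<Gamma> D + count \<Delta> D"
    using assms(3) by (rule count_pos)
  show ?thesis
    unfolding subst2.simps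
  proof (rule sat_seq_subst[OF assms(2,3)])
    show "set_mset (delete_all D \<Gamma> + repeat_mset (count \<Gamma> D) {#A, B#} +
        (delete_all D \<Delta> + repeat_mset (count \<Delta> D) {#A, B#})) = set_mset (\<Gamma> + \<Delta>) - {D} \<union> {A, B}"
      using count by (auto simp: set_mset_delete_all count_eq_zero_iff)
    show "3 \<le> size (delete_all D \<Gamma> + repeat_mset (count \<Gamma> D) {#A, B#}) +
        size (delete_all D \<Delta> + repeat_mset (count \<Delta> D) {#A, B#})"
      by (rule size_subst2[OF assms(2,3)])
    show "excess v \<Delta> + z - excess v \<Gamma> = excess v (delete_all D \<Delta> + repeat_mset (count \<Delta> D) {#A, B#}) + z -
        excess v (delete_all D \<Gamma> + repeat_mset (count \<Gamma> D) {#A, B#})"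
      by (simp only: excess_delete_all[of v \<Gamma> D] excess_delete_all[of v \<Delta> D] excess_plus
          excess_repeat excess_add_mset excess_empty assms(1)) (simp add: algebra_simps)
  qed
qed

text \<open>A truncated product has fractional part 0, so each occurrence contributes -1, which
  moves into the index. The copies of A and B on the two sides cancel in the inequality but stay
  subject to the condition on integer parts.\<close>

lemma sat_subst_conj_shift:
  assumes "D = A \<^bold>\<odot> B" "fpart v D = 0"
    and "proper_seq (Cmp R z \<Gamma> \<Delta>)" "D \<in># \<Gamma> + \<Delta>"
  shows "sat_seq v (subst_conj_shift A B (Cmp R z \<Gamma> \<Delta>)) \<longleftrightarrow> sat_seq v (Cmp R z \<Gamma> \<Delta>)"
proof -
  show ?thesis
    unfolding subst_conj_shift.simps Let_def assms(1)[symmetric]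
  proof (rule sat_seq_subst[OF assms(3,4)])
    show "set_mset (delete_all D \<Gamma> + {#A, B#} + (delete_all D \<Delta> + {#A, B#})) =
        set_mset (\<Gamma> + \<Delta>) - {D} \<union> {A, B}"
      by (auto simp: set_mset_delete_all)
    show "3 \<le> size (delete_all D \<Gamma> + {#A, B#}) + size (delete_all D \<Delta> + {#A, B#})" by simp
    show "excess v \<Delta> + z - excess v \<Gamma> = excess v (delete_all D \<Delta> + {#A, B#}) +
        real_of_int (z + int (count \<Gamma> D) - int (count \<Delta> D)) - excess v (delete_all D \<Gamma> + {#A, B#})"
      using assms(2) by (simp add: excess_delete_all[of v \<Gamma> D] excess_delete_all[of v \<Delta> D])
  qed
qed

text \<open>The excess of the pivot is that of B minus that of A; the negative term goes to the
  opposite side.\<close>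

lemma sat_subst_imp:
  assumes "D = A \<^bold>\<rightarrow> B" "fpart v D = 1 - fpart v A + fpart v B"
    and "proper_seq (Cmp R z \<Gamma> \<Delta>)" "D \<in># \<Gamma> + \<Delta>"
  shows "sat_seq v (subst_imp A B (Cmp R z \<Gamma> \<Delta>)) \<longleftrightarrow> sat_seq v (Cmp R z \<Gamma> \<Delta>)"
proof -
  have count: "0 < count \<Gamma> D + count \<Delta> D"
    using assms(4) by (rule count_pos)
  show ?thesis
    unfolding subst_imp.simps Let_def assms(1)[symmetric]
  proof (rule sat_seq_subst[OF assms(3,4)])
    let ?\<Gamma> = "delete_all D \<Gamma> + replicate_mset (count \<Delta> D) A + replicate_mset (count \<Gamma> D) B"
    let ?\<Delta> = "delete_all D \<Delta> + replicate_mset (count \<Gamma> D) A + replicate_mset (count \<Delta> D) B"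
    show "set_mset (?\<Gamma> + ?\<Delta>) = set_mset (\<Gamma> + \<Delta>) - {D} \<union> {A, B}"
      using count by (auto simp: set_mset_delete_all count_eq_zero_iff)
    show "3 \<le> size ?\<Gamma> + size ?\<Delta>"
      by (rule size_subst_imp[OF assms(3,4)])
    show "excess v \<Delta> + z - excess v \<Gamma> = excess v ?\<Delta> + z - excess v ?\<Gamma>"
      by (simp only: excess_delete_all[of v \<Gamma> D] excess_delete_all[of v \<Delta> D] excess_plus
          excess_replicate assms(2)) (simp add: algebra_simps)
  qed
qed

end

lemma sat_seq_map:
  assumes "\<And>F. v (f F) = v F"
  shows "sat_seq v (map_rseq f S) \<longleftrightarrow> sat_seq v S"
proof (cases S)
  case (LL \<Gamma> \<Delta>)
  then show ?thesis using assms by (cases \<Gamma>; cases \<Delta>) auto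
next
  case (Cmp R z \<Gamma> \<Delta>)
  have fp: "fpart v (f F) = fpart v F" for F by (simp add: fpart_def assms)
  have single: "image_mset f M = {#F#} \<longleftrightarrow> (\<exists>E. M = {#E#} \<and> F = f E)" for M F
  proof
    assume single: "image_mset f M = {#F#}"
    then have "size M = 1" using size_image_mset[of f M] by simp
    then show "\<exists>E. M = {#E#} \<and> F = f E" using size_1_singleton_mset[of M] single by auto
  qed auto
  have sum: "(\<Sum>A\<in>#image_mset f M. fpart v A) = (\<Sum>A\<in>#M. fpart v A)" for M
    by (simp add: image_mset.compositionality comp_def fp)
  have "(\<forall>A\<in>#image_mset f \<Gamma> + image_mset f \<Delta>. ipart (v A) = x) \<longleftrightarrow>
      (\<forall>A\<in>#\<Gamma> + \<Delta>. ipart (v A) = x)" for x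
    using assms by (simp add: ball_Un)
  then show ?thesis
    unfolding Cmp rseq.map sat_seq.simps size_image_mset sum single using assms by auto
qed

lemma sat_seq_subst1: "v E = v D \<Longrightarrow> sat_seq v (subst1 D E S) \<longleftrightarrow> sat_seq v S"
  unfolding subst1_def by (rule sat_seq_map) simp

lemma sat_subst1: "v E = v D \<Longrightarrow> sat v (subst1 D E |`| G) \<longleftrightarrow> sat v G"
  by (rule sat_image_cong) (rule sat_seq_subst1)

text \<open>A \<lless>-sequent sees only integer parts. This is why the rules may put the simpler
  part of the pivot in its place even though the values differ.\<close>

lemma sat_subst1_LL:
  assumes "ipart (v E) = ipart (v D)"
  shows "sat v (subst1 D E |`| part_G1 G D) \<longleftrightarrow> sat v (part_G1 G D)"
proof (rule sat_image_cong)
  fix S assume "S |\<in>| part_G1 G D"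
  then obtain \<Gamma> \<Delta> where S: "S = LL \<Gamma> \<Delta>" by (auto simp: part_G1_def)
  show "sat_seq v (subst1 D E S) = sat_seq v S"
    unfolding S subst1_def using assms by (cases \<Gamma>; cases \<Delta>) auto
qed

text \<open>An infinite pivot has no finite integer part, so the linear clause fails. In the other
  clause both formulas are infinite, so a strict comparison fails too; every sequent that can be
  satisfied lies in \<open>part_G3\<close>.\<close>

lemma sat_subst1_Top:
  assumes nonneg: "\<And>F. 0 \<le> v F" and "v D = \<infinity>" "v Top = \<infinity>"
  shows "sat v (subst1 D Top |`| part_G3 G D) \<longleftrightarrow> sat v (part_G2 G D)"
proof -
  have "S |\<in>| part_G3 G D" if S: "S |\<in>| part_G2 G D" "sat_seq v S" for S
  proof -
    obtain R z \<Gamma> \<Delta> where Cmp: "S = Cmp R z \<Gamma> \<Delta>" and D: "D \<in># \<Gamma> + \<Delta>"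
      using S by (auto simp: part_G2_def)
    have "ipart (v D) = \<infinity>" using assms by simp
    then have "\<not> (\<exists>n::int. \<forall>A\<in>#\<Gamma> + \<Delta>. ipart (v A) = ereal (of_int n))" using D by force
    then obtain A B where AB: "\<Gamma> = {#A#}" "\<Delta> = {#B#}" "z = 0" "ipart (v A) = ipart (v B)"
      "cmp_holds R (v A) (v B)"
      using S(2) unfolding Cmp sat_seq.simps by blast
    then have "ipart (v A) = \<infinity>" "ipart (v B) = \<infinity>" using D assms(2) by auto
    then have "v A = \<infinity>" "v B = \<infinity>" using ipart_eq_infinity_iff nonneg by blast+
    then have "R = Preceq" using AB by (cases R) auto
    then show ?thesis using S AB Cmp by (simp add: part_G3_def)
  qed
  moreover have "S |\<in>| part_G2 G D" if "S |\<in>| part_G3 G D" for S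
    using that by (simp add: part_G3_def)
  ultimately have "sat v (part_G3 G D) \<longleftrightarrow> sat v (part_G2 G D)" unfolding sat_def by blast
  then show ?thesis using sat_subst1[of v Top D] assms by simp
qed

lemma sat_not_ll: "sat v (not_ll A B) \<longleftrightarrow> \<not> ipart (v A) < ipart (v B)"
  by (auto simp: not_ll_def sat_insert)

section \<open>Antecedents and rules under a fixed valuation\<close>

context
  fixes v :: "fm \<Rightarrow> ereal"
  assumes v: "valuation v"
begin

lemma v_nonneg [simp]: "0 \<le> v A"
  using valuation_nonneg[OF v] .

lemma v_Top: "v Top = \<infinity>"
  using v op_imp_eq_infinity_iff[of 0 0] by (simp add: valuation_def)

lemma sat_not_le: "sat v (not_le A B) \<longleftrightarrow> \<not> v A \<le> v B"
proof -
  have "v B < v A" if "ipart (v B) < ipart (v A)" using less_if_ipart_less that by simp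
  moreover have "ipart (v B) \<le> ipart (v A)" if "v B < v A" using that less_if_ipart_less[of "v A" "v B"] by force
  ultimately show ?thesis by (auto simp: not_le_def sat_insert not_le)
qed

lemma sat_not_preceq_Top: "sat v (not_preceq Top A) \<longleftrightarrow> v A \<noteq> \<infinity>"
  using ipart_eq_infinity_iff[of "v A"] v_Top by (auto simp: not_preceq_def sat_insert)

lemma sat_not_prec: "sat v (not_prec A B) \<longleftrightarrow> \<not> (ipart (v A) = ipart (v B) \<and> v A < v B)"
  by (auto simp: not_prec_def sat_insert)

lemma sat_not_sim: "sat v (not_sim A B) \<longleftrightarrow> ipart (v A) \<noteq> ipart (v B)"
  by (auto simp: not_sim_def sat_insert)

lemma sat_not_ll_Top: "sat v (not_ll A Top) \<longleftrightarrow> v A = \<infinity>"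
  using ipart_eq_infinity_iff[of "v A"] v_Top by (auto simp: sat_not_ll)

lemma sat_not_preceq1:
  "sat v (not_preceq1 A B) \<longleftrightarrow>
    \<not> (ipart (v A) = ipart (v B) \<and> v A \<noteq> \<infinity> \<and> v B \<noteq> \<infinity> \<and> 1 \<le> fpart v A + fpart v B)"
proof -
  have "\<exists>n::int. ipart (v A) = ereal (of_int n)" if "v A \<noteq> \<infinity>"
    using that by - (rule pt_cases[OF v_nonneg[of A]], auto)
  then show ?thesis
    unfolding not_preceq1_def sat_union sat_not_sim sat_not_ll_Top sat_insert by auto
qed

lemma sat_not_precm1:
  "sat v (not_precm1 A B) \<longleftrightarrow>
    \<not> (ipart (v A) = ipart (v B) \<and> v A \<noteq> \<infinity> \<and> v B \<noteq> \<infinity> \<and> fpart v A + fpart v B < 1)"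
proof -
  have "\<exists>n::int. ipart (v A) = ereal (of_int n)" if "v A \<noteq> \<infinity>"
    using that by - (rule pt_cases[OF v_nonneg[of A]], auto)
  then show ?thesis
    unfolding not_precm1_def sat_union sat_not_sim sat_not_ll_Top sat_insert by auto
qed

lemma conj_rule_sound:
  assumes proper: "\<And>S. S |\<in>| G \<Longrightarrow> proper_seq S"
  shows "(\<forall>P\<in>set (conj_premises G A B). sat v P) \<longleftrightarrow> sat v G"
proof -
  define D where "D = A \<^bold>\<odot> B"
  define C where "C = least_of A B"
  have vD: "v D = op_conj (v A) (v B)" using v by (simp add: D_def valuation_def)
  have H: "sat v (part_H G D) \<Longrightarrow> sat v G" by (auto simp: sat_def part_H_def)
  have C: "C = A \<or> C = B" by (simp add: C_def least_of_def)
  note parts = sat_parts[of v G D]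
  have Top_subst: "sat v (subst1 D Top |`| part_G1 G D) \<longleftrightarrow> sat v (part_G1 G D)"
    "sat v (subst1 D Top |`| part_G3 G D) \<longleftrightarrow> sat v (part_G2 G D)" if "v D = \<infinity>"
    using sat_subst1[of v Top D] sat_subst1_Top[of v D G] v_Top that by simp_all
  have p1: "sat v (not_ll A B |\<union>| (subst1 D A |`| G |\<union>| part_H G D)) \<longleftrightarrow>
      (ipart (v A) < ipart (v B) \<longrightarrow> sat v G)"
  proof -
    have "v A = v D" if "ipart (v A) < ipart (v B)"
      using that by (simp add: vD op_conj_ipart_less)
    then show ?thesis using sat_subst1[of v A D] H unfolding sat_union sat_not_ll by blast
  qed
  have p2: "sat v (not_ll B A |\<union>| (subst1 D B |`| G |\<union>| part_H G D)) \<longleftrightarrow>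
      (ipart (v B) < ipart (v A) \<longrightarrow> sat v G)"
  proof -
    have "v B = v D" if "ipart (v B) < ipart (v A)"
      using that by (simp add: vD op_conj_comm[of "v A"] op_conj_ipart_less)
    then show ?thesis using sat_subst1[of v B D] H unfolding sat_union sat_not_ll by blast
  qed
  \<comment> \<open>Premises three and four split this case by whether the product is truncated; two
    infinite values are left to premise five.\<close>
  define same where "same \<longleftrightarrow> ipart (v A) = ipart (v B) \<and> v A \<noteq> \<infinity> \<and> v B \<noteq> \<infinity>"
  have same: "component_value v A B D" "ipart (v C) = ipart (v D)"
      "fpart v D = max 0 (fpart v A + fpart v B - 1)" if same
  proof -
    obtain n a where A: "v A = pt n a" "0 \<le> a" "a < 1"
      using \<open>same\<close> by - (rule pt_cases[OF v_nonneg[of A]], auto simp: same_def)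
    obtain m b where B: "v B = pt m b" "0 \<le> b" "b < 1"
      using \<open>same\<close> by - (rule pt_cases[OF v_nonneg[of B]], auto simp: same_def)
    have "n = m" using \<open>same\<close> A B by (simp add: same_def)
    then have D: "v D = pt n (max 0 (a + b - 1))" "max 0 (a + b - 1) < 1" "0 \<le> max 0 (a + b - 1)"
      using A B op_conj_pt[OF A(2,3) B(2,3), of n m] by (simp_all add: vD)
    have i: "ipart (v A) = ereal (of_int n)" "ipart (v B) = ereal (of_int n)"
      "ipart (v D) = ereal (of_int n)"
      unfolding A(1) B(1) D(1) using A B D \<open>n = m\<close> by (simp_all del: max_def)
    show "component_value v A B D" using i D by unfold_locales auto
    show "ipart (v C) = ipart (v D)" using C i by auto
    show "fpart v D = max 0 (fpart v A + fpart v B - 1)"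
      using fpart_pt[where v = v, OF A] fpart_pt[where v = v, OF B]
        fpart_pt[where v = v, OF D(1,3,2)] by simp
  qed
  have p3: "sat v (not_preceq1 A B |\<union>|
      (subst1 D C |`| part_G1 G D |\<union>| subst2 D A B |`| part_G2 G D |\<union>| part_H G D)) \<longleftrightarrow>
      (same \<and> 1 \<le> fpart v A + fpart v B \<longrightarrow> sat v G)"
  proof -
    have "sat v (subst2 D A B |`| part_G2 G D) \<longleftrightarrow> sat v (part_G2 G D)"
      if "same" "1 \<le> fpart v A + fpart v B"
    proof (rule sat_image_cong)
      interpret component_value v A B D using same that by blast
      fix S assume "S |\<in>| part_G2 G D"
      then obtain R z \<Gamma> \<Delta> where S: "S = Cmp R z \<Gamma> \<Delta>" "D \<in># \<Gamma> + \<Delta>" "S |\<in>| G"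
        by (rule part_G2_cases)
      have "proper_seq (Cmp R z \<Gamma> \<Delta>)" using proper[OF S(3)] S(1) by simp
      with S(1,2) show "sat_seq v (subst2 D A B S) \<longleftrightarrow> sat_seq v S"
        using sat_subst2 same(3)[OF that(1)] that(2) by simp
    qed
    moreover have "sat v (not_preceq1 A B) \<longleftrightarrow> \<not> (same \<and> 1 \<le> fpart v A + fpart v B)"
      by (simp add: sat_not_preceq1 same_def)
    ultimately show ?thesis
      unfolding sat_union using parts same(2) sat_subst1_LL[of v C D G] by blast
  qed
  have p4: "sat v (not_precm1 A B |\<union>|
      (subst1 D C |`| part_G1 G D |\<union>| subst_conj_shift A B |`| part_G2 G D |\<union>| part_H G D)) \<longleftrightarrow>
      (same \<and> fpart v A + fpart v B < 1 \<longrightarrow> sat v G)"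
  proof -
    have "sat v (subst_conj_shift A B |`| part_G2 G D) \<longleftrightarrow> sat v (part_G2 G D)"
      if "same" "fpart v A + fpart v B < 1"
    proof (rule sat_image_cong)
      interpret component_value v A B D using same that by blast
      fix S assume "S |\<in>| part_G2 G D"
      then obtain R z \<Gamma> \<Delta> where S: "S = Cmp R z \<Gamma> \<Delta>" "D \<in># \<Gamma> + \<Delta>" "S |\<in>| G"
        by (rule part_G2_cases)
      have "proper_seq (Cmp R z \<Gamma> \<Delta>)" using proper[OF S(3)] S(1) by simp
      with S(1,2) show "sat_seq v (subst_conj_shift A B S) \<longleftrightarrow> sat_seq v S"
        using sat_subst_conj_shift[OF D_def] same(3)[OF that(1)] that(2) by simp
    qed
    moreover have "sat v (not_precm1 A B) \<longleftrightarrow> \<not> (same \<and> fpart v A + fpart v B < 1)"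
      by (simp add: sat_not_precm1 same_def)
    ultimately show ?thesis
      unfolding sat_union using parts same(2) sat_subst1_LL[of v C D G] by blast
  qed
  have p5: "sat v ((not_preceq Top A |\<union>| not_preceq Top B) |\<union>|
      (subst1 D Top |`| part_G1 G D |\<union>| subst1 D Top |`| part_G3 G D |\<union>| part_H G D)) \<longleftrightarrow>
      (v A = \<infinity> \<and> v B = \<infinity> \<longrightarrow> sat v G)"
  proof -
    have D: "v D = \<infinity>" if "v A = \<infinity>" "v B = \<infinity>" using that by (simp add: vD)
    then show ?thesis
      unfolding sat_union sat_not_preceq_Top using parts Top_subst by blast
  qed
  have "(\<forall>P\<in>set (conj_premises G A B). sat v P) \<longleftrightarrow>
    (ipart (v A) < ipart (v B) \<longrightarrow> sat v G) \<and> (ipart (v B) < ipart (v A) \<longrightarrow> sat v G) \<and>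
    (same \<and> 1 \<le> fpart v A + fpart v B \<longrightarrow> sat v G) \<and>
    (same \<and> fpart v A + fpart v B < 1 \<longrightarrow> sat v G) \<and> (v A = \<infinity> \<and> v B = \<infinity> \<longrightarrow> sat v G)"
    unfolding conj_premises_def Let_def D_def[symmetric] C_def[symmetric]
    using p1 p2 p3 p4 p5 by simp
  moreover have "ipart (v A) < ipart (v B) \<or> ipart (v B) < ipart (v A) \<or> same \<or> v A = \<infinity> \<and> v B = \<infinity>"
    using ipart_eq_infinity_iff[of "v A"] ipart_eq_infinity_iff[of "v B"] by (auto simp: same_def)
  ultimately show ?thesis by auto
qed

lemma imp_rule_sound:
  assumes proper: "\<And>S. S |\<in>| G \<Longrightarrow> proper_seq S"
  shows "(\<forall>P\<in>set (imp_premises G A B). sat v P) \<longleftrightarrow> sat v G"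
proof -
  define D where "D = A \<^bold>\<rightarrow> B"
  define C where "C = least_of A B"
  have vD: "v D = op_imp (v A) (v B)" using v by (simp add: D_def valuation_def)
  have H: "sat v (part_H G D) \<Longrightarrow> sat v G" by (auto simp: sat_def part_H_def)
  have C: "C = A \<or> C = B" by (simp add: C_def least_of_def)
  note parts = sat_parts[of v G D]
  have Top_subst: "sat v (subst1 D Top |`| part_G1 G D) \<longleftrightarrow> sat v (part_G1 G D)"
    "sat v (subst1 D Top |`| part_G3 G D) \<longleftrightarrow> sat v (part_G2 G D)" if "v D = \<infinity>"
    using sat_subst1[of v Top D] sat_subst1_Top[of v D G] v_Top that by simp_all
  have p1: "sat v (not_ll B A |\<union>| (subst1 D B |`| G |\<union>| part_H G D)) \<longleftrightarrow>
      (ipart (v B) < ipart (v A) \<longrightarrow> sat v G)"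
  proof -
    have "v B = v D" if "ipart (v B) < ipart (v A)" using that by (simp add: vD op_imp_def)
    then show ?thesis using sat_subst1[of v B D] H unfolding sat_union sat_not_ll by blast
  qed
  have same: "component_value v A B D" "ipart (v C) = ipart (v D)"
      "fpart v D = 1 - fpart v A + fpart v B" if same: "ipart (v B) = ipart (v A)" "v B < v A"
  proof -
    have fin: "v A \<noteq> \<infinity>" "v B \<noteq> \<infinity>"
      using same ipart_eq_infinity_iff[of "v A"] ipart_eq_infinity_iff[of "v B"] by auto
    obtain n a where A: "v A = pt n a" "0 \<le> a" "a < 1"
      using fin(1) by - (rule pt_cases[OF v_nonneg[of A]], auto)
    obtain m b where B: "v B = pt m b" "0 \<le> b" "b < 1"
      using fin(2) by - (rule pt_cases[OF v_nonneg[of B]], auto)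
    have nm: "n = m" using same A B by simp
    have "b < a" using same(2) A B nm by simp
    then have D: "v D = pt n (1 - a + b)" "1 - a + b < 1" "0 \<le> 1 - a + b"
      using A B op_imp_pt[OF A(2,3) B(2,3), of n m] nm by (simp_all add: vD)
    have i: "ipart (v A) = ereal (of_int n)" "ipart (v B) = ereal (of_int n)"
      "ipart (v D) = ereal (of_int n)"
      unfolding A(1) B(1) D(1) using A B D(2,3) nm by (simp_all only: ipart_pt)
    show "component_value v A B D" using i D by unfold_locales auto
    show "ipart (v C) = ipart (v D)" using C i by auto
    show "fpart v D = 1 - fpart v A + fpart v B"
      using fpart_pt[where v = v, OF A] fpart_pt[where v = v, OF B]
        fpart_pt[where v = v, OF D(1,3,2)] by simp
  qed
  have p2: "sat v (not_prec B A |\<union>|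
      (subst1 D C |`| part_G1 G D |\<union>| subst_imp A B |`| part_G2 G D |\<union>| part_H G D)) \<longleftrightarrow>
      (ipart (v B) = ipart (v A) \<and> v B < v A \<longrightarrow> sat v G)"
  proof -
    have "sat v (subst_imp A B |`| part_G2 G D) \<longleftrightarrow> sat v (part_G2 G D)"
      if "ipart (v B) = ipart (v A)" "v B < v A"
    proof (rule sat_image_cong)
      interpret component_value v A B D using same that by blast
      fix S assume "S |\<in>| part_G2 G D"
      then obtain R z \<Gamma> \<Delta> where S: "S = Cmp R z \<Gamma> \<Delta>" "D \<in># \<Gamma> + \<Delta>" "S |\<in>| G"
        by (rule part_G2_cases)
      have "proper_seq (Cmp R z \<Gamma> \<Delta>)" using proper[OF S(3)] S(1) by simp
      with S(1,2) show "sat_seq v (subst_imp A B S) \<longleftrightarrow> sat_seq v S"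
        using sat_subst_imp[OF D_def] same(3)[OF that] by simp
    qed
    then show ?thesis
      unfolding sat_union sat_not_prec using parts same(2) sat_subst1_LL[of v C D G] by blast
  qed
  have p3: "sat v (not_le A B |\<union>|
      (subst1 D Top |`| part_G1 G D |\<union>| subst1 D Top |`| part_G3 G D |\<union>| part_H G D)) \<longleftrightarrow>
      (v A \<le> v B \<longrightarrow> sat v G)"
  proof -
    have D: "v D = \<infinity>" if "v A \<le> v B" using that by (simp add: vD op_imp_eq_infinity_iff)
    then show ?thesis
      unfolding sat_union sat_not_le using parts Top_subst by blast
  qed
  have "(\<forall>P\<in>set (imp_premises G A B). sat v P) \<longleftrightarrow>
    (ipart (v B) < ipart (v A) \<longrightarrow> sat v G) \<and>
    (ipart (v B) = ipart (v A) \<and> v B < v A \<longrightarrow> sat v G) \<and> (v A \<le> v B \<longrightarrow> sat v G)"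
    unfolding imp_premises_def Let_def D_def[symmetric] C_def[symmetric]
    using p1 p2 p3 by simp
  moreover have "ipart (v B) < ipart (v A) \<or> ipart (v B) = ipart (v A) \<and> v B < v A \<or> v A \<le> v B"
    using less_if_ipart_less[of "v A" "v B"]
    by (cases "ipart (v A)" "ipart (v B)" rule: linorder_cases) auto
  ultimately show ?thesis by auto
qed

end

section \<open>Termination of the reduction\<close>

context
  fixes G :: hyperseq and A B D :: fm
  assumes proper: "\<And>S. S |\<in>| G \<Longrightarrow> proper_seq S"
    and ne: "A \<noteq> D" "B \<noteq> D" "Top \<noteq> D"
begin

text \<open>These are the properties handed down to the premises. \<open>Top\<close> is listed
  because antecedents and substitutions introduce it; being atomic, it precedes the pivot of any
  reducible hypersequent.\<close>

definition smaller :: "fm rseq \<Rightarrow> bool" where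
  "smaller S \<longleftrightarrow> proper_seq S \<and> set_rseq S \<subseteq> formulas G - {D} \<union> {A, B, Top}"

lemma set_rseq_formulas: "S |\<in>| G \<Longrightarrow> set_rseq S \<subseteq> formulas G"
  by (auto simp: formulas_def)

lemma smaller_H: "S |\<in>| part_H G D \<Longrightarrow> smaller S"
  using proper set_rseq_formulas by (auto simp: smaller_def part_H_def)

lemma smaller_subst1:
  assumes "S |\<in>| G" "E \<in> {A, B, Top}"
  shows "smaller (subst1 D E S)"
proof -
  have "proper_seq (subst1 D E S)"
    using proper[OF assms(1)] by (cases S) (simp_all add: subst1_def)
  moreover have "set_rseq (subst1 D E S) \<subseteq> set_rseq S - {D} \<union> {A, B, Top}"
    using assms(2) by (auto simp: subst1_def rseq.set_map)
  ultimately show ?thesis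
    using set_rseq_formulas[OF assms(1)] by (auto simp: smaller_def)
qed

lemma smaller_Cmp:
  assumes "S |\<in>| G" "S = Cmp R z \<Gamma> \<Delta>"
    and "3 \<le> size \<Gamma>' + size \<Delta>'"
    and "set_mset \<Gamma>' \<union> set_mset \<Delta>' \<subseteq> set_mset \<Gamma> \<union> set_mset \<Delta> - {D} \<union> {A, B}"
  shows "smaller (Cmp R z' \<Gamma>' \<Delta>')"
  using set_rseq_formulas[OF assms(1)] assms(2-4) by (auto simp: smaller_def)

lemma smaller_subst2:
  assumes S: "S |\<in>| part_G2 G D"
  shows "smaller (subst2 D A B S)"
proof -
  obtain R z \<Gamma> \<Delta> where S: "S = Cmp R z \<Gamma> \<Delta>" "D \<in># \<Gamma> + \<Delta>" "S |\<in>| G"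
    using S by (rule part_G2_cases)
  show ?thesis
    unfolding S(1) subst2.simps
  proof (rule smaller_Cmp[OF S(3,1)])
    show "3 \<le> size (delete_all D \<Gamma> + repeat_mset (count \<Gamma> D) {#A, B#}) +
        size (delete_all D \<Delta> + repeat_mset (count \<Delta> D) {#A, B#})"
      using size_subst2[of R z \<Gamma> \<Delta> D A B] proper[OF S(3)] S(1,2) by simp
    show "set_mset (delete_all D \<Gamma> + repeat_mset (count \<Gamma> D) {#A, B#}) \<union>
        set_mset (delete_all D \<Delta> + repeat_mset (count \<Delta> D) {#A, B#}) \<subseteq>
        set_mset \<Gamma> \<union> set_mset \<Delta> - {D} \<union> {A, B}"
      by (auto simp: set_mset_delete_all)
  qed
qed

lemma smaller_subst_conj_shift:
  assumes S: "S |\<in>| part_G2 G D" and D: "D = A \<^bold>\<odot> B"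
  shows "smaller (subst_conj_shift A B S)"
proof -
  obtain R z \<Gamma> \<Delta> where S: "S = Cmp R z \<Gamma> \<Delta>" "D \<in># \<Gamma> + \<Delta>" "S |\<in>| G"
    using S by (rule part_G2_cases)
  show ?thesis
    unfolding S(1) subst_conj_shift.simps Let_def D[symmetric]
    by (rule smaller_Cmp[OF S(3,1)]) (auto simp: set_mset_delete_all)
qed

lemma smaller_subst_imp:
  assumes S: "S |\<in>| part_G2 G D" and D: "D = A \<^bold>\<rightarrow> B"
  shows "smaller (subst_imp A B S)"
proof -
  obtain R z \<Gamma> \<Delta> where S: "S = Cmp R z \<Gamma> \<Delta>" "D \<in># \<Gamma> + \<Delta>" "S |\<in>| G"
    using S by (rule part_G2_cases)
  show ?thesis
    unfolding S(1) subst_imp.simps Let_def D[symmetric]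
  proof (rule smaller_Cmp[OF S(3,1)])
    let ?\<Gamma> = "delete_all D \<Gamma> + replicate_mset (count \<Delta> D) A + replicate_mset (count \<Gamma> D) B"
    let ?\<Delta> = "delete_all D \<Delta> + replicate_mset (count \<Gamma> D) A + replicate_mset (count \<Delta> D) B"
    show "3 \<le> size ?\<Gamma> + size ?\<Delta>"
      using size_subst_imp[of R z \<Gamma> \<Delta> D A B] proper[OF S(3)] S(1,2) by simp
    show "set_mset ?\<Gamma> \<union> set_mset ?\<Delta> \<subseteq> set_mset \<Gamma> \<union> set_mset \<Delta> - {D} \<union> {A, B}"
      by (auto simp: set_mset_delete_all)
  qed
qed

lemma part_subset: "S |\<in>| part_G1 G D \<Longrightarrow> S |\<in>| G" "S |\<in>| part_G3 G D \<Longrightarrow> S |\<in>| G"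
  by (auto simp: part_G1_def part_G3_def part_G2_def)

lemmas antecedent_defs =
  not_ll_def not_le_def not_preceq_def not_prec_def not_sim_def not_preceq1_def not_precm1_def

lemma smaller_antecedents:
  assumes "S |\<in>| not_ll A B |\<union>| not_ll B A |\<union>| not_preceq1 A B |\<union>| not_precm1 A B |\<union>|
    not_preceq Top A |\<union>| not_preceq Top B |\<union>| not_prec B A |\<union>| not_le A B"
  shows "smaller S"
  using assms ne by (auto simp: antecedent_defs smaller_def)

lemma least_of_cases: "least_of A B \<in> {A, B, Top}"
  by (simp add: least_of_def)

lemma smaller_conj_premises:
  assumes "D = A \<^bold>\<odot> B" "P \<in> set (conj_premises G A B)" "S |\<in>| P"
  shows "smaller S"
  using assms(2,3) smaller_antecedents[of S] smaller_H smaller_subst1 smaller_subst2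
    smaller_subst_conj_shift[OF _ assms(1)] part_subset least_of_cases
  unfolding conj_premises_def Let_def assms(1)[symmetric] by auto

lemma smaller_imp_premises:
  assumes "D = A \<^bold>\<rightarrow> B" "P \<in> set (imp_premises G A B)" "S |\<in>| P"
  shows "smaller S"
  using assms(2,3) smaller_antecedents[of S] smaller_H smaller_subst1
    smaller_subst_imp[OF _ assms(1)] part_subset least_of_cases
  unfolding imp_premises_def Let_def assms(1)[symmetric] by auto

end

definition admissible :: "fm set \<Rightarrow> hyperseq \<Rightarrow> bool" where
  "admissible U G \<longleftrightarrow> (\<forall>S. S |\<in>| G \<longrightarrow> proper_seq S) \<and> formulas G \<subseteq> U"

text \<open>The measure decreases because all formulas of a premise strictly precede the pivot.\<close>

definition formulas_below :: "fm set \<Rightarrow> hyperseq \<Rightarrow> fm set" where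
  "formulas_below U G = {E \<in> U. \<exists>F\<in>formulas G. E = F \<or> E <\<^sub>c F}"

text \<open>All labels of one reduction draw their formulas from such a set, and its finiteness
  makes the cardinality of \<open>formulas_below\<close> a usable measure.\<close>

locale subformula_closed =
  fixes U :: "fm set"
  assumes finite: "finite U" and Top: "Top \<in> U"
    and Conj: "A \<^bold>\<odot> B \<in> U \<Longrightarrow> A \<in> U \<and> B \<in> U"
    and Imp: "A \<^bold>\<rightarrow> B \<in> U \<Longrightarrow> A \<in> U \<and> B \<in> U"
begin

lemma rule_premises:
  assumes G: "admissible U G" and red: "\<not> irreducible_hs G"
  shows "rule_premises G \<noteq> []"
    and "valuation v \<Longrightarrow> (\<forall>P\<in>set (rule_premises G). sat v P) \<longleftrightarrow> sat v G"
    and "P \<in> set (rule_premises G) \<Longrightarrow> admissible U P"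
    and "P \<in> set (rule_premises G) \<Longrightarrow> card (formulas_below U P) < card (formulas_below U G)"
proof -
  define D where "D = pivot G"
  have D: "D \<in> formulas G" "\<And>E. E \<in> formulas G \<Longrightarrow> E \<noteq> D \<Longrightarrow> E <\<^sub>c D" "\<not> atomic D"
    using pivot pivot_nonatomic[OF red] by (auto simp: D_def)
  have DU: "D \<in> U" using D(1) G by (auto simp: admissible_def)
  have proper: "\<And>S. S |\<in>| G \<Longrightarrow> proper_seq S" using G by (simp add: admissible_def)
  have TopD: "Top <\<^sub>c D" using D(3) by (simp add: less_c_def atomic_iff_complexity)
  obtain A B where rule: "D = A \<^bold>\<odot> B \<and> rule_premises G = conj_premises G A B \<or>
      D = A \<^bold>\<rightarrow> B \<and> rule_premises G = imp_premises G A B"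
    using D(3) by (cases D) (auto simp: atomic_def rule_premises_def D_def[symmetric])
  have "A \<in> U \<and> B \<in> U" using rule DU Conj[of A B] Imp[of A B] by metis
  moreover have "complexity A < complexity D \<and> complexity B < complexity D"
    using rule D(3) by (elim disjE) (simp_all add: atomic_def)
  ultimately have AB: "A <\<^sub>c D" "B <\<^sub>c D" "A \<in> U" "B \<in> U" by (simp_all add: less_c_def)
  have ne: "A \<noteq> D" "B \<noteq> D" "Top \<noteq> D" using AB TopD less_c_irrefl by auto
  show "rule_premises G \<noteq> []"
    using rule by (auto simp: conj_premises_def imp_premises_def Let_def)
  show "(\<forall>P\<in>set (rule_premises G). sat v P) \<longleftrightarrow> sat v G" if v: "valuation v" for v
    using rule conj_rule_sound[of v G A B, OF v proper] imp_rule_sound[of v G A B, OF v proper]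
    by (elim disjE) simp_all
  have small: "proper_seq S \<and> set_rseq S \<subseteq> formulas G - {D} \<union> {A, B, Top}"
    if P: "P \<in> set (rule_premises G)" and S: "S |\<in>| P" for P S
    using rule
  proof
    assume "D = A \<^bold>\<odot> B \<and> rule_premises G = conj_premises G A B"
    then have "smaller G A B D S" using smaller_conj_premises[OF proper ne _ _ S] P by simp
    then show ?thesis by (simp add: smaller_def[OF proper ne])
  next
    assume "D = A \<^bold>\<rightarrow> B \<and> rule_premises G = imp_premises G A B"
    then have "smaller G A B D S" using smaller_imp_premises[OF proper ne _ _ S] P by simp
    then show ?thesis by (simp add: smaller_def[OF proper ne])
  qed
  have formulas: "formulas P \<subseteq> formulas G - {D} \<union> {A, B, Top}" if "P \<in> set (rule_premises G)" for P
    using small[OF that] unfolding formulas_def by blast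
  show "admissible U P" if "P \<in> set (rule_premises G)" for P
    unfolding admissible_def
  proof (intro conjI allI impI)
    show "proper_seq S" if "S |\<in>| P" for S using small[OF \<open>P \<in> set (rule_premises G)\<close> that] by blast
    have "formulas G - {D} \<union> {A, B, Top} \<subseteq> U" using G AB Top by (auto simp: admissible_def)
    with formulas[OF that] show "formulas P \<subseteq> U" by (rule subset_trans)
  qed
  assume "P \<in> set (rule_premises G)"
  then have less: "F <\<^sub>c D" if "F \<in> formulas P" for F
    using formulas[of P] that D(2) AB(1,2) TopD by blast
  have "formulas_below U P \<subset> formulas_below U G"
  proof
    show "formulas_below U P \<subseteq> formulas_below U G"
    proof
      fix E assume "E \<in> formulas_below U P"
      then obtain F where F: "E \<in> U" "F \<in> formulas P" "E = F \<or> E <\<^sub>c F" by (auto simp: formulas_below_def)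
      then have "E <\<^sub>c D" using less[OF F(2)] less_c_trans[of E F D] by auto
      then show "E \<in> formulas_below U G" using F(1) D(1) by (auto simp: formulas_below_def)
    qed
    have "D \<notin> formulas_below U P"
      using less less_c_trans[of D _ D] less_c_irrefl[of D] by (auto simp: formulas_below_def)
    moreover have "D \<in> formulas_below U G" using D(1) DU by (auto simp: formulas_below_def)
    ultimately show "formulas_below U P \<noteq> formulas_below U G" by auto
  qed
  then show "card (formulas_below U P) < card (formulas_below U G)"
    using finite by (intro psubset_card_mono) (auto simp: formulas_below_def)
qed

text \<open>A reducible leaf disappears only if it really receives children;
  \<open>rule_premises\<close> guarantees this for admissible labels.\<close>

lemma leaves_expand:
  assumes "\<And>G. G \<in> leaves t \<Longrightarrow> admissible U G"
  shows "leaves (expand t) =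
    (\<Union>G\<in>leaves t. if irreducible_hs G then {G} else set (rule_premises G))"
  using assms
proof (induction t rule: expand.induct)
  case (1 G ts)
  show ?case
  proof (cases "ts = []")
    case True
    then have "admissible U G" using 1(2) by simp
    then have "rule_premises G \<noteq> []" if "\<not> irreducible_hs G" using that by (rule rule_premises(1))
    then show ?thesis using True by (cases "irreducible_hs G") simp_all
  next
    case False
    have "leaves (expand t) = (\<Union>G\<in>leaves t. if irreducible_hs G then {G} else set (rule_premises G))"
      if "t \<in> set ts" for t
    proof (rule 1(1)[OF False that])
      show "admissible U P" if "P \<in> leaves t" for P
        using 1(2)[of P] False that \<open>t \<in> set ts\<close> by auto
    qed
    then have "(\<Union>t\<in>set ts. leaves (expand t)) =
        (\<Union>t\<in>set ts. \<Union>G\<in>leaves t. if irreducible_hs G then {G} else set (rule_premises G))"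
      by (rule SUP_cong[OF refl])
    then show ?thesis using False by (simp only: expand.simps leaves.simps if_False map_is_Nil_conv
      set_map UN_simps)
  qed
qed

text \<open>The loop invariant. Being stated for each valuation separately, it passes through
  \<open>expand\<close> leaf by leaf; validity is formed only after the loop has ended.\<close>

definition reduces :: "hyperseq \<Rightarrow> tree \<Rightarrow> bool" where
  "reduces G t \<longleftrightarrow> (\<forall>P\<in>leaves t. admissible U P) \<and>
    (\<forall>v. valuation v \<longrightarrow> (\<forall>P\<in>leaves t. sat v P) = sat v G)"

lemma reduces_expand:
  assumes "reduces G t"
  shows "reduces G (expand t)"
proof -
  have adm: "\<And>P. P \<in> leaves t \<Longrightarrow> admissible U P"
    and eq: "\<And>v. valuation v \<Longrightarrow> (\<forall>P\<in>leaves t. sat v P) = sat v G"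
    using assms by (auto simp: reduces_def)
  have leaves: "leaves (expand t) =
      (\<Union>Q\<in>leaves t. if irreducible_hs Q then {Q} else set (rule_premises Q))"
    by (rule leaves_expand) (rule adm)
  have "admissible U P" if "P \<in> leaves (expand t)" for P
    using that adm rule_premises(3) unfolding leaves by (auto split: if_splits)
  moreover have "(\<forall>P\<in>leaves (expand t). sat v P) = sat v G" if "valuation v" for v
  proof -
    have "(\<forall>P\<in>(if irreducible_hs Q then {Q} else set (rule_premises Q)). sat v P) \<longleftrightarrow> sat v Q"
      if "Q \<in> leaves t" for Q
      using rule_premises(2)[OF adm[OF that] _ \<open>valuation v\<close>] by simp
    then have "(\<forall>P\<in>leaves (expand t). sat v P) \<longleftrightarrow> (\<forall>Q\<in>leaves t. sat v Q)"
      unfolding leaves ball_UN by (rule ball_cong[OF refl])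
    then show ?thesis using eq[OF \<open>valuation v\<close>] by (rule trans)
  qed
  ultimately show ?thesis by (simp add: reduces_def)
qed

text \<open>A round expands all reducible leaves at once, so a strict bound n on their measures
  drops by one per round and also bounds the number of rounds.\<close>

lemma reduction_terminates:
  assumes "reduces G t"
    and "\<And>P. P \<in> leaves t \<Longrightarrow> \<not> irreducible_hs P \<Longrightarrow> card (formulas_below U P) < n"
  shows "\<exists>t'. while_option (\<lambda>t. \<exists>G \<in> leaves t. \<not> irreducible_hs G) expand t = Some t'"
  using assms
proof (induction n arbitrary: t)
  case 0
  then show ?case by (subst while_option_unfold) auto
next
  case (Suc n)
  have adm: "\<And>P. P \<in> leaves t \<Longrightarrow> admissible U P" using Suc.prems(1) by (simp add: reduces_def)
  have leaves: "leaves (expand t) =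
      (\<Union>Q\<in>leaves t. if irreducible_hs Q then {Q} else set (rule_premises Q))"
    by (rule leaves_expand) (rule adm)
  have "card (formulas_below U P) < n" if P: "P \<in> leaves (expand t)" "\<not> irreducible_hs P" for P
  proof -
    obtain Q where Q: "Q \<in> leaves t" "\<not> irreducible_hs Q" "P \<in> set (rule_premises Q)"
      using P unfolding leaves by (auto split: if_splits)
    then show ?thesis
      using rule_premises(4)[OF adm[OF Q(1)] Q(2,3)] Suc.prems(2)[OF Q(1,2)] by simp
  qed
  then have "\<exists>t'. while_option (\<lambda>t. \<exists>G \<in> leaves t. \<not> irreducible_hs G) expand (expand t) = Some t'"
    by (rule Suc.IH[OF reduces_expand[OF Suc.prems(1)]])
  then show ?case by (subst while_option_unfold) simp
qed

lemma reduction_valid: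
  assumes "admissible U G"
  shows "\<exists>t. while_option (\<lambda>t. \<exists>G \<in> leaves t. \<not> irreducible_hs G) expand (Node G []) = Some t \<and>
    ((\<forall>P\<in>leaves t. valid P) \<longleftrightarrow> valid G)"
proof -
  let ?b = "\<lambda>t. \<exists>G \<in> leaves t. \<not> irreducible_hs G"
  have init: "reduces G (Node G [])" using assms by (simp add: reduces_def)
  then obtain t where t: "while_option ?b expand (Node G []) = Some t"
    using reduction_terminates[OF init, of "Suc (card (formulas_below U G))"] by auto
  have "reduces G t"
    by (rule while_option_rule[where P = "reduces G", OF _ t init]) (rule reduces_expand)
  then have "(\<forall>P\<in>leaves t. valid P) \<longleftrightarrow> valid G"
    unfolding reduces_def valid_def by metis
  then show ?thesis using t by blast
qed

end

lemma mem_BL_TAUT: "encode A \<in> BL_TAUT \<longleftrightarrow> BL \<turnstile> A"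
  using inj_encode by (auto simp: BL_TAUT_def inj_eq)

lemma valid_root: "valid {| Top \<preceq>\<^sub>0 A |} \<longleftrightarrow> tautology A"
proof -
  have "sat v {| Top \<preceq>\<^sub>0 A |} \<longleftrightarrow> v A = \<infinity>" if v: "valuation v" for v
    using ipart_eq_infinity_iff[OF v_nonneg[OF v, of A]] v_Top[OF v]
    by (auto simp: sat_insert)
  then show ?thesis by (auto simp: valid_def tautology_def)
qed

theorem theorem5p1:
  fixes A :: fm
  shows "encode A \<in> BL_TAUT \<longleftrightarrow> check_tautology (encode A) = Some Yes"
proof -
  \<comment> \<open>Premises may introduce \<open>Top\<close>, and closure under subformulas then
    calls for \<open>Bot\<close>.\<close>
  define U where "U = insert Top (insert Bot (subformulas A))"
  interpret subformula_closed U
  proof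
    show "finite U" by (simp add: U_def finite_subformulas)
    show "Top \<in> U" by (simp add: U_def)
    show "B \<in> U \<and> C \<in> U" if "B \<^bold>\<odot> C \<in> U" for B C
      using that subformulas_trans[of "B \<^bold>\<odot> C" A] subformulas_self[of B] subformulas_self[of C]
      by (auto simp: U_def)
    show "B \<in> U \<and> C \<in> U" if "B \<^bold>\<rightarrow> C \<in> U" for B C
      using that subformulas_trans[of "B \<^bold>\<rightarrow> C" A] subformulas_self[of B] subformulas_self[of C]
      by (auto simp: U_def)
  qed
  have "admissible U {| Top \<preceq>\<^sub>0 A |}"
    using subformulas_self[of A] by (simp add: admissible_def formulas_def U_def)
  from reduction_valid[OF this] obtain t where
    "build_reduction A = Some t" "(\<forall>P\<in>leaves t. valid P) \<longleftrightarrow> valid {| Top \<preceq>\<^sub>0 A |}"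
    unfolding build_reduction_def by blast
  then have "check_tautology (encode A) = Some Yes \<longleftrightarrow> tautology A"
    by (simp add: check_tautology_def the_inv_f_f[OF inj_encode] valid_root)
  then show ?thesis by (simp add: mem_BL_TAUT BL_complete)
qed

end
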